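(* Let $\mathfrak g$ be any simple Lie algebra of rank $r$. For every integer $k\ge 1$, every dominant integral weight $\lambda=\sum_{\alpha\in I_r} l_\alpha\omega_\alpha$ ($l_\alpha\in\mathbb Z_{\ge0}$) and every collection of non-negative integers $\mathbf n=\{n_{\alpha,i}\}$ with $\alpha\in I_r$, $1\le i\le t_\alpha k$ (and $n_{\alpha,i}=0$ for $i>t_\alpha k$), $$M^{(k)}_{\lambda,\mathbf n}=N^{(k)}_{\lambda,\mathbf n},$$ where $$N^{(k)}_{\lambda,\mathbf n}=\sum_{\mathbf m:\ q_\alpha=0\ \forall\alpha}\ \prod_{\alpha\in I_r}\prod_{i=1}^{t_\alpha k}\binom{m_{\alpha,i}+p_{\alpha,i}}{m_{\alpha,i}},\qquad M^{(k)}_{\lambda,\mathbf n}=\sum_{\substack{\mathbf m:\ q_\alpha=0\ \forall\alpha\\ p_{\alpha,i}\ge0\ \forall\alpha,i}}\ \prod_{\alpha\in I_r}\prod_{i=1}^{t_\alpha k}\binom{m_{\alpha,i}+p_{\alpha,i}}{m_{\alpha,i}},$$ both sums being over collections $\mathbf m=\{m_{\alpha,i}\}_{\alpha\in I_r,\,1\le i\le t_\alpha k}$ of non-negative integers satisfying the indicated restrictions.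
   Context: $I_r=\{1,\dots,r\}$ indexes the simple roots $\alpha_1,\dots,\alpha_r$ of $\mathfrak g$; the Cartan matrix is $C_{\alpha,\beta}=2(\alpha_\alpha,\alpha_\beta)/(\alpha_\alpha,\alpha_\alpha)$; $\omega_\alpha$ are the fundamental weights. $t_\alpha=1$ for long roots (and for all roots when $\mathfrak g$ is simply-laced), $t_\alpha=2$ for the short simple roots of $B_r,C_r,F_4$, and $t_\alpha=3$ for the short simple root of $G_2$. Given $\lambda,\mathbf n,\mathbf m$ (with $m_{\alpha,i}=n_{\alpha,i}=0$ for $i>t_\alpha k$), the total spins and vacancy numbers are $$q_\alpha=l_\alpha+\sum_{\beta,i} i\,C_{\alpha,\beta}\,m_{\beta,i}-\sum_i i\,n_{\alpha,i},$$ $$p_{\alpha,i}=\sum_{j\ge1} \min(i,j)\,n_{\alpha,j}-\sum_{\beta\in I_r}\operatorname{sgn}(C_{\alpha,\beta})\sum_{j\ge1}\min(|C_{\alpha,\beta}|j,\,|C_{\beta,\alpha}|i)\,m_{\beta,j}.$$ For $m\in\mathbb Z_{\ge0}$ and any $p\in\mathbb Z$ (possibly negative), $\binom{m+p}{m}=\frac{(p+m)(p+m-1)\cdots(p+1)}{m!}$. The condition $q_\alpha=0$ for all $\alpha$ leaves only finitely many $\mathbf m$. *)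

theory Defs
  imports Complex_Main
begin

section \<open>Simple complex Lie algebras and their simple roots\<close>

text \<open>
  The fixed basis \<open>Basis\<close> only witnesses finite dimension and is used to compute traces; no
  notion below depends on its choice.
\<close>

locale lie_algebra = finite_dimensional_vector_space scale Basis
  for scale :: "complex \<Rightarrow> 'g::ab_group_add \<Rightarrow> 'g" and Basis :: "'g set" +
  fixes br :: "'g \<Rightarrow> 'g \<Rightarrow> 'g"
  assumes br_add_left: "br (x + y) z = br x z + br y z"
    and br_add_right: "br x (y + z) = br x y + br x z"
    and br_scale_left: "br (scale c x) y = scale c (br x y)"
    and br_scale_right: "br x (scale c y) = scale c (br x y)"
    and br_self: "br x x = 0"
    and jacobi: "br x (br y z) + br y (br z x) + br z (br x y) = 0"
begin

definition lie_ideal :: "'g set \<Rightarrow> bool" where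
  "lie_ideal I \<longleftrightarrow> subspace I \<and> (\<forall>x. \<forall>y\<in>I. br x y \<in> I)"

definition trace :: "('g \<Rightarrow> 'g) \<Rightarrow> complex" where
  "trace f = (\<Sum>b\<in>Basis. representation Basis (f b) b)"

definition killing :: "'g \<Rightarrow> 'g \<Rightarrow> complex" where
  "killing x y = trace (\<lambda>z. br x (br y z))"

text \<open>
  Cartan subalgebras in the form appropriate to semisimple algebras: commutative, equal to their
  own centralizer, and acting diagonalizably (the eigenvectors of each \<open>ad h\<close> span).
\<close>

definition cartan_subalgebra :: "'g set \<Rightarrow> bool" where
  "cartan_subalgebra H \<longleftrightarrow>
     subspace H \<and>
     (\<forall>x\<in>H. \<forall>y\<in>H. br x y = 0) \<and>
     (\<forall>x. (\<forall>h\<in>H. br h x = 0) \<longrightarrow> x \<in> H) \<and>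
     (\<forall>h\<in>H. span {x. \<exists>c. br h x = scale c x} = UNIV)"

text \<open>
  A linear functional on \<open>H\<close> is represented by a function that is linear on \<open>H\<close> and zero outside
  \<open>H\<close>, so that equal functionals are equal functions.
\<close>

definition dual :: "'g set \<Rightarrow> ('g \<Rightarrow> complex) set" where
  "dual H = {\<phi>. (\<forall>x\<in>H. \<forall>y\<in>H. \<phi> (x + y) = \<phi> x + \<phi> y) \<and>
                 (\<forall>c. \<forall>x\<in>H. \<phi> (scale c x) = c * \<phi> x) \<and>
                 (\<forall>x. x \<notin> H \<longrightarrow> \<phi> x = 0)}"

definition root_space :: "'g set \<Rightarrow> ('g \<Rightarrow> complex) \<Rightarrow> 'g set" where
  "root_space H \<phi> = {x. \<forall>h\<in>H. br h x = scale (\<phi> h) x}"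

definition roots :: "'g set \<Rightarrow> ('g \<Rightarrow> complex) set" where
  "roots H = {\<phi> \<in> dual H. \<phi> \<noteq> (\<lambda>_. 0) \<and> root_space H \<phi> \<noteq> {0}}"

text \<open>
  The form on the dual of \<open>H\<close> transported from the Killing form, which is nondegenerate on a
  Cartan subalgebra \<open>H\<close> of a simple Lie algebra.
\<close>

definition dual_vec :: "'g set \<Rightarrow> ('g \<Rightarrow> complex) \<Rightarrow> 'g" where
  "dual_vec H \<phi> = (THE u. u \<in> H \<and> (\<forall>h\<in>H. killing u h = \<phi> h))"

definition dual_form :: "'g set \<Rightarrow> ('g \<Rightarrow> complex) \<Rightarrow> ('g \<Rightarrow> complex) \<Rightarrow> complex" where
  "dual_form H \<phi> \<psi> = killing (dual_vec H \<phi>) (dual_vec H \<psi>)"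

definition simple_roots :: "'g set \<Rightarrow> nat \<Rightarrow> (nat \<Rightarrow> 'g \<Rightarrow> complex) \<Rightarrow> bool" where
  "simple_roots H r \<alpha> \<longleftrightarrow>
     (\<forall>a\<in>{1..r}. \<alpha> a \<in> roots H) \<and>
     (\<forall>c :: nat \<Rightarrow> complex. (\<forall>h\<in>H. (\<Sum>a=1..r. c a * \<alpha> a h) = 0) \<longrightarrow> (\<forall>a\<in>{1..r}. c a = 0)) \<and>
     (\<forall>\<beta>\<in>roots H. \<exists>c :: nat \<Rightarrow> int.
        ((\<forall>a\<in>{1..r}. c a \<ge> 0) \<or> (\<forall>a\<in>{1..r}. c a \<le> 0)) \<and>
        (\<forall>h\<in>H. \<beta> h = (\<Sum>a=1..r. of_int (c a) * \<alpha> a h)))"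

text \<open>
  On roots the form takes real values, positive on the diagonal, and the quotients below are
  integers; \<open>Re\<close> and the floor only change the type.
\<close>

definition cartan_matrix :: "'g set \<Rightarrow> (nat \<Rightarrow> 'g \<Rightarrow> complex) \<Rightarrow> nat \<Rightarrow> nat \<Rightarrow> int" where
  "cartan_matrix H \<alpha> a b = \<lfloor>Re (2 * dual_form H (\<alpha> a) (\<alpha> b) / dual_form H (\<alpha> a) (\<alpha> a))\<rfloor>"

text \<open>
  Every root has the length of some simple root, so it suffices to compare with simple roots.
\<close>

definition long_root :: "'g set \<Rightarrow> nat \<Rightarrow> (nat \<Rightarrow> 'g \<Rightarrow> complex) \<Rightarrow> nat \<Rightarrow> bool" where
  "long_root H r \<alpha> a \<longleftrightarrow>
     (\<forall>b\<in>{1..r}. Re (dual_form H (\<alpha> b) (\<alpha> b)) \<le> Re (dual_form H (\<alpha> a) (\<alpha> a)))"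

definition type_G2 :: "'g set \<Rightarrow> nat \<Rightarrow> (nat \<Rightarrow> 'g \<Rightarrow> complex) \<Rightarrow> bool" where
  "type_G2 H r \<alpha> \<longleftrightarrow> r = 2 \<and>
     (cartan_matrix H \<alpha> 1 2 = - 1 \<and> cartan_matrix H \<alpha> 2 1 = - 3 \<or>
      cartan_matrix H \<alpha> 1 2 = - 3 \<and> cartan_matrix H \<alpha> 2 1 = - 1)"

text \<open>
  Short simple roots occur only in types B, C, F4 (value 2) and G2 (value 3).
\<close>

definition root_t :: "'g set \<Rightarrow> nat \<Rightarrow> (nat \<Rightarrow> 'g \<Rightarrow> complex) \<Rightarrow> nat \<Rightarrow> nat" where
  "root_t H r \<alpha> a = (if long_root H r \<alpha> a then 1 else if type_G2 H r \<alpha> then 3 else 2)"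

end

locale simple_lie_algebra = lie_algebra +
  assumes nonabelian: "\<exists>x y. br x y \<noteq> 0"
    and no_ideals: "lie_ideal I \<Longrightarrow> I = {0} \<or> I = UNIV"


section \<open>Fermionic sums\<close>

text \<open>
  Collections of nonnegative integers indexed by \<open>a \<in> {1..r}\<close> and \<open>1 \<le> i \<le> t a * k\<close> are functions
  vanishing at all other indices. The dominant integral weight \<open>\<lambda>\<close> is given by its coefficients
  \<open>l a\<close> with respect to the fundamental weights.
\<close>

definition collections :: "nat \<Rightarrow> (nat \<Rightarrow> nat) \<Rightarrow> nat \<Rightarrow> (nat \<Rightarrow> nat \<Rightarrow> nat) set" where
  "collections r t k = {m. \<forall>a i. \<not> (a \<in> {1..r} \<and> i \<in> {1..t a * k}) \<longrightarrow> m a i = 0}"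

definition total_spin ::
  "nat \<Rightarrow> (nat \<Rightarrow> nat \<Rightarrow> int) \<Rightarrow> (nat \<Rightarrow> nat) \<Rightarrow> nat \<Rightarrow> (nat \<Rightarrow> nat) \<Rightarrow> (nat \<Rightarrow> nat \<Rightarrow> nat) \<Rightarrow>
   (nat \<Rightarrow> nat \<Rightarrow> nat) \<Rightarrow> nat \<Rightarrow> int" where
  "total_spin r C t k l n m a =
     int (l a) + (\<Sum>b=1..r. \<Sum>i=1..t b * k. int i * C a b * int (m b i))
     - (\<Sum>i=1..t a * k. int i * int (n a i))"

definition vacancy ::
  "nat \<Rightarrow> (nat \<Rightarrow> nat \<Rightarrow> int) \<Rightarrow> (nat \<Rightarrow> nat) \<Rightarrow> nat \<Rightarrow> (nat \<Rightarrow> nat \<Rightarrow> nat) \<Rightarrow>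
   (nat \<Rightarrow> nat \<Rightarrow> nat) \<Rightarrow> nat \<Rightarrow> nat \<Rightarrow> int" where
  "vacancy r C t k n m a i =
     (\<Sum>j=1..t a * k. int (min i j) * int (n a j))
     - (\<Sum>b=1..r. sgn (C a b) *
          (\<Sum>j=1..t b * k. min (\<bar>C a b\<bar> * int j) (\<bar>C b a\<bar> * int i) * int (m b j)))"

text \<open>
  \<open>x gchoose m\<close> is \<open>x (x - 1) \<dots> (x - m + 1) / m!\<close>, here with \<open>x = m + p\<close> and \<open>p\<close> possibly negative.
\<close>

definition weight_product ::
  "nat \<Rightarrow> (nat \<Rightarrow> nat \<Rightarrow> int) \<Rightarrow> (nat \<Rightarrow> nat) \<Rightarrow> nat \<Rightarrow> (nat \<Rightarrow> nat \<Rightarrow> nat) \<Rightarrow>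
   (nat \<Rightarrow> nat \<Rightarrow> nat) \<Rightarrow> rat" where
  "weight_product r C t k n m =
     (\<Prod>a=1..r. \<Prod>i=1..t a * k.
        of_int (int (m a i) + vacancy r C t k n m a i) gchoose m a i)"

text \<open>
  Both index sets are finite because a Cartan matrix of a simple Lie algebra is invertible.
\<close>

definition N_sum ::
  "nat \<Rightarrow> (nat \<Rightarrow> nat \<Rightarrow> int) \<Rightarrow> (nat \<Rightarrow> nat) \<Rightarrow> nat \<Rightarrow> (nat \<Rightarrow> nat) \<Rightarrow> (nat \<Rightarrow> nat \<Rightarrow> nat) \<Rightarrow> rat" where
  "N_sum r C t k l n =
     (\<Sum>m\<in>{m \<in> collections r t k. \<forall>a\<in>{1..r}. total_spin r C t k l n m a = 0}.
        weight_product r C t k n m)"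

definition M_sum ::
  "nat \<Rightarrow> (nat \<Rightarrow> nat \<Rightarrow> int) \<Rightarrow> (nat \<Rightarrow> nat) \<Rightarrow> nat \<Rightarrow> (nat \<Rightarrow> nat) \<Rightarrow> (nat \<Rightarrow> nat \<Rightarrow> nat) \<Rightarrow> rat" where
  "M_sum r C t k l n =
     (\<Sum>m\<in>{m \<in> collections r t k. (\<forall>a\<in>{1..r}. total_spin r C t k l n m a = 0) \<and>
              (\<forall>a\<in>{1..r}. \<forall>i\<in>{1..t a * k}. vacancy r C t k n m a i \<ge> 0)}.
        weight_product r C t k n m)"

end

(*
  Summing the binomial coefficients over the m_{a,i} in the order of increasing i / t_a turns the
  generating function of the fermionic sum into a product of powers of the solution Q_{a,i} of the
  Q-system with Q_{a,0} = 1 and Q_{a,1} = 1 / u_a. Group the configurations violating the positivity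
  conditions by the largest time i / t_a at which some vacancy number p_{a,i} is negative and by the
  values of m at later times. The contribution of each group is the constant term of Q_{a,1} times
  nonnegative powers of the Q_{a,j} and arbitrary powers of the Q_{b,j} with b different from a, so it
  vanishes if Q_{b,j} has no positive powers of u_a for any b, that is, if the Q_{b,j} are polynomials
  in the initial data Q_{a,1}.

  Polynomiality is proved for the T-system, which has independent initial data T_{a,1}(s), s in Z, and
  specializes to the Q-system. Modulo T_{a,n-1} the numerator of the recursion for T_{a,n+1} vanishes
  after multiplication by a product of T's of other colours, and T's of different colours are
  relatively prime since each is linear in an extremal variable that the other does not contain.

  On the Lie algebra side it suffices that the Cartan matrix is an indecomposable matrix of finite
  type. Rationality of the root strings makes the Killing form nondegenerate and positive definite on
  the real span of the roots, which bounds the products of off-diagonal entries and the number of root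
  lengths.
*)
theory Submission
  imports Defs "HOL-Library.Poly_Mapping" "HOL-Library.Product_Lexorder"
    "HOL-Computational_Algebra.Polynomial" "HOL-Computational_Algebra.Formal_Laurent_Series"
begin

section \<open>Polynomials in arbitrarily many variables\<close>

text \<open>On configurations with q = 0, p may be replaced by p + q, in which every minimum becomes
  a positive part. A vacancy number then depends only on later multiplicities, and q is its value at
  i = 0; this triangularity permits elimination in time order. The last violation is singled out
  because of signs. Abel summation in its colour turns the exponents into second differences 2 p_j -
  p_{j-1} - p_{j+1}, nonnegative by concavity, and boundary factors Q_s^(p_{s+1}+1) and
  Q_{s+1}^(-p_s-1), whose exponents are nonnegative when p_s < 0 <= p_{s+1}. In the Q-system the few
  initial variables enter all Q's at once and give no handle on common factors. The shifts s spread
  the initial data along a line: the leftmost variable of T_{a,n}(s) is absent from every T of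
  another colour starting no further left. Constant terms are taken in nested one-variable Laurent
  series: one variable for the colour of the violation and one for all other colours, entering with
  integer exponents that separate the finitely many spin vectors. On the Lie algebra side,
  integrality of weights replaces Cartan's criterion.\<close>

type_synonym 'v mpol = "('v \<Rightarrow>\<^sub>0 nat) \<Rightarrow>\<^sub>0 int"

text \<open>Polynomials are treated as the free abelian group on the monomials, so that
  \<open>frag_induction\<close> acts as induction on polynomials: an additive identity is checked on
  \<open>frag_of m\<close> only.\<close>

definition mvar :: "'v \<Rightarrow> 'v mpol" where
  "mvar v = frag_of (Poly_Mapping.single v 1)"

definition monom_eval :: "('v \<Rightarrow> 'b::comm_ring_1) \<Rightarrow> ('v \<Rightarrow>\<^sub>0 nat) \<Rightarrow> 'b" where
  "monom_eval \<rho> m = (\<Prod>v\<in>Poly_Mapping.keys m. \<rho> v ^ Poly_Mapping.lookup m v)"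

definition mpol_eval :: "('v \<Rightarrow> 'b::comm_ring_1) \<Rightarrow> 'v mpol \<Rightarrow> 'b" where
  "mpol_eval \<rho> p = (\<Sum>m\<in>Poly_Mapping.keys p. of_int (Poly_Mapping.lookup p m) * monom_eval \<rho> m)"

lemma monom_eval_superset:
  assumes "finite A" "Poly_Mapping.keys m \<subseteq> A"
  shows "monom_eval \<rho> m = (\<Prod>v\<in>A. \<rho> v ^ Poly_Mapping.lookup m v)"
  unfolding monom_eval_def
  by (rule prod.mono_neutral_left) (use assms in \<open>auto simp: in_keys_iff\<close>)

lemma monom_eval_add: "monom_eval \<rho> (m + m') = monom_eval \<rho> m * monom_eval \<rho> m'"
proof -
  let ?A = "Poly_Mapping.keys m \<union> Poly_Mapping.keys m'"
  have "Poly_Mapping.keys (m + m') \<subseteq> ?A"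
    by (rule Poly_Mapping.keys_add)
  then show ?thesis
    by (simp add: monom_eval_superset[of ?A] lookup_add power_add prod.distrib)
qed

lemma mpol_eval_superset:
  assumes "finite A" "Poly_Mapping.keys p \<subseteq> A"
  shows "mpol_eval \<rho> p = (\<Sum>m\<in>A. of_int (Poly_Mapping.lookup p m) * monom_eval \<rho> m)"
  unfolding mpol_eval_def
  by (rule sum.mono_neutral_left) (use assms in \<open>auto simp: in_keys_iff\<close>)

lemma mpol_eval_diff: "mpol_eval \<rho> (p - q) = mpol_eval \<rho> p - mpol_eval \<rho> q"
proof -
  let ?A = "Poly_Mapping.keys p \<union> Poly_Mapping.keys q"
  have "Poly_Mapping.keys (p - q) \<subseteq> ?A"
    by (rule keys_diff)
  then show ?thesis
    by (simp add: mpol_eval_superset[of ?A] lookup_minus left_diff_distrib sum_subtractf)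
qed

lemma mpol_eval_frag_of: "mpol_eval \<rho> (frag_of m) = monom_eval \<rho> m"
  by (simp add: mpol_eval_def keys_frag_of)

lemma mpol_eval_0 [simp]: "mpol_eval \<rho> 0 = 0"
  by (simp add: mpol_eval_def)

lemma mpol_eval_mult: "mpol_eval \<rho> (p * q) = mpol_eval \<rho> p * mpol_eval \<rho> q"
proof -
  have step: "mpol_eval \<rho> (frag_of m * q) = monom_eval \<rho> m * mpol_eval \<rho> q" for m
  proof -
    have "Poly_Mapping.keys q \<subseteq> UNIV" by simp
    then show ?thesis
    proof (induction q rule: frag_induction)
      case (one m')
      have "frag_of m * frag_of m' = frag_of (m + m')"
        by (simp add: mult_single)
      then show ?case
        by (simp add: mpol_eval_frag_of monom_eval_add)
    qed (simp_all add: right_diff_distrib mpol_eval_diff)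
  qed
  have "Poly_Mapping.keys p \<subseteq> UNIV" by simp
  then show ?thesis
    by (induction p rule: frag_induction)
      (simp_all add: left_diff_distrib mpol_eval_diff step mpol_eval_frag_of)
qed

lemma mpol_eval_1 [simp]:
  fixes \<rho> :: "'v \<Rightarrow> 'b::comm_ring_1"
  shows "mpol_eval \<rho> 1 = 1"
proof -
  have "mpol_eval \<rho> 1 = mpol_eval \<rho> (frag_of 0)"
    by simp
  also have "\<dots> = 1"
    unfolding mpol_eval_frag_of by (simp add: monom_eval_def)
  finally show ?thesis .
qed

lemma mpol_eval_add: "mpol_eval \<rho> (p + q) = mpol_eval \<rho> p + mpol_eval \<rho> q"
  using mpol_eval_diff[of \<rho> p "0 - q"] mpol_eval_diff[of \<rho> 0 q] by simp

lemma mpol_eval_power: "mpol_eval \<rho> (p ^ n) = mpol_eval \<rho> p ^ n"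
  by (induction n) (simp_all add: mpol_eval_mult)

lemma mpol_eval_prod: "mpol_eval \<rho> (prod f A) = (\<Prod>x\<in>A. mpol_eval \<rho> (f x))"
  by (induction A rule: infinite_finite_induct) (simp_all add: mpol_eval_mult)

lemma mpol_eval_mvar [simp]: "mpol_eval \<rho> (mvar v) = \<rho> v"
  by (simp add: mvar_def mpol_eval_frag_of monom_eval_def)

lemma mpol_eval_in_subring:
  assumes v: "\<And>v. \<rho> v \<in> A" and "1 \<in> A"
    and diff: "\<And>x y. x \<in> A \<Longrightarrow> y \<in> A \<Longrightarrow> x - y \<in> A"
    and mult: "\<And>x y. x \<in> A \<Longrightarrow> y \<in> A \<Longrightarrow> x * y \<in> A"
  shows "mpol_eval \<rho> p \<in> A"
proof -
  have pow: "x ^ n \<in> A" if "x \<in> A" for x n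
    using that \<open>1 \<in> A\<close> by (induction n) (auto intro: mult)
  have "(\<Prod>v\<in>F. \<rho> v ^ k v) \<in> A" for F k
    by (induction F rule: infinite_finite_induct) (auto intro!: mult pow v \<open>1 \<in> A\<close>)
  then have mon: "monom_eval \<rho> m \<in> A" for m
    unfolding monom_eval_def .
  have "Poly_Mapping.keys p \<subseteq> UNIV" by simp
  then show ?thesis
    by (induction p rule: frag_induction)
      (use diff[OF \<open>1 \<in> A\<close> \<open>1 \<in> A\<close>] in \<open>auto simp: mpol_eval_diff mpol_eval_frag_of mon diff\<close>)
qed

section \<open>Regular pairs\<close>

text \<open>\<open>g\<close> is a non-zero-divisor modulo \<open>f\<close>. This stands in for
  coprimality: the argument only ever cancels a factor from a divisibility, so unique factorization
  never enters.\<close>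

definition regular_pair :: "'a::comm_ring_1 \<Rightarrow> 'a \<Rightarrow> bool" where
  "regular_pair f g \<longleftrightarrow> (\<forall>h. f dvd g * h \<longrightarrow> f dvd h)"

lemma regular_pair_1 [simp]: "regular_pair f 1" "regular_pair 1 f"
  by (simp_all add: regular_pair_def)

lemma regular_pair_sym:
  fixes f g :: "'a::idom"
  assumes reg: "regular_pair f g" and "f \<noteq> 0"
  shows "regular_pair g f"
  unfolding regular_pair_def
proof (intro allI impI)
  fix h assume "g dvd f * h"
  then obtain k where k: "f * h = g * k" by auto
  then have "f dvd k"
    using reg unfolding regular_pair_def by (metis dvd_triv_left)
  then obtain k' where "k = f * k'" by auto
  then have "h = g * k'"
    using k \<open>f \<noteq> 0\<close> by (metis mult.left_commute mult_cancel_left)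
  then show "g dvd h" by simp
qed

lemma regular_pair_mult:
  "regular_pair f g \<Longrightarrow> regular_pair f g' \<Longrightarrow> regular_pair f (g * g')"
  unfolding regular_pair_def mult.assoc by blast

lemma regular_pair_power: "regular_pair f g \<Longrightarrow> regular_pair f (g ^ n)"
  by (induction n) (simp_all add: regular_pair_mult)

lemma regular_pair_prod:
  "(\<And>x. x \<in> A \<Longrightarrow> regular_pair f (g x)) \<Longrightarrow> regular_pair f (prod g A)"
  by (induction A rule: infinite_finite_induct) (simp_all add: regular_pair_mult)

text \<open>Taylor expansion in one variable: \<open>v\<close> is replaced by \<open>v\<close> plus
  the indeterminate of the outer \<open>poly\<close>. A constant result expresses that
  \<open>v\<close> does not occur, a linear one that it occurs linearly; this avoids splitting the
  ring into polynomials over the other variables.\<close>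

definition shift_var :: "'v \<Rightarrow> 'v mpol \<Rightarrow> 'v mpol poly" where
  "shift_var v = mpol_eval (\<lambda>w. if w = v then [:mvar w, 1:] else [:mvar w:])"

lemma shift_var_simps:
  "shift_var v (p - q) = shift_var v p - shift_var v q"
  "shift_var v (p * q) = shift_var v p * shift_var v q"
  "shift_var v (p ^ n) = shift_var v p ^ n"
  "shift_var v (prod f A) = (\<Prod>x\<in>A. shift_var v (f x))"
  "shift_var v 1 = 1" "shift_var v 0 = 0"
  "shift_var v (mvar v) = [:mvar v, 1:]"
  "w \<noteq> v \<Longrightarrow> shift_var v (mvar w) = [:mvar w:]"
  by (simp_all add: shift_var_def mpol_eval_diff mpol_eval_mult mpol_eval_power mpol_eval_prod)

lemma coeff_0_shift_var: "coeff (shift_var v p) 0 = p"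
proof -
  have mon: "coeff (shift_var v (frag_of m)) 0 = frag_of m" for m
  proof -
    have pow: "coeff (p ^ n) 0 = coeff p 0 ^ n" for p :: "'a mpol poly" and n
      by (induction n) (simp_all add: coeff_mult_0)
    have pr: "coeff (prod g F) 0 = (\<Prod>x\<in>F. coeff (g x) 0)" for g :: "'a \<Rightarrow> 'a mpol poly" and F
      by (induction F rule: infinite_finite_induct) (simp_all add: coeff_mult_0)
    have mv: "mvar x ^ n = frag_of (Poly_Mapping.single x n)" for x :: 'a and n
      by (induction n) (simp_all add: mvar_def mult_single flip: single_add)
    have pf: "(\<Prod>x\<in>F. frag_of (g x)) = frag_of (\<Sum>x\<in>F. g x)" for g :: "'a \<Rightarrow> 'a \<Rightarrow>\<^sub>0 nat" and F
      by (induction F rule: infinite_finite_induct) (simp_all add: mult_single)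
    have "coeff (if x = v then [:mvar x, 1:] else [:mvar x:]) 0 = mvar x" for x
      by simp
    then have "coeff (shift_var v (frag_of m)) 0 =
        (\<Prod>x\<in>Poly_Mapping.keys m. mvar x ^ Poly_Mapping.lookup m x)"
      by (simp only: shift_var_def mpol_eval_frag_of monom_eval_def pr pow)
    also have "\<dots> = frag_of (\<Sum>x\<in>Poly_Mapping.keys m. Poly_Mapping.single x (Poly_Mapping.lookup m x))"
      by (simp add: mv pf)
    also have "(\<Sum>x\<in>Poly_Mapping.keys m. Poly_Mapping.single x (Poly_Mapping.lookup m x)) = m"
      by (rule poly_mapping_eqI)
        (auto simp: lookup_sum lookup_single when_def sum.delta' in_keys_iff)
    finally show ?thesis .
  qed
  have "Poly_Mapping.keys p \<subseteq> UNIV" by simp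
  then show ?thesis
    by (induction p rule: frag_induction) (simp_all add: shift_var_simps mon)
qed

text \<open>
  Compare coefficients with respect to the translation parameter, from the top one down.
\<close>

lemma regular_pair_leading:
  fixes f g :: "'v::linorder mpol"
  assumes f: "shift_var v f = [:f:]" and g: "shift_var v g = [:g, A:]"
    and reg: "regular_pair f A"
  shows "regular_pair f g"
  unfolding regular_pair_def
proof (intro allI impI)
  fix h assume "f dvd g * h"
  then obtain k where k: "g * h = f * k" by auto
  define H where "H = shift_var v h"
  have "[:g, A:] * H = [:f:] * shift_var v k"
    unfolding H_def f[symmetric] g[symmetric] shift_var_simps(2)[symmetric] k ..
  then have eq: "g * coeff H (Suc n) + A * coeff H n = f * coeff (shift_var v k) (Suc n)" for n
    by (auto simp: poly_eq_iff dest!: spec[of _ "Suc n"])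
  have "f dvd coeff H n" if "n \<le> Suc (degree H)" for n
    using that
  proof (induction rule: inc_induct)
    case base
    show ?case by (simp add: coeff_eq_0)
  next
    case (step n)
    have "f dvd A * coeff H n"
    proof -
      have "A * coeff H n = f * coeff (shift_var v k) (Suc n) - g * coeff H (Suc n)"
        using eq[of n] by (simp add: eq_diff_eq add.commute)
      then show ?thesis
        using step.IH by (simp add: dvd_diff dvd_mult)
    qed
    then show ?case using reg unfolding regular_pair_def by blast
  qed
  then have "f dvd coeff H 0" by blast
  then show "f dvd h"
    unfolding H_def coeff_0_shift_var .
qed

section \<open>A T-system with a deformation parameter\<close>

definition eqm :: "'a::comm_ring_1 \<Rightarrow> 'a \<Rightarrow> 'a \<Rightarrow> bool" where
  "eqm c x y \<longleftrightarrow> c dvd x - y"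

lemma eqm_refl [simp]: "eqm c x x"
  by (simp add: eqm_def)

lemma eqm_sym: "eqm c x y \<Longrightarrow> eqm c y x"
  unfolding eqm_def by (metis dvd_minus_iff minus_diff_eq)

lemma eqm_trans [trans]: "eqm c x y \<Longrightarrow> eqm c y z \<Longrightarrow> eqm c x z"
  unfolding eqm_def by (metis diff_add_cancel add_diff_eq dvd_add)

lemma eqm_mult:
  assumes "eqm c x y" "eqm c x' y'"
  shows "eqm c (x * x') (y * y')"
proof -
  have "x * x' - y * y' = (x - y) * x' + y * (x' - y')"
    by (simp add: algebra_simps)
  then show ?thesis
    using assms unfolding eqm_def by (simp add: dvd_add dvd_mult dvd_mult2)
qed

lemma eqm_prod:
  "(\<And>i. i \<in> A \<Longrightarrow> eqm c (f i) (g i)) \<Longrightarrow> eqm c (prod f A) (prod g A)"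
  by (induction A rule: infinite_finite_induct) (simp_all add: eqm_mult)

lemma eqm_cancel:
  assumes "regular_pair c g" "eqm c (g * x) (g * y)"
  shows "eqm c x y"
  using assms unfolding regular_pair_def eqm_def right_diff_distrib[symmetric] by blast

text \<open>Modulo \<open>c\<close> the array has rank one once its adjacent 2 by 2 minors vanish
  and its entries can be cancelled: products of neighbouring minors give wider minors, along a pair
  of adjacent rows and then down the rows.\<close>

lemma rank_one_array:
  fixes G :: "nat \<Rightarrow> nat \<Rightarrow> 'a::comm_ring_1"
  assumes adj: "\<And>x y. x < t \<Longrightarrow> y < t \<Longrightarrow>
      eqm c (G x y * G (Suc x) (Suc y)) (G x (Suc y) * G (Suc x) y)"
    and reg: "\<And>x y. x \<le> t \<Longrightarrow> y \<le> t \<Longrightarrow> regular_pair c (G x y)"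
  shows "eqm c (G 0 0 * G t t) (G 0 t * G t 0)"
proof -
  have row: "eqm c (G x 0 * G (Suc x) y) (G x y * G (Suc x) 0)" if "x < t" "y \<le> t" for x y
    using that(2)
  proof (induction y)
    case 0
    show ?case by simp
  next
    case (Suc y)
    then have y: "y < t" by simp
    have "eqm c ((G x 0 * G (Suc x) y) * (G x y * G (Suc x) (Suc y)))
        ((G x y * G (Suc x) 0) * (G x (Suc y) * G (Suc x) y))"
      by (rule eqm_mult) (use Suc y adj[OF \<open>x < t\<close> y] in auto)
    then have "eqm c ((G x y * G (Suc x) y) * (G x 0 * G (Suc x) (Suc y)))
        ((G x y * G (Suc x) y) * (G x (Suc y) * G (Suc x) 0))"
      by (simp only: mult_ac)
    then show ?case
      by (rule eqm_cancel[rotated]) (use y \<open>x < t\<close> in \<open>auto intro!: regular_pair_mult reg\<close>)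
  qed
  have "eqm c (G 0 0 * G x t) (G 0 t * G x 0)" if "x \<le> t" for x
    using that
  proof (induction x)
    case 0
    show ?case by (simp add: mult.commute)
  next
    case (Suc x)
    then have x: "x < t" by simp
    have "eqm c ((G 0 0 * G x t) * (G x 0 * G (Suc x) t)) ((G 0 t * G x 0) * (G x t * G (Suc x) 0))"
      by (rule eqm_mult) (use Suc x row[OF x, of t] in auto)
    then have "eqm c ((G x t * G x 0) * (G 0 0 * G (Suc x) t)) ((G x t * G x 0) * (G 0 t * G (Suc x) 0))"
      by (simp only: mult_ac)
    then show ?case
      by (rule eqm_cancel[rotated]) (use x in \<open>auto intro!: regular_pair_mult reg\<close>)
  qed
  then show ?thesis by blast
qed

text \<open>
  \<open>c a b\<close> is the absolute value of the off-diagonal Cartan matrix entry and \<open>d\<close> symmetrizes it.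
\<close>

locale cartan_data =
  fixes r :: nat and c :: "nat \<Rightarrow> nat \<Rightarrow> nat" and d :: "nat \<Rightarrow> nat"
  assumes d_pos: "a \<in> {1..r} \<Longrightarrow> 0 < d a"
    and symm: "a \<in> {1..r} \<Longrightarrow> b \<in> {1..r} \<Longrightarrow> a \<noteq> b \<Longrightarrow> d a * c a b = d b * c b a"
    and thin: "a \<in> {1..r} \<Longrightarrow> b \<in> {1..r} \<Longrightarrow> a \<noteq> b \<Longrightarrow> c a b \<le> 1 \<or> c b a \<le> 1"
begin

text \<open>The ceiling of \<open>(c b a * n - e) / c a b\<close>. For \<open>c a b > 0\<close> the
  lengths over all \<open>e < c a b\<close> add up to \<open>c b a * n\<close>.\<close>

definition nbr_len :: "nat \<Rightarrow> nat \<Rightarrow> nat \<Rightarrow> nat \<Rightarrow> nat" where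
  "nbr_len a b n e = (c b a * n + c a b - 1 - e) div c a b"

text \<open>Rounding up costs less than one step of length \<open>d b\<close>, so after removing one
  step a neighbour ends strictly before time \<open>n * d a\<close>. This is the decrease of
  \<open>(n - 1) * d a\<close> along the recursion for \<open>T\<close>.\<close>

lemma nbr_len_measure:
  assumes "a \<in> {1..r}" "b \<in> {1..r}" "a \<noteq> b" "e < c a b" "0 < n"
  shows "(nbr_len a b n e - 1) * d b < n * d a"
proof (cases "nbr_len a b n e")
  case 0
  then show ?thesis using d_pos assms by simp
next
  case (Suc l)
  have "Suc l * c a b \<le> c b a * n + c a b - 1 - e"
    unfolding Suc[symmetric] nbr_len_def by (rule div_times_less_eq_dividend)
  then have "l * c a b < c b a * n"
    using assms(4) by (cases "c b a * n") auto
  moreover have "0 < d b" using assms d_pos by blast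
  ultimately have "d b * (l * c a b) < d b * (c b a * n)"
    by simp
  also have "\<dots> = (d a * n) * c a b"
    using symm[OF assms(1-3)] by (simp add: mult_ac)
  finally have "(l * d b) * c a b < (n * d a) * c a b"
    by (simp add: mult_ac)
  then show ?thesis using Suc by simp
qed

text \<open>A chosen quotient lets \<open>T\<close> be defined by recursion before divisibility is
  known; once it is known, the quotient by a nonzero element of a domain is unique.\<close>

definition exact_quot :: "'a::comm_ring_1 \<Rightarrow> 'a \<Rightarrow> 'a" where
  "exact_quot x y = (SOME q. x = q * y)"

text \<open>Colour 0 lies outside \<open>{1..r}\<close>, which keeps this variable apart from the
  initial data \<open>mvar (a, s)\<close> of the system.\<close>

definition zeta :: "(nat \<times> int) mpol" where
  "zeta = mvar (0, 0)"

text \<open>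
  \<open>T a n s\<close> belongs to the arithmetic progression \<open>s, s + 2 d a, \<dots>\<close> with \<open>n\<close> terms. The extra
  variable \<open>zeta\<close> specializes to the grading variable of the generating function.
\<close>

function T :: "nat \<Rightarrow> nat \<Rightarrow> int \<Rightarrow> (nat \<times> int) mpol" where
  "T a 0 s = 1"
| "T a (Suc 0) s = mvar (a, s)"
| "T a (Suc (Suc n)) s =
     (if a \<in> {1..r} then
     exact_quot (T a (Suc n) s * T a (Suc n) (s + 2 * int (d a)) - zeta ^ Suc n *
       (\<Prod>b\<in>{1..r} - {a}. \<Prod>e<c a b.
          T b (nbr_len a b (Suc n) e) (s + int (min (d a) (d b)) + 2 * int (d a) * int e)))
       (T a n (s + 2 * int (d a))) else 1)"
  by pat_completeness auto
termination
proof -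
  have *: "(nbr_len a b (Suc n) e - Suc 0) * d b < d a + n * d a"
    if "Suc 0 \<le> a" "a \<le> r" "Suc 0 \<le> b" "b \<le> r" "b \<noteq> a" "e < c a b" for a b e n
    using nbr_len_measure[of a b e "Suc n"] that by simp
  \<comment> \<open>The default value of \<open>T\<close> outside \<open>{1..r}\<close> stops the
    recursion where \<open>d a\<close> might be zero.\<close>
  have **: "(n - Suc 0) * d a < d a + n * d a" if "Suc 0 \<le> a" "a \<le> r" for a n
    using d_pos[of a] that by (cases n) auto
  show ?thesis
    by (relation "measure (\<lambda>(a, n, s). (n - 1) * d a)") (auto simp: * ** d_pos)
qed

definition nbr_prod :: "nat \<Rightarrow> nat \<Rightarrow> nat \<Rightarrow> int \<Rightarrow> (nat \<times> int) mpol" where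
  "nbr_prod a b n s =
     (\<Prod>e<c a b. T b (nbr_len a b n e) (s + int (min (d a) (d b)) + 2 * int (d a) * int e))"

definition T_rem :: "nat \<Rightarrow> nat \<Rightarrow> int \<Rightarrow> (nat \<times> int) mpol" where
  "T_rem a n s = (\<Prod>b\<in>{1..r} - {a}. nbr_prod a b n s)"

definition T_relation :: "nat \<Rightarrow> nat \<Rightarrow> bool" where
  "T_relation a n \<longleftrightarrow> (\<forall>s. T a n s * T a n (s + 2 * int (d a)) =
     T a (Suc n) s * T a (n - 1) (s + 2 * int (d a)) + zeta ^ n * T_rem a n s)"

section \<open>Extremal variables and regularity between colours\<close>

definition free_of :: "nat \<times> int \<Rightarrow> (nat \<times> int) mpol \<Rightarrow> bool" where
  "free_of v f \<longleftrightarrow> shift_var v f = [:f:]"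

lemma free_of_1 [simp]: "free_of v 1"
  by (simp add: free_of_def shift_var_simps one_pCons)

lemma free_of_mult: "free_of v f \<Longrightarrow> free_of v g \<Longrightarrow> free_of v (f * g)"
  by (simp add: free_of_def shift_var_simps)

lemma free_of_diff: "free_of v f \<Longrightarrow> free_of v g \<Longrightarrow> free_of v (f - g)"
  by (simp add: free_of_def shift_var_simps)

lemma free_of_power: "free_of v f \<Longrightarrow> free_of v (f ^ n)"
  by (induction n) (simp_all add: free_of_mult)

lemma free_of_prod: "(\<And>x. x \<in> A \<Longrightarrow> free_of v (f x)) \<Longrightarrow> free_of v (prod f A)"
  by (induction A rule: infinite_finite_induct) (simp_all add: free_of_mult)

lemma free_of_zeta: "b \<noteq> 0 \<Longrightarrow> free_of (b, p) zeta"
  by (simp add: free_of_def zeta_def shift_var_simps)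

lemma free_of_quot:
  assumes "free_of v (q * y)" "free_of v y" "y \<noteq> 0"
  shows "free_of v q"
proof -
  have "shift_var v q * [:y:] = [:q:] * [:y:]"
    using assms(1,2) by (simp add: free_of_def shift_var_simps)
  then show ?thesis
    using assms(3) unfolding free_of_def by (metis mult_cancel_right pCons_eq_0_iff)
qed

text \<open>Invariant of the construction: the variables of \<open>T a n s\<close> other than
  \<open>zeta\<close> sit at positions from \<open>s\<close> on, and at \<open>s\<close> itself only
  colour \<open>a\<close> occurs, linearly, with a shorter \<open>T\<close> as coefficient. Colour 0
  is left out because of \<open>zeta\<close>. The relation is stated at \<open>n - 1\<close> since
  its quotient is what defines \<open>T a n\<close>.\<close>

definition good :: "nat \<Rightarrow> nat \<Rightarrow> bool" where
  "good a n \<longleftrightarrow>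
     (\<forall>s b p. b \<noteq> 0 \<and> (p < s \<or> p = s \<and> b \<noteq> a) \<longrightarrow> free_of (b, p) (T a n s)) \<and>
     (0 < n \<longrightarrow> (\<forall>s. shift_var (a, s) (T a n s) = [:T a n s, T a (n - 1) (s + 2 * int (d a)):])) \<and>
     (\<forall>s. T a n s \<noteq> 0) \<and> (1 < n \<longrightarrow> T_relation a (n - 1))"

text \<open>Because \<open>s \<le> s'\<close>, the variable \<open>(a, s)\<close> is absent from
  \<open>T b m s'\<close> and linear in \<open>T a n s\<close>; regularity therefore passes from the
  leading coefficient, a shorter \<open>T\<close>, to the whole.\<close>

lemma regular_T_step:
  assumes a: "good a n" and b: "good b m" and "0 < n" "a \<noteq> b" "a \<noteq> 0" "s \<le> s'"
    and reg: "regular_pair (T b m s') (T a (n - 1) (s + 2 * int (d a)))"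
  shows "regular_pair (T a n s) (T b m s') \<and> regular_pair (T b m s') (T a n s)"
proof -
  have "free_of (a, s) (T b m s')"
    using b assms(4-6) unfolding good_def by (metis order_le_less)
  then have 1: "shift_var (a, s) (T b m s') = [:T b m s':]"
    unfolding free_of_def .
  have 2: "shift_var (a, s) (T a n s) = [:T a n s, T a (n - 1) (s + 2 * int (d a)):]"
    using a \<open>0 < n\<close> unfolding good_def by blast
  have "regular_pair (T b m s') (T a n s)"
    by (rule regular_pair_leading[OF 1 2 reg])
  moreover have "T b m s' \<noteq> 0"
    using b unfolding good_def by blast
  ultimately show ?thesis
    using regular_pair_sym by blast
qed

text \<open>Whichever of the two starts further to the left provides the extremal variable, and the
  induction on \<open>n + m\<close> shortens that one.\<close>

lemma regular_T:
  assumes ab: "a \<noteq> b" "a \<noteq> 0" "b \<noteq> 0"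
    and "\<And>i. i \<le> n \<Longrightarrow> good a i" "\<And>i. i \<le> m \<Longrightarrow> good b i"
  shows "regular_pair (T a n s) (T b m s') \<and> regular_pair (T b m s') (T a n s)"
  using assms(4,5)
proof (induction "n + m" arbitrary: n m s s')
  case 0
  then show ?case by simp
next
  case (Suc N)
  note IH = Suc.hyps(1) and N = Suc.hyps(2) and prems = Suc.prems
  consider "n = 0" | "m = 0" | "0 < n" "0 < m" "s \<le> s'" | "0 < n" "0 < m" "s' \<le> s"
    by linarith
  then show ?case
  proof cases
    case 3
    have "regular_pair (T b m s') (T a (n - 1) (s + 2 * int (d a)))"
      by (rule IH[THEN conjunct2]) (use 3 N prems in auto)
    then show ?thesis
      using regular_T_step[of a n b m s s'] prems(1)[of n] prems(2)[of m] 3 ab by blast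
  next
    case 4
    have "regular_pair (T a n s) (T b (m - 1) (s' + 2 * int (d b)))"
      by (rule IH[THEN conjunct1]) (use 4 N prems in auto)
    then show ?thesis
      using regular_T_step[of b m a n s' s] prems(1)[of n] prems(2)[of m] 4 ab by blast
  qed simp_all
qed

lemma regular_T_zeta:
  assumes "a \<noteq> 0" and "\<And>i. i \<le> n \<Longrightarrow> good a i"
  shows "regular_pair (T a n s) zeta"
proof -
  have nz: "zeta \<noteq> 0"
    by (simp add: zeta_def mvar_def)
  have "regular_pair zeta (T a n s)"
    using assms(2)
  proof (induction n arbitrary: s)
    case (Suc n)
    show ?case
    proof (rule regular_pair_leading)
      show "shift_var (a, s) zeta = [:zeta:]"
        using free_of_zeta assms(1) unfolding free_of_def by blast
      show "shift_var (a, s) (T a (Suc n) s) = [:T a (Suc n) s, T a n (s + 2 * int (d a)):]"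
        using Suc.prems[of "Suc n"] unfolding good_def by simp
      show "regular_pair zeta (T a n (s + 2 * int (d a)))"
        using Suc by simp
    qed
  qed simp
  then show ?thesis
    using nz regular_pair_sym by blast
qed

section \<open>Divisibility of the numerator in the recursion\<close>

lemma dvd_T_rem:
  assumes "a \<in> {1..r}" "b \<in> {1..r}" "a \<noteq> b" "e < c b a"
    and "nbr_len b a m e = n" "p + int (min (d b) (d a)) + 2 * int (d b) * int e = q"
  shows "T a n q dvd zeta ^ k * T_rem b m p"
proof -
  have "T a n q dvd nbr_prod b a m p"
    unfolding nbr_prod_def using assms(4-6) by (intro dvd_prodI[of _ e, THEN dvd_trans[rotated]]) auto
  also have "\<dots> dvd T_rem b m p"
    unfolding T_rem_def by (rule dvd_prodI) (use assms in auto)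
  finally show ?thesis by simp
qed

text \<open>One neighbour colour \<open>b\<close> is treated at a time. Modulo \<open>T a n\<close>,
  the relevant T-relations of colour \<open>b\<close> lose their remainder, because it contains
  \<open>T a n\<close> at the right position; what is left is a rank-one identity among the
  \<open>T\<close>'s of colour \<open>b\<close>.\<close>

lemma nbr_prod_cross:
  assumes a: "a \<in> {1..r}" and b: "b \<in> {1..r}" and ab: "a \<noteq> b" and "0 < n"
    and good: "\<And>a' m. a' \<in> {1..r} \<Longrightarrow> (m - 1) * d a' < Suc n * d a \<Longrightarrow> good a' m"
  shows "eqm (T a n (s + 2 * int (d a)))
    (nbr_prod a b n s * nbr_prod a b n (s + 2 * int (d a)))
    (nbr_prod a b (Suc n) s * nbr_prod a b (n - 1) (s + 2 * int (d a)))"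
proof -
  let ?c = "T a n (s + 2 * int (d a))"
  have da: "0 < d a" and db: "0 < d b" using d_pos a b by auto
  have goodb: "good b m" if "(m - 1) * d b < Suc n * d a" for m
    using good b that by blast
  have gooda: "good a m" if "m \<le> n" for m
  proof (rule good[OF a])
    have "m - 1 < Suc n" using that by simp
    then show "(m - 1) * d a < Suc n * d a" using da by (simp del: mult_Suc)
  qed
  consider "c a b = 0" | "c a b = 1" | t where "c b a = 1" "c a b = Suc t"
    using thin[OF a b ab] symm[OF a b ab] da db by (cases "c a b"; cases "c b a") auto
  then show ?thesis
  proof cases
    case 1
    then show ?thesis by (simp add: nbr_prod_def)
  next
    case 2
    define t where "t = c b a"
    have dat: "d a = d b * t" using symm[OF a b ab] 2 by (simp add: t_def)
    then have t: "0 < t" using da by (cases t) auto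
    then have g: "min (d a) (d b) = d b" using dat by (cases t) auto
    have np: "nbr_prod a b m p = T b (t * m) (p + int (d b))" for m p
      by (simp add: nbr_prod_def 2 nbr_len_def g t_def)
    \<comment> \<open>Lengths grow with \<open>y\<close> and shrink with \<open>x\<close>, while the
      start moves by \<open>x\<close> steps. The four corners are the four values of
      \<open>nbr_prod\<close>, and every adjacent minor is a T-relation of colour
      \<open>b\<close>.\<close>
    define G where "G x y = T b (t * n + y - x) (s + int (d b) + 2 * int (d b) * int x)" for x y
    have sn: "Suc n * d a = (t * Suc n) * d b"
      unfolding dat by (simp only: mult_ac)
    have tn: "t \<le> t * n" using \<open>0 < n\<close> by simp
    have "eqm ?c (G 0 0 * G t t) (G 0 t * G t 0)"
    proof (rule rank_one_array)
      fix x y assume x: "x < t" and y: "y < t"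
      define m where "m = t * n + y - x"
      define p where "p = s + int (d b) + 2 * int (d b) * int x"
      have m: "0 < m" "m < t * Suc n"
        using x y tn unfolding m_def mult_Suc_right by linarith+
      have p': "p + 2 * int (d b) = s + int (d b) + 2 * int (d b) * int (Suc x)"
        by (simp add: p_def algebra_simps)
      have "m * d b < (t * Suc n) * d b" using m(2) db by (rule mult_strict_right_mono)
      then have "(Suc m - 1) * d b < Suc n * d a" unfolding sn by simp
      from goodb[OF this] have "T_relation b m"
        using m unfolding good_def by simp
      then have rel: "T b m p * T b m (p + 2 * int (d b)) =
          T b (Suc m) p * T b (m - 1) (p + 2 * int (d b)) + zeta ^ m * T_rem b m p"
        unfolding T_relation_def by blast
      have len: "t * n + Suc y - Suc x = t * n + y - x"
        "t * n + Suc y - x = Suc (t * n + y - x)" "t * n + y - Suc x = t * n + y - x - 1"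
        using x tn by linarith+
      have Geq: "G x y = T b m p" "G (Suc x) (Suc y) = T b m (p + 2 * int (d b))"
        "G x (Suc y) = T b (Suc m) p" "G (Suc x) y = T b (m - 1) (p + 2 * int (d b))"
        unfolding G_def p' by (simp_all only: len p_def m_def)
      have "?c dvd zeta ^ m * T_rem b m p"
      proof (rule dvd_T_rem[OF a b ab])
        \<comment> \<open>Among the \<open>t\<close> factors of colour \<open>a\<close> in the
          remainder, the one with \<open>e = t - 1 - x\<close> has length \<open>n\<close> and
          starts at \<open>s + 2 * d a\<close>.\<close>
        show "t - 1 - x < c b a" using t by (simp add: t_def)
        have "nbr_len b a m (t - 1 - x) = (m + x) div t"
          using x by (simp add: nbr_len_def 2 t_def)
        also have "m + x = t * n + y" using x tn unfolding m_def by linarith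
        also have "\<dots> div t = n" using y by simp
        finally show "nbr_len b a m (t - 1 - x) = n" .
        have "int (t - 1 - x) = int t - 1 - int x" using x by simp
        then show "p + int (min (d b) (d a)) + 2 * int (d b) * int (t - 1 - x) = s + 2 * int (d a)"
          using g by (simp add: p_def min.commute dat algebra_simps)
      qed
      then show "eqm ?c (G x y * G (Suc x) (Suc y)) (G x (Suc y) * G (Suc x) y)"
        unfolding Geq rel eqm_def by simp
    next
      fix x y assume x: "x \<le> t" and y: "y \<le> t"
      show "regular_pair ?c (G x y)"
        unfolding G_def
      proof (rule regular_T[THEN conjunct1])
        fix i assume i: "i \<le> t * n + y - x"
        then have "i - 1 < t * n + t" using y t by linarith
        then have "i - 1 < t * Suc n" by simp
        from mult_strict_right_mono[OF this db] show "good b i"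
          unfolding sn[symmetric] by (rule goodb)
      qed (use a b ab gooda in simp_all)
    qed
    moreover have "G 0 0 = nbr_prod a b n s" "G t t = nbr_prod a b n (s + 2 * int (d a))"
      "G 0 t = nbr_prod a b (Suc n) s" "G t 0 = nbr_prod a b (n - 1) (s + 2 * int (d a))"
      by (simp_all add: G_def np dat algebra_simps)
    ultimately show ?thesis by simp
  next
    case (3 t)
    have dbt: "d b = d a * Suc t" using symm[OF a b ab] 3 by simp
    then have g: "min (d a) (d b) = d a" by simp
    \<comment> \<open>Here \<open>d b\<close> is a multiple of \<open>d a\<close>, and shifting
      \<open>s\<close> by \<open>2 * d a\<close> moves the index \<open>e\<close> by one. Both sides
      thus share all factors except those at the two ends.\<close>
    define F where "F m e = T b ((m + t - e) div Suc t) (s + int (d a) + 2 * int (d a) * int e)" for m e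
    have np: "nbr_prod a b m s = (\<Prod>e<Suc t. F m e)" for m
      by (simp add: nbr_prod_def 3 nbr_len_def g F_def)
    have np': "nbr_prod a b m (s + 2 * int (d a)) = (\<Prod>e<Suc t. F (Suc m) (Suc e))" for m
      unfolding nbr_prod_def 3(2)
      by (rule prod.cong) (simp_all add: nbr_len_def 3 g F_def algebra_simps)
    let ?M = "\<lambda>m. \<Prod>e<t. F m (Suc e)"
    \<comment> \<open>If \<open>Suc t\<close> divides \<open>n\<close>, the factors at the ends form
      a T-relation of colour \<open>b\<close>; otherwise the rounded lengths do not jump and the two
      sides are equal.\<close>
    have F_eq: "eqm ?c (F n 0 * F (Suc n) (Suc t)) (F (Suc n) 0 * F n (Suc t))"
    proof (cases "Suc t dvd n")
      case True
      then obtain N where N: "n = Suc t * N" by auto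
      then have "0 < N" using \<open>0 < n\<close> by (cases N) auto
      define p where "p = s + int (d a)"
      have "N * d b = n * d a" unfolding N dbt by (simp only: mult_ac)
      then have "(Suc N - 1) * d b < Suc n * d a" using da by simp
      from goodb[OF this] have "T_relation b N"
        using \<open>0 < N\<close> unfolding good_def by simp
      then have rel: "T b N p * T b N (p + 2 * int (d b)) =
          T b (Suc N) p * T b (N - 1) (p + 2 * int (d b)) + zeta ^ N * T_rem b N p"
        unfolding T_relation_def by blast
      have "?c dvd zeta ^ N * T_rem b N p"
        by (rule dvd_T_rem[OF a b ab, of 0])
          (use g in \<open>auto simp: 3 nbr_len_def N p_def min.commute\<close>)
      moreover have d1: "(n + t) div Suc t = N"
        by (rule div_nat_eqI) (auto simp: N)
      moreover have d2: "(Suc n + t) div Suc t = Suc N"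
        by (rule div_nat_eqI) (auto simp: N)
      moreover have d3: "(n - Suc 0) div Suc t = N - 1"
        by (rule div_nat_eqI) (use \<open>0 < N\<close> N in \<open>auto simp: algebra_simps diff_mult_distrib2\<close>)
      moreover have d4: "n div Suc t = N"
        by (rule div_nat_eqI) (auto simp: N)
      moreover have q: "s + int (d a) + 2 * int (d a) * int (Suc t) = p + 2 * int (d b)"
        by (simp add: p_def dbt algebra_simps)
      ultimately show ?thesis
        using rel unfolding eqm_def F_def q
        by (simp add: p_def)
    next
      case False
      define q m where "q = n div Suc t" and "m = n mod Suc t"
      have n: "n = Suc t * q + m"
        unfolding q_def m_def by (rule mult_div_mod_eq[symmetric])
      have m: "0 < m" "m \<le> t" using False mod_less_divisor[of "Suc t" n]
        by (auto simp: m_def dvd_eq_mod_eq_0 simp del: mod_less_divisor)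
      have "(n + t) div Suc t = Suc q" "(Suc n + t) div Suc t = Suc q"
        "(n - Suc 0) div Suc t = q" "n div Suc t = q"
        by (rule div_nat_eqI; use m n in simp)+
      then show ?thesis by (simp add: F_def)
    qed
    have "eqm ?c (F n 0 * F (Suc n) (Suc t) * (?M n * ?M (Suc n)))
        (F (Suc n) 0 * F n (Suc t) * (?M n * ?M (Suc n)))"
      by (rule eqm_mult[OF F_eq]) simp
    moreover have "nbr_prod a b n s * nbr_prod a b n (s + 2 * int (d a)) =
        F n 0 * F (Suc n) (Suc t) * (?M n * ?M (Suc n))"
      unfolding np np' prod.lessThan_Suc_shift[of "F n"] prod.lessThan_Suc[of "\<lambda>e. F (Suc n) (Suc e)"]
      by (simp only: mult_ac)
    moreover have "nbr_prod a b (Suc n) s * nbr_prod a b (n - 1) (s + 2 * int (d a)) =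
        F (Suc n) 0 * F n (Suc t) * (?M n * ?M (Suc n))"
    proof -
      have "Suc (n - 1) = n" using \<open>0 < n\<close> by simp
      then show ?thesis
        unfolding np np' prod.lessThan_Suc_shift[of "F (Suc n)"] prod.lessThan_Suc[of "\<lambda>e. F (Suc (n - 1)) (Suc e)"]
        by (simp only: mult_ac)
    qed
    ultimately show ?thesis by simp
  qed
qed

lemma T_rem_0 [simp]: "T_rem a 0 s = 1"
proof -
  have "(c a b - Suc e) div c a b = 0" for b e
    by (cases "c a b") simp_all
  then show ?thesis
    by (simp add: T_rem_def nbr_prod_def nbr_len_def)
qed

text \<open>Put \<open>k = m - 1\<close> and work modulo \<open>T a m\<close>. The T-relations at
  \<open>m\<close> for two adjacent starts express \<open>T a (Suc m)\<close> times
  \<open>T a k\<close>, and the one at \<open>k\<close> expresses a product of two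
  \<open>T a k\<close>. Multiplying them and applying \<open>nbr_prod_cross\<close>, the numerator
  vanishes after multiplication by \<open>zeta ^ k * T_rem a k\<close>, which is regular and can be
  cancelled.\<close>

lemma T_dvd:
  assumes a: "a \<in> {1..r}"
    and good: "\<And>a' m'. a' \<in> {1..r} \<Longrightarrow> (m' - 1) * d a' < Suc m * d a \<Longrightarrow> good a' m'"
  shows "T a m (s + 2 * int (d a)) dvd
    T a (Suc m) s * T a (Suc m) (s + 2 * int (d a)) - zeta ^ Suc m * T_rem a (Suc m) s"
proof (cases m)
  case 0
  then show ?thesis by simp
next
  case (Suc k)
  define s' where "s' = s + 2 * int (d a)"
  define s'' where "s'' = s' + 2 * int (d a)"
  let ?c = "T a m s'"
  have da: "0 < d a" using a d_pos by blast
  have gooda: "good a i" if "i \<le> Suc m" for i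
  proof (rule good[OF a])
    have "i - 1 < Suc m" using that by simp
    then show "(i - 1) * d a < Suc m * d a" using da by (rule mult_strict_right_mono)
  qed
  have rel: "T a m u * T a m (u + 2 * int (d a)) =
      T a (Suc m) u * T a k (u + 2 * int (d a)) + zeta ^ m * T_rem a m u" for u
    using gooda[of "Suc m"] Suc unfolding good_def T_relation_def by simp
  have 1: "eqm ?c (T a (Suc m) s * T a k s') (- (zeta ^ m * T_rem a m s))"
    using rel[of s] unfolding eqm_def s'_def by (metis diff_minus_eq_add dvd_triv_right)
  have 2: "eqm ?c (T a (Suc m) s' * T a k s'') (- (zeta ^ m * T_rem a m s'))"
    using rel[of s'] unfolding eqm_def s''_def by (metis diff_minus_eq_add dvd_triv_left)
  have 3: "eqm ?c (T a k s' * T a k s'') (zeta ^ k * T_rem a k s')"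
  proof (cases k)
    case (Suc j)
    have "T a k s' * T a k s'' = T a m s' * T a j s'' + zeta ^ k * T_rem a k s'"
      using gooda[of m] Suc \<open>m = Suc k\<close> unfolding good_def T_relation_def s''_def by simp
    then show ?thesis unfolding eqm_def by simp
  qed simp
  have 4: "eqm ?c (T_rem a m s * T_rem a m s') (T_rem a (Suc m) s * T_rem a k s')"
    unfolding T_rem_def prod.distrib[symmetric]
  proof (rule eqm_prod)
    fix b assume "b \<in> {1..r} - {a}"
    then show "eqm ?c (nbr_prod a b m s * nbr_prod a b m s') (nbr_prod a b (Suc m) s * nbr_prod a b k s')"
      using nbr_prod_cross[of a b m s] a good Suc unfolding s'_def by simp
  qed
  let ?X = "zeta ^ k * T_rem a k s'" and ?TT = "T a (Suc m) s * T a (Suc m) s'"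
  have "eqm ?c (?X * ?TT) ((T a k s' * T a k s'') * ?TT)"
    by (intro eqm_mult eqm_sym[OF 3] eqm_refl)
  also have "(T a k s' * T a k s'') * ?TT = (T a (Suc m) s * T a k s') * (T a (Suc m) s' * T a k s'')"
    by (simp only: mult_ac)
  also have "eqm ?c \<dots> (- (zeta ^ m * T_rem a m s) * - (zeta ^ m * T_rem a m s'))"
    by (intro eqm_mult 1 2)
  also have "\<dots> = zeta ^ m * zeta ^ m * (T_rem a m s * T_rem a m s')"
    by (simp add: mult_ac)
  also have "eqm ?c \<dots> (zeta ^ m * zeta ^ m * (T_rem a (Suc m) s * T_rem a k s'))"
    by (intro eqm_mult 4 eqm_refl)
  also have "\<dots> = ?X * (zeta ^ Suc m * T_rem a (Suc m) s)"
    by (simp add: Suc mult_ac)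
  finally have eq: "eqm ?c (?X * ?TT) (?X * (zeta ^ Suc m * T_rem a (Suc m) s))" .
  have "regular_pair ?c ?X"
  proof (intro regular_pair_mult regular_pair_power)
    show "regular_pair ?c zeta"
      by (rule regular_T_zeta) (use a gooda in auto)
    show "regular_pair ?c (T_rem a k s')"
      unfolding T_rem_def nbr_prod_def
    proof (intro regular_pair_prod)
      fix b e assume b: "b \<in> {1..r} - {a}" and e: "e \<in> {..<c a b}"
      have "good b i" if "i \<le> nbr_len a b k e" for i
      proof (cases "k = 0")
        case True
        then have "nbr_len a b k e = 0"
          using e by (simp add: nbr_len_def)
        then show ?thesis using that good[of b i] b da by simp
      next
        case False
        have "(i - 1) * d b \<le> (nbr_len a b k e - 1) * d b"
          using that by (intro mult_le_mono1) simp
        also have "\<dots> < k * d a"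
          by (rule nbr_len_measure) (use a b e False in auto)
        also have "\<dots> \<le> Suc m * d a"
          using Suc by (intro mult_le_mono1) simp
        finally show ?thesis using good b by blast
      qed
      then show "regular_pair ?c (T b (nbr_len a b k e)
          (s' + int (min (d a) (d b)) + 2 * int (d a) * int e))"
        using a b gooda by (intro regular_T[THEN conjunct1]) auto
    qed
  qed
  from eqm_cancel[OF this eq] show ?thesis
    unfolding eqm_def s'_def .
qed

text \<open>Divisibility makes the chosen quotient exact, hence the relation holds. The other
  clauses pass to the quotient by cancelling \<open>T a m\<close>, all of whose variables except
  \<open>zeta\<close> lie strictly to the right of \<open>s\<close>.\<close>

lemma good_all: "a \<in> {1..r} \<Longrightarrow> good a n"
proof (induction "(n - 1) * d a" arbitrary: a n rule: less_induct)
  case less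
  note a = less.prems
  have da: "0 < d a" using a d_pos by blast
  consider "n = 0" | "n = Suc 0" | m where "n = Suc (Suc m)"
    by (metis not0_implies_Suc)
  then show ?case
  proof cases
    case 1
    then show ?thesis by (simp add: good_def)
  next
    case 2
    moreover have "mvar v \<noteq> 0" for v :: "nat \<times> int"
      by (simp add: mvar_def)
    ultimately show ?thesis
      using a by (auto simp: good_def free_of_def shift_var_simps)
  next
    case (3 m)
    have IH: "good a' m'" if "a' \<in> {1..r}" "(m' - 1) * d a' < Suc m * d a" for a' m'
      using less.hyps[of m' a'] that 3 by simp
    have gooda: "good a i" if "i \<le> Suc m" for i
    proof (rule IH[OF a])
      have "i - 1 < Suc m" using that by simp
      then show "(i - 1) * d a < Suc m * d a" using da by (rule mult_strict_right_mono)
    qed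
    have E: "T a (Suc m) s * T a (Suc m) (s + 2 * int (d a)) - zeta ^ Suc m * T_rem a (Suc m) s =
        T a n s * T a m (s + 2 * int (d a))" for s
    proof -
      have "T a n s = exact_quot (T a (Suc m) s * T a (Suc m) (s + 2 * int (d a)) -
          zeta ^ Suc m * T_rem a (Suc m) s) (T a m (s + 2 * int (d a)))"
        using a by (simp add: 3 T_rem_def nbr_prod_def)
      moreover have "\<exists>q. T a (Suc m) s * T a (Suc m) (s + 2 * int (d a)) -
          zeta ^ Suc m * T_rem a (Suc m) s = q * T a m (s + 2 * int (d a))"
        using T_dvd[OF a IH, where s = s and m = m] by (metis dvdE mult.commute)
      ultimately show ?thesis
        unfolding exact_quot_def by (metis (mono_tags, lifting) someI_ex)
    qed
    have rel: "T_relation a (Suc m)"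
      unfolding T_relation_def using E 3 by (simp add: algebra_simps)
    have free_rem: "free_of (b, p) (T_rem a (Suc m) s)" if "b \<noteq> 0" "p \<le> s" for b p s
      unfolding T_rem_def nbr_prod_def
    proof (intro free_of_prod)
      fix b' e assume b': "b' \<in> {1..r} - {a}" and e: "e \<in> {..<c a b'}"
      have "good b' (nbr_len a b' (Suc m) e)"
        by (rule IH) (use nbr_len_measure[of a b' e "Suc m"] a b' e in auto)
      moreover have "p < s + int (min (d a) (d b')) + 2 * int (d a) * int e"
      proof -
        have "0 < min (d a) (d b')" using da d_pos b' by simp
        moreover have "0 \<le> 2 * int (d a) * int e" by simp
        ultimately show ?thesis using that by linarith
      qed
      ultimately show "free_of (b, p)
          (T b' (nbr_len a b' (Suc m) e) (s + int (min (d a) (d b')) + 2 * int (d a) * int e))"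
        using that unfolding good_def by blast
    qed
    have nz: "T a i s \<noteq> 0" if "i \<le> Suc m" for i s
      using gooda[OF that] unfolding good_def by blast
    have free: "free_of (b, p) (T a i s)" if "i \<le> Suc m" "b \<noteq> 0" "p < s \<or> p = s \<and> b \<noteq> a" for i b p s
      using gooda[OF that(1)] that unfolding good_def by blast
    have free': "free_of (b, p) (T a n s)" if "b \<noteq> 0" "p < s \<or> p = s \<and> b \<noteq> a" for b p s
    proof (rule free_of_quot)
      show "free_of (b, p) (T a n s * T a m (s + 2 * int (d a)))"
        unfolding E[symmetric]
        by (intro free_of_diff free_of_mult free_of_power free_of_zeta free free_rem)
          (use that da in auto)
      show "free_of (b, p) (T a m (s + 2 * int (d a)))"
        by (rule free) (use that da in auto)
    qed (use nz in auto)
    have lead: "shift_var (a, s) (T a n s) = [:T a n s, T a (Suc m) (s + 2 * int (d a)):]" for s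
    proof -
      let ?v = "(a, s)" and ?s = "s + 2 * int (d a)"
      have 1: "shift_var ?v (T a (Suc m) s) = [:T a (Suc m) s, T a m ?s:]"
        using gooda[of "Suc m"] unfolding good_def by simp
      have a0: "a \<noteq> 0" using a by simp
      have 2: "shift_var ?v (T a i ?s) = [:T a i ?s:]" if "i \<le> Suc m" for i
        using free[OF that a0, of s ?s] da unfolding free_of_def by simp
      have 3: "shift_var ?v (zeta ^ Suc m * T_rem a (Suc m) s) = [:zeta ^ Suc m * T_rem a (Suc m) s:]"
        using free_of_mult[OF free_of_power[OF free_of_zeta[OF a0]] free_rem[OF a0 order_refl]]
        unfolding free_of_def by blast
      have "shift_var ?v (T a n s) * [:T a m ?s:] = shift_var ?v (T a n s * T a m ?s)"
        by (simp add: shift_var_simps 2)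
      also have "\<dots> = [:T a (Suc m) s, T a m ?s:] * [:T a (Suc m) ?s:] -
          [:zeta ^ Suc m * T_rem a (Suc m) s:]"
        unfolding E[symmetric] shift_var_simps(1) 3 shift_var_simps(2)[of ?v "T a (Suc m) s"] 1 2[OF order_refl] ..
      also have "\<dots> = [:T a (Suc m) s * T a (Suc m) ?s - zeta ^ Suc m * T_rem a (Suc m) s,
          T a m ?s * T a (Suc m) ?s:]"
        by (simp add: mult.commute)
      also have "\<dots> = [:T a n s, T a (Suc m) ?s:] * [:T a m ?s:]"
        unfolding E by (simp add: mult.commute)
      finally show ?thesis
        using nz[of m ?s] by (metis le_SucI mult_cancel_right order_refl pCons_eq_0_iff)
    qed
    have "T a n s \<noteq> 0" for s
      using lead[of s] nz[of "Suc m"] by (auto simp: shift_var_simps)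
    then show ?thesis
      unfolding good_def using free' lead rel 3 by simp
  qed
qed

theorem T_relation_all: "a \<in> {1..r} \<Longrightarrow> 0 < n \<Longrightarrow> T_relation a n"
  using good_all[of a "Suc n"] unfolding good_def by simp

end

section \<open>Laurent series\<close>

text \<open>Unlike a bound on \<open>fls_subdegree\<close>, which is 0 at the zero series, this
  holds of 0 for every \<open>n\<close> and is stable under sums and differences.\<close>

definition ord_ge :: "'a::zero fls \<Rightarrow> int \<Rightarrow> bool" where
  "ord_ge f n \<longleftrightarrow> (\<forall>m<n. fls_nth f m = 0)"

lemma ord_ge_iff: "ord_ge f n \<longleftrightarrow> f = 0 \<or> n \<le> fls_subdegree f"
proof
  assume "ord_ge f n"
  then show "f = 0 \<or> n \<le> fls_subdegree f"
    unfolding ord_ge_def using fls_subdegree_geI by blast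
qed (auto simp: ord_ge_def)

lemma ord_ge_mono: "ord_ge f n \<Longrightarrow> m \<le> n \<Longrightarrow> ord_ge f m"
  by (simp add: ord_ge_def)

lemma ord_ge_mult:
  fixes f g :: "'a::idom fls"
  shows "ord_ge f m \<Longrightarrow> ord_ge g n \<Longrightarrow> ord_ge (f * g) (m + n)"
  by (cases "f = 0 \<or> g = 0") (auto simp: ord_ge_iff)

lemma ord_ge_power:
  fixes f :: "'a::idom fls"
  shows "ord_ge f m \<Longrightarrow> ord_ge (f ^ n) (int n * m)"
proof (induction n)
  case 0
  then show ?case by (simp add: ord_ge_def)
next
  case (Suc n)
  then show ?case
    using ord_ge_mult[of f m "f ^ n" "int n * m"] by (simp add: distrib_right)
qed

lemma ord_ge_add:
  fixes f g :: "'a::comm_ring_1 fls"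
  shows "ord_ge f n \<Longrightarrow> ord_ge g n \<Longrightarrow> ord_ge (f + g) n"
  by (simp add: ord_ge_def)

lemma ord_ge_diff:
  fixes f g :: "'a::comm_ring_1 fls"
  shows "ord_ge f n \<Longrightarrow> ord_ge g n \<Longrightarrow> ord_ge (f - g) n"
  by (simp add: ord_ge_def)

lemma fls_nth_sum': "fls_nth (sum f A) n = (\<Sum>x\<in>A. fls_nth (f x) n)"
  by (induction A rule: infinite_finite_induct) simp_all

lemma ord_ge_const: "ord_ge (fls_const x) 0"
  by (simp add: ord_ge_def)

definition one_unit :: "'a::field fls \<Rightarrow> bool" where
  "one_unit f \<longleftrightarrow> ord_ge (f - 1) 1"

lemma one_unit_nonzero: "one_unit f \<Longrightarrow> f \<noteq> 0"
  by (auto simp: one_unit_def ord_ge_def dest!: spec[of _ 0])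

lemma one_unit_subdegree:
  assumes "one_unit f" shows "fls_subdegree f = 0" "fls_nth f 0 = 1" "ord_ge f 0"
proof -
  show f0: "fls_nth f 0 = 1"
    using assms unfolding one_unit_def ord_ge_def by (auto dest!: spec[of _ 0])
  have "fls_nth f m = 0" if "m < 0" for m
    using assms that unfolding one_unit_def ord_ge_def by (auto dest!: spec[of _ m])
  then show "ord_ge f 0" by (simp add: ord_ge_def)
  then show "fls_subdegree f = 0"
    using f0 by (intro fls_subdegree_eqI) (auto simp: ord_ge_def)
qed

lemma one_unit_1 [simp]: "one_unit 1"
  by (simp add: one_unit_def ord_ge_def)

lemma one_unit_one_minus: "ord_ge y 1 \<Longrightarrow> one_unit (1 - y)"
  by (simp add: one_unit_def ord_ge_def)

lemma one_unit_mult: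
  assumes "one_unit f" "one_unit g" shows "one_unit (f * g)"
proof -
  have "f * g - 1 = (f - 1) * g + (g - 1)"
    by (simp add: algebra_simps)
  moreover have "ord_ge ((f - 1) * g) (1 + 0)"
    using assms one_unit_subdegree(3) by (intro ord_ge_mult) (auto simp: one_unit_def)
  ultimately show ?thesis
    using assms(2) unfolding one_unit_def by (simp only: add_0_right ord_ge_add)
qed

lemma one_unit_inverse:
  assumes "one_unit f" shows "one_unit (inverse f)"
proof -
  have f: "f \<noteq> 0" using assms one_unit_nonzero by blast
  have "inverse f - 1 = (1 - f) * inverse f"
    using f by (simp add: algebra_simps)
  moreover have "ord_ge (inverse f) 0"
    using one_unit_subdegree(1)[OF assms] by (simp add: ord_ge_iff)
  moreover have "ord_ge (1 - f) 1"
  proof -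
    have "ord_ge (0 - (f - 1)) 1"
      by (rule ord_ge_diff) (use assms in \<open>simp_all add: one_unit_def ord_ge_iff\<close>)
    then show ?thesis by simp
  qed
  ultimately show ?thesis
    unfolding one_unit_def using ord_ge_mult[of "1 - f" 1 "inverse f" 0] by simp
qed

lemma one_unit_power: "one_unit f \<Longrightarrow> one_unit (f ^ n)"
  by (induction n) (simp_all add: one_unit_mult)

lemma one_unit_power_int: "one_unit f \<Longrightarrow> one_unit (f powi n)"
  by (simp add: power_int_def one_unit_power one_unit_inverse)

lemma one_unit_prod: "(\<And>x. x \<in> A \<Longrightarrow> one_unit (f x)) \<Longrightarrow> one_unit (prod f A)"
  by (induction A rule: infinite_finite_induct) (simp_all add: one_unit_mult)

lemma fls_const_of_rat: "fls_const (of_rat q) = (of_rat q :: 'a::field_char_0 fls)"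
proof (cases q)
  case (Fract a b)
  have b: "(of_int b :: 'a) \<noteq> 0" using Fract by simp
  have "fls_const (of_rat q) * fls_const (of_int b) = fls_const (of_int a :: 'a)"
    using b Fract by (simp add: of_rat_rat)
  then have "fls_const (of_rat q) * (of_int b :: 'a fls) = of_int a"
    by (simp add: fls_of_int)
  moreover have "(of_int b :: 'a fls) \<noteq> 0" using Fract by simp
  ultimately have "fls_const (of_rat q) = (of_int a / of_int b :: 'a fls)"
    by (simp add: nonzero_eq_divide_eq)
  then show ?thesis using Fract by (simp add: of_rat_rat)
qed

section \<open>The binomial series for arbitrary integer exponents\<close>

definition binc :: "int \<Rightarrow> nat \<Rightarrow> rat" where
  "binc p k = of_int (int k + p) gchoose k"

lemma binc_0 [simp]: "binc p 0 = 1"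
  by (simp add: binc_def)

lemma binc_minus_1: "binc (-1) (Suc k) = 0"
  by (simp add: binc_def flip: binomial_gbinomial)

lemma binc_pascal: "binc (p + 1) (Suc k) = binc p (Suc k) + binc (p + 1) k"
proof -
  have "binc (p + 1) (Suc k) = (of_int (int k + p + 1) + 1 gchoose Suc k)"
    by (simp add: binc_def algebra_simps)
  also have "\<dots> = (of_int (int k + p + 1) gchoose k) + (of_int (int k + p + 1) gchoose Suc k)"
    by (rule gbinomial_Suc_Suc)
  finally show ?thesis
    by (simp add: binc_def algebra_simps)
qed

definition bin_trunc :: "int \<Rightarrow> nat \<Rightarrow> 'a::field_char_0 fls \<Rightarrow> 'a fls" where
  "bin_trunc p M y = (\<Sum>k\<le>M. of_rat (binc p k) * y ^ k)"

lemma bin_trunc_step: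
  "(1 - y) * bin_trunc (p + 1) M y = bin_trunc p M y - of_rat (binc (p + 1) M) * y ^ Suc M"
proof (induction M)
  case 0
  then show ?case by (simp add: bin_trunc_def)
next
  case (Suc M)
  have "(1 - y) * bin_trunc (p + 1) (Suc M) y =
      (1 - y) * bin_trunc (p + 1) M y + (1 - y) * (of_rat (binc (p + 1) (Suc M)) * y ^ Suc M)"
    by (simp add: bin_trunc_def algebra_simps)
  also have "\<dots> = bin_trunc p M y + (of_rat (binc (p + 1) (Suc M)) - of_rat (binc (p + 1) M)) * y ^ Suc M
      - of_rat (binc (p + 1) (Suc M)) * y ^ Suc (Suc M)"
    unfolding Suc by (simp add: algebra_simps)
  also have "of_rat (binc (p + 1) (Suc M)) - of_rat (binc (p + 1) M) = (of_rat (binc p (Suc M)) :: 'a fls)"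
    by (simp add: binc_pascal of_rat_add)
  finally show ?case by (simp add: bin_trunc_def)
qed

text \<open>The case \<open>p = -1\<close> is trivial and Pascal's rule moves between
  \<open>p\<close> and \<open>p + 1\<close>; induction in both directions reaches negative
  \<open>p\<close> as well. Truncation avoids substituting a series into an infinite sum.\<close>

lemma bin_trunc_approx:
  fixes y :: "'a::field_char_0 fls"
  assumes y: "ord_ge y 1"
  shows "ord_ge ((1 - y) powi (- p - 1) - bin_trunc p M y) (int (Suc M))"
proof -
  have u: "one_unit (1 - y)" by (rule one_unit_one_minus[OF y])
  then have nz: "1 - y \<noteq> 0" by (rule one_unit_nonzero)
  have "ord_ge (of_rat (binc (q + 1) M) :: 'a fls) 0" for q
    unfolding fls_const_of_rat[symmetric] by (rule ord_ge_const)
  then have err: "ord_ge (of_rat (binc (q + 1) M) * y ^ Suc M) (int (Suc M))" for q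
    using ord_ge_mult[OF _ ord_ge_power[OF y, of "Suc M"]] by fastforce
  let ?E = "\<lambda>p. (1 - y) powi (- p - 1) - bin_trunc p M y"
  have step: "(1 - y) * ?E (q + 1) = ?E q + of_rat (binc (q + 1) M) * y ^ Suc M" for q
  proof -
    have "(1 - y) powi (- q - 1) = (1 - y) powi ((- (q + 1) - 1) + 1)"
      by (rule arg_cong) linarith
    also have "\<dots> = (1 - y) * (1 - y) powi (- (q + 1) - 1)"
      by (rule power_int_add_1') (use nz in simp)
    finally show ?thesis
      unfolding right_diff_distrib[of "1 - y"] bin_trunc_step by simp
  qed
  show ?thesis
  proof (induction p rule: int_induct[of _ "-1"])
    case base
    have "bin_trunc (- 1) M y = 1"
      unfolding bin_trunc_def by (induction M) (simp_all add: binc_minus_1)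
    then show ?case by (simp add: ord_ge_def)
  next
    case (step1 q)
    have "ord_ge ((1 - y) * ?E (q + 1)) (int (Suc M))"
      unfolding step using step1.IH err by (rule ord_ge_add)
    moreover have "ord_ge (inverse (1 - y)) 0"
      using one_unit_subdegree(3)[OF one_unit_inverse[OF u]] .
    ultimately have "ord_ge (inverse (1 - y) * ((1 - y) * ?E (q + 1))) (0 + int (Suc M))"
      by (intro ord_ge_mult)
    moreover have "inverse (1 - y) * ((1 - y) * ?E (q + 1)) = ?E (q + 1)"
      by (simp only: mult.assoc[symmetric] left_inverse[OF nz] mult_1_left)
    ultimately show ?case by (simp only: add_0)
  next
    case (step2 q)
    have "(1 - y) * ?E q = ?E (q - 1) + of_rat (binc q M) * y ^ Suc M"
      using step[of "q - 1"] unfolding diff_add_cancel .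
    then have "?E (q - 1) = (1 - y) * ?E q - of_rat (binc q M) * y ^ Suc M"
      by (simp only: add_diff_cancel_right')
    moreover have "ord_ge ((1 - y) * ?E q) (0 + int (Suc M))"
      using one_unit_subdegree(3)[OF u] step2.IH by (rule ord_ge_mult)
    ultimately show ?case
      using err[of "q - 1"] unfolding diff_add_cancel add_0 by (simp only: ord_ge_diff)
  qed
qed

text \<open>The order of \<open>y ^ k\<close> restricts the sum to \<open>k * i \<le> N\<close>,
  which are the multiplicities that a site of grade \<open>i\<close> can have in a configuration of
  weight \<open>N\<close>.\<close>

lemma binomial_series_nth:
  fixes g y :: "'a::field_char_0 fls"
  assumes g: "ord_ge g 0" and y: "ord_ge y (int i)" and "0 < i"
  shows "fls_nth (g * (1 - y) powi (- p - 1)) (int N) =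
    (\<Sum>k | k * i \<le> N. of_rat (binc p k) * fls_nth (g * y ^ k) (int N))"
proof -
  have y1: "ord_ge y 1" using y by (rule ord_ge_mono) (use \<open>0 < i\<close> in simp)
  have "ord_ge (g * ((1 - y) powi (- p - 1) - bin_trunc p N y)) (0 + int (Suc N))"
    by (intro ord_ge_mult g bin_trunc_approx y1)
  then have "fls_nth (g * (1 - y) powi (- p - 1)) (int N) = fls_nth (g * bin_trunc p N y) (int N)"
    by (simp add: ord_ge_def right_diff_distrib)
  also have "g * bin_trunc p N y = (\<Sum>k\<le>N. fls_const (of_rat (binc p k)) * (g * y ^ k))"
    by (simp add: bin_trunc_def sum_distrib_left fls_const_of_rat mult_ac)
  also have "fls_nth \<dots> (int N) = (\<Sum>k\<le>N. of_rat (binc p k) * fls_nth (g * y ^ k) (int N))"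
    by (simp add: fls_nth_sum')
  also have "\<dots> = (\<Sum>k | k * i \<le> N. of_rat (binc p k) * fls_nth (g * y ^ k) (int N))"
  proof (rule sum.mono_neutral_right)
    show "{k. k * i \<le> N} \<subseteq> {..N}"
    proof
      fix k assume "k \<in> {k. k * i \<le> N}"
      moreover have "k * 1 \<le> k * i" using \<open>0 < i\<close> by (intro mult_le_mono2) simp
      ultimately show "k \<in> {..N}" unfolding mem_Collect_eq atMost_iff mult_1_right by (rule order_trans[rotated])
    qed
    show "\<forall>k\<in>{..N} - {k. k * i \<le> N}. of_rat (binc p k) * fls_nth (g * y ^ k) (int N) = 0"
    proof
      fix k assume "k \<in> {..N} - {k. k * i \<le> N}"
      then have "int N < int k * int i"
        by (simp flip: of_nat_mult)
      moreover have "ord_ge (g * y ^ k) (0 + int k * int i)"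
        by (intro ord_ge_mult ord_ge_power g y)
      ultimately show "of_rat (binc p k) * fls_nth (g * y ^ k) (int N) = 0"
        by (simp add: ord_ge_def)
    qed
  qed simp
  finally show ?thesis .
qed

section \<open>The generating function of the fermionic sums\<close>

context cartan_data
begin

text \<open>The coefficient of \<open>m y\<close> in \<open>q_a + p_{a,i}\<close> for
  \<open>x = (a, i)\<close>; at \<open>i = 0\<close> it is the coefficient in \<open>q_a\<close>
  alone.\<close>

definition kap :: "nat \<times> nat \<Rightarrow> nat \<times> nat \<Rightarrow> int" where
  "kap x y = (if fst x = fst y then 2 * max 0 (int (snd y) - int (snd x))
     else - max 0 (int (c (fst x) (fst y)) * int (snd y) - int (c (fst y) (fst x)) * int (snd x)))"

definition time :: "nat \<times> nat \<Rightarrow> nat" where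
  "time x = snd x * d (fst x)"

definition sites :: "(nat \<times> nat) set" where
  "sites = {1..r} \<times> {1..}"

lemma time_pos: "x \<in> sites \<Longrightarrow> 0 < time x"
  using d_pos by (auto simp: sites_def time_def)

text \<open>Symmetrizability, \<open>d a * c a b = d b * c b a\<close>, makes the positive parts in
  \<open>kap\<close> a comparison of times. Hence a vacancy number sees only the multiplicities at
  strictly later sites.\<close>

lemma kap_eq_0:
  assumes "fst x \<in> {1..r}" "fst y \<in> {1..r}" "time y \<le> time x"
  shows "kap x y = 0"
proof (cases "fst x = fst y")
  case True
  then show ?thesis
    using assms d_pos[of "fst x"] by (simp add: kap_def time_def)
next
  case False
  let ?a = "fst x" and ?b = "fst y"
  have "d ?a * (c ?a ?b * snd y) = c ?b ?a * time y"
    using symm[OF assms(1,2) False] by (simp add: time_def mult_ac)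
  also have "\<dots> \<le> c ?b ?a * time x"
    using assms(3) by simp
  also have "\<dots> = d ?a * (c ?b ?a * snd x)"
    by (simp add: time_def mult_ac)
  finally have "c ?a ?b * snd y \<le> c ?b ?a * snd x"
    using d_pos[OF assms(1)] by simp
  then show ?thesis
    using False by (simp add: kap_def flip: of_nat_mult)
qed

definition earlier :: "nat \<times> nat \<Rightarrow> (nat \<times> nat) set" where
  "earlier y = {x \<in> sites. time x < time y}"

lemma finite_earlier [simp]: "finite (earlier y)"
proof (rule finite_subset)
  show "earlier y \<subseteq> {1..r} \<times> {1..time y}"
  proof
    fix x assume x: "x \<in> earlier y"
    then have "0 < d (fst x)" using d_pos by (auto simp: earlier_def sites_def)
    then have "snd x \<le> time x" by (simp add: time_def)
    then show "x \<in> {1..r} \<times> {1..time y}"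
      using x by (cases x) (auto simp: earlier_def sites_def)
  qed
qed simp

definition down_closed :: "(nat \<times> nat) set \<Rightarrow> bool" where
  "down_closed S \<longleftrightarrow> S \<subseteq> sites \<and> (\<forall>y\<in>S. earlier y \<subseteq> S)"

definition configs :: "(nat \<times> nat) set \<Rightarrow> nat \<Rightarrow> (nat \<times> nat \<Rightarrow> nat) set" where
  "configs S N = {m. (\<forall>x. x \<notin> S \<longrightarrow> m x = 0) \<and> (\<Sum>x\<in>S. snd x * m x) = N}"

definition vac :: "(nat \<times> nat) set \<Rightarrow> (nat \<times> nat \<Rightarrow> int) \<Rightarrow> (nat \<times> nat \<Rightarrow> nat) \<Rightarrow> nat \<times> nat \<Rightarrow> int" where
  "vac S P m x = P x + (\<Sum>y\<in>S. kap x y * int (m y))"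

definition bin_weight :: "(nat \<times> nat) set \<Rightarrow> (nat \<times> nat \<Rightarrow> int) \<Rightarrow> (nat \<times> nat \<Rightarrow> nat) \<Rightarrow> rat" where
  "bin_weight S P m = (\<Prod>x\<in>S. binc (vac S P m x) (m x))"

lemma finite_configs:
  assumes "finite S" "S \<subseteq> sites" shows "finite (configs S N)"
proof (rule finite_subset)
  show "configs S N \<subseteq> {m. \<forall>x. (x \<in> S \<longrightarrow> m x \<in> {..N}) \<and> (x \<notin> S \<longrightarrow> m x = 0)}"
  proof (intro subsetI CollectI allI conjI impI)
    fix m x assume m: "m \<in> configs S N"
    show "m x = 0" if "x \<notin> S" using m that unfolding configs_def by blast
    assume x: "x \<in> S"
    have "1 \<le> snd x" using x assms(2) by (auto simp: sites_def)
    then have "m x \<le> snd x * m x" by simp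
    also have "\<dots> \<le> (\<Sum>x\<in>S. snd x * m x)"
      using assms(1) x by (intro member_le_sum) auto
    finally show "m x \<in> {..N}" using m by (simp add: configs_def)
  qed
qed (rule finite_set_of_finite_funs[OF assms(1) finite_atMost])

lemma sum_configs_insert:
  assumes "finite S" "S \<subseteq> sites" "x \<notin> S" "x \<in> sites"
  shows "(\<Sum>m\<in>configs (insert x S) N. f m) =
    (\<Sum>k | k * snd x \<le> N. \<Sum>m\<in>configs S (N - k * snd x). f (m(x := k)))"
proof -
  have fin: "finite {k. k * snd x \<le> N}"
  proof (rule finite_subset)
    have "1 \<le> snd x" using assms(4) by (auto simp: sites_def)
    then have "k \<le> k * snd x" for k by simp
    then show "{k. k * snd x \<le> N} \<subseteq> {..N}" using order_trans by blast
  qed simp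
  have sum_upd: "(\<Sum>y\<in>S. snd y * (m(x := k)) y) = (\<Sum>y\<in>S. snd y * m y)" for m and k :: nat
    by (rule sum.cong) (use assms(3) in auto)
  have "(\<Sum>k | k * snd x \<le> N. \<Sum>m\<in>configs S (N - k * snd x). f (m(x := k))) =
      (\<Sum>(k, m)\<in>(SIGMA k:{k. k * snd x \<le> N}. configs S (N - k * snd x)). f (m(x := k)))"
    by (rule sum.Sigma) (use fin finite_configs assms in auto)
  also have "\<dots> = (\<Sum>m\<in>configs (insert x S) N. f m)"
  proof (rule sum.reindex_bij_witness[of _ "\<lambda>m. (m x, m(x := 0))" "\<lambda>(k, m). m(x := k)"])
    fix p assume "p \<in> (SIGMA k:{k. k * snd x \<le> N}. configs S (N - k * snd x))"
    then obtain k m where p: "p = (k, m)" "k * snd x \<le> N" "m \<in> configs S (N - k * snd x)"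
      by auto
    then have mx: "m x = 0" using assms(3) unfolding configs_def by blast
    show "((case p of (k, m) \<Rightarrow> m(x := k)) x, (case p of (k, m) \<Rightarrow> m(x := k))(x := 0)) = p"
      using mx by (auto simp: p)
    show "(case p of (k, m) \<Rightarrow> m(x := k)) \<in> configs (insert x S) N"
      using p assms(1,3) sum_upd[of m k] by (auto simp: configs_def mult.commute)
    show "f (case p of (k, m) \<Rightarrow> m(x := k)) = (case p of (k, m) \<Rightarrow> f (m(x := k)))"
      by (simp add: p)
  next
    fix m assume m: "m \<in> configs (insert x S) N"
    show "(case (m x, m(x := 0)) of (k, m) \<Rightarrow> m(x := k)) = m" by simp
    show "(m x, m(x := 0)) \<in> (SIGMA k:{k. k * snd x \<le> N}. configs S (N - k * snd x))"
      using m assms(1,3) sum_upd[of m 0] by (auto simp: configs_def mult.commute)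
  qed
  finally show ?thesis ..
qed

end

locale y_system = cartan_data +
  fixes \<upsilon> :: "nat \<Rightarrow> 'k::field_char_0"
  assumes \<upsilon>_nonzero: "a \<in> {1..r} \<Longrightarrow> \<upsilon> a \<noteq> 0"
begin

text \<open>A factor \<open>Y y\<close> stands for one more unit of \<open>m y\<close>:
  \<open>fls_X\<close> records the weight \<open>snd y\<close>, while the constants and the factors
  \<open>1 - Y x\<close> shift every \<open>P x\<close> by \<open>kap x y\<close>, as in
  \<open>gen_fun_shift\<close>. Only earlier sites occur because \<open>kap x y\<close> vanishes at
  all others.\<close>

function Y :: "nat \<times> nat \<Rightarrow> 'k fls" where
  "Y y = fls_X ^ snd y * ((\<Prod>a\<in>{1..r}. fls_const (\<upsilon> a) powi kap (a, 0) y) *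
     (\<Prod>x\<in>earlier y. (1 - Y x) powi (- kap x y)))"
  by pat_completeness auto
termination
  by (relation "measure time") (auto simp: earlier_def)

declare Y.simps [simp del]

lemma const_power_int: "fls_const (\<upsilon> a) powi n = fls_const (\<upsilon> a powi n)"
  by (simp add: fls_const_power_int)

definition const_part :: "(nat \<times> nat \<Rightarrow> int) \<Rightarrow> 'k fls" where
  "const_part P = (\<Prod>a\<in>{1..r}. fls_const (\<upsilon> a) powi P (a, 0))"

lemma const_part_const: "const_part P = fls_const (\<Prod>a\<in>{1..r}. \<upsilon> a powi P (a, 0))"
proof -
  have "(\<Prod>a\<in>A. fls_const (f a)) = fls_const (\<Prod>a\<in>A. f a)" for f :: "nat \<Rightarrow> 'k" and A
    by (induction A rule: infinite_finite_induct) simp_all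
  then show ?thesis by (simp add: const_part_def const_power_int)
qed

lemma ord_Y: "y \<in> sites \<Longrightarrow> ord_ge (Y y) (int (snd y))"
  and one_unit_Y: "y \<in> sites \<Longrightarrow> one_unit (1 - Y y)"
proof -
  have main: "ord_ge (Y y) (int (snd y))" if "y \<in> sites" for y
    using that
  proof (induction y rule: Y.induct)
    case (1 y)
    have "one_unit (\<Prod>x\<in>earlier y. (1 - Y x) powi (- kap x y))"
    proof (intro one_unit_prod one_unit_power_int one_unit_one_minus)
      fix x assume x: "x \<in> earlier y"
      then have "ord_ge (Y x) (int (snd x))" "1 \<le> snd x"
        using 1 by (auto simp: earlier_def sites_def)
      then show "ord_ge (Y x) 1" by (auto intro: ord_ge_mono)
    qed
    then have "ord_ge (\<Prod>x\<in>earlier y. (1 - Y x) powi (- kap x y)) 0"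
      by (rule one_unit_subdegree)
    moreover have "ord_ge (\<Prod>a\<in>{1..r}. fls_const (\<upsilon> a) powi kap (a, 0) y) 0"
      using const_part_const[of "\<lambda>x. kap x y"] unfolding const_part_def by (simp add: ord_ge_const)
    moreover have "ord_ge (fls_X ^ snd y :: 'k fls) (int (snd y) * 1)"
      by (rule ord_ge_power) (simp add: ord_ge_iff)
    ultimately have "ord_ge (fls_X ^ snd y * ((\<Prod>a\<in>{1..r}. fls_const (\<upsilon> a) powi kap (a, 0) y) *
        (\<Prod>x\<in>earlier y. (1 - Y x) powi (- kap x y)))) (int (snd y) * 1 + (0 + 0))"
      by (intro ord_ge_mult)
    then show ?case unfolding Y.simps[of y] by simp
  qed
  show "y \<in> sites \<Longrightarrow> ord_ge (Y y) (int (snd y))" by (rule main)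
  show "one_unit (1 - Y y)" if "y \<in> sites"
  proof (rule one_unit_one_minus)
    show "ord_ge (Y y) 1"
      by (rule ord_ge_mono[OF main[OF that]]) (use that in \<open>auto simp: sites_def\<close>)
  qed
qed

lemma Y_nonone: "y \<in> sites \<Longrightarrow> 1 - Y y \<noteq> 0"
  using one_unit_Y one_unit_nonzero by blast

definition gen_fun :: "(nat \<times> nat) set \<Rightarrow> (nat \<times> nat \<Rightarrow> int) \<Rightarrow> 'k fls" where
  "gen_fun S P = const_part P * (\<Prod>x\<in>S. (1 - Y x) powi (- P x - 1))"

definition const_weight :: "(nat \<times> nat \<Rightarrow> int) \<Rightarrow> 'k" where
  "const_weight P = (\<Prod>a\<in>{1..r}. \<upsilon> a powi P (a, 0))"

lemma Y_eq_prod: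
  assumes "finite S" "S \<subseteq> sites" "earlier y \<subseteq> S" "y \<in> sites"
  shows "Y y = fls_X ^ snd y * (const_part (\<lambda>x. kap x y) * (\<Prod>x\<in>S. (1 - Y x) powi (- kap x y)))"
proof -
  have "(\<Prod>x\<in>earlier y. (1 - Y x) powi (- kap x y)) = (\<Prod>x\<in>S. (1 - Y x) powi (- kap x y))"
  proof (rule prod.mono_neutral_left)
    show "\<forall>x\<in>S - earlier y. (1 - Y x) powi (- kap x y) = 1"
    proof
      fix x assume x: "x \<in> S - earlier y"
      then have "time y \<le> time x" using assms(2) by (auto simp: earlier_def)
      moreover have "fst x \<in> {1..r}" "fst y \<in> {1..r}"
        using x assms by (auto simp: sites_def)
      ultimately show "(1 - Y x) powi (- kap x y) = 1"
        using kap_eq_0[of x y] by simp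
    qed
  qed (use assms in auto)
  then show ?thesis
    by (simp add: Y.simps[of y] const_part_def)
qed

lemma gen_fun_shift:
  assumes "finite S" "S \<subseteq> sites"
  shows "gen_fun S (\<lambda>x. P x + kap x y * int k) =
    gen_fun S P * (const_part (\<lambda>x. kap x y) * (\<Prod>x\<in>S. (1 - Y x) powi (- kap x y))) ^ k"
proof -
  have 1: "const_part (\<lambda>x. P x + kap x y * int k) = const_part P * const_part (\<lambda>x. kap x y) ^ k"
    unfolding const_part_def prod_power_distrib prod.distrib[symmetric]
    by (rule prod.cong) (use \<upsilon>_nonzero in \<open>auto simp: power_int_add power_int_mult\<close>)
  have 2: "(\<Prod>x\<in>S. (1 - Y x) powi (- (P x + kap x y * int k) - 1)) =
      (\<Prod>x\<in>S. (1 - Y x) powi (- P x - 1)) * (\<Prod>x\<in>S. (1 - Y x) powi (- kap x y)) ^ k"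
    unfolding prod_power_distrib prod.distrib[symmetric]
  proof (rule prod.cong)
    fix x assume "x \<in> S"
    then have nz: "1 - Y x \<noteq> 0" using Y_nonone assms(2) by blast
    have "- (P x + kap x y * int k) - 1 = (- P x - 1) + (- kap x y) * int k"
      by (simp add: algebra_simps)
    then show "(1 - Y x) powi (- (P x + kap x y * int k) - 1) =
        (1 - Y x) powi (- P x - 1) * ((1 - Y x) powi (- kap x y)) ^ k"
      by (simp only: power_int_add power_int_mult power_int_of_nat nz simp_thms)
  qed simp
  show ?thesis
    unfolding gen_fun_def 1 2 power_mult_distrib by (simp only: mult_ac)
qed

lemma ord_gen_fun:
  assumes "finite S" "S \<subseteq> sites" shows "ord_ge (gen_fun S P) 0"
proof -
  have "ord_ge (gen_fun S P) (0 + 0)"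
    unfolding gen_fun_def const_part_const
    by (intro ord_ge_mult ord_ge_const one_unit_subdegree(3) one_unit_prod one_unit_power_int one_unit_Y)
      (use assms in auto)
  then show ?thesis by simp
qed

text \<open>The site added last has the latest time, so its vacancy number is the constant
  \<open>P y\<close> and the sum over \<open>m y\<close> is a binomial series in \<open>Y y\<close>.
  Each power \<open>Y y ^ k\<close> is then absorbed into \<open>gen_fun S\<close> as a shift of
  \<open>P\<close>, to which the induction hypothesis applies.\<close>

theorem gen_fun_nth:
  assumes "finite S" "down_closed S"
  shows "fls_nth (gen_fun S P) (int N) =
    (\<Sum>m\<in>configs S N. const_weight (vac S P m) * of_rat (bin_weight S P m))"
  using assms
proof (induction S arbitrary: P N rule: finite_ranking_induct[where f = time])
  case empty
  have "configs {} N = (if N = 0 then {\<lambda>_. 0} else {})"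
    by (auto simp: configs_def)
  then show ?case
    by (simp add: gen_fun_def const_part_const const_weight_def vac_def bin_weight_def)
next
  case (insert y S)
  show ?case
  \<comment> \<open>The ranking induction also allows an element that is already present.\<close>
  proof (cases "y \<in> S")
    case True
    then show ?thesis using insert.IH insert.prems by (simp add: insert_absorb)
  next
    case y: False
    have S: "S \<subseteq> sites" "y \<in> sites" using insert.prems by (auto simp: down_closed_def)
    have "y \<notin> earlier x" if "x \<in> S" for x
      using insert.hyps(2)[OF that] by (auto simp: earlier_def)
    then have dS: "down_closed S"
      using insert.prems unfolding down_closed_def by blast
    have "y \<notin> earlier y" by (simp add: earlier_def)
    then have eS: "earlier y \<subseteq> S" using insert.prems by (auto simp: down_closed_def)
    let ?V = "const_part (\<lambda>x. kap x y) * (\<Prod>x\<in>S. (1 - Y x) powi (- kap x y))"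
    have Yy: "Y y = fls_X ^ snd y * ?V"
      by (rule Y_eq_prod) (use insert.hyps S eS in auto)
    have kap0: "kap x y' = 0" if "x = y" "y' \<in> insert y S" for x y'
      by (rule kap_eq_0) (use that S insert.hyps(2) in \<open>auto simp: sites_def\<close>)
    have vac_upd: "vac (insert y S) P (m(y := k)) x = vac S (\<lambda>x. P x + kap x y * int k) m x" for m k x
    proof -
      have "(\<Sum>z\<in>S. kap x z * int ((m(y := k)) z)) = (\<Sum>z\<in>S. kap x z * int (m z))"
        by (rule sum.cong) (use y in auto)
      then show ?thesis
        using y insert.hyps by (simp add: vac_def)
    qed
    have vac_y: "vac (insert y S) P m y = P y" for m
      unfolding vac_def using kap0 by simp
    have bw: "bin_weight (insert y S) P (m(y := k)) =
        binc (P y) k * bin_weight S (\<lambda>x. P x + kap x y * int k) m" for m k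
    proof -
      have "(\<Prod>x\<in>S. binc (vac (insert y S) P (m(y := k)) x) ((m(y := k)) x)) =
          bin_weight S (\<lambda>x. P x + kap x y * int k) m"
        unfolding bin_weight_def vac_upd by (rule prod.cong) (use y in auto)
      then show ?thesis
        unfolding bin_weight_def using y insert.hyps vac_y by simp
    qed
    have cw: "const_weight (vac (insert y S) P (m(y := k))) =
        const_weight (vac S (\<lambda>x. P x + kap x y * int k) m)" for m k
      by (simp add: const_weight_def vac_upd)
    have nth: "fls_nth (gen_fun S P * Y y ^ k) (int N) =
        fls_nth (gen_fun S (\<lambda>x. P x + kap x y * int k)) (int (N - k * snd y))"
      if "k * snd y \<le> N" for k
    proof -
      have "gen_fun S P * Y y ^ k = fls_X ^ (k * snd y) * gen_fun S (\<lambda>x. P x + kap x y * int k)"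
        unfolding Yy power_mult_distrib gen_fun_shift[OF insert.hyps(1) S(1)]
        unfolding mult.commute[of k] power_mult by (simp only: mult_ac)
      moreover have "int (N - k * snd y) = int N - int (k * snd y)"
        using that by (simp add: of_nat_diff)
      ultimately show ?thesis
        by (simp add: fls_X_power_times_conv_shift)
    qed
    have "gen_fun (insert y S) P = gen_fun S P * (1 - Y y) powi (- P y - 1)"
      using y insert.hyps by (simp add: gen_fun_def mult_ac)
    then have "fls_nth (gen_fun (insert y S) P) (int N) =
        (\<Sum>k | k * snd y \<le> N. of_rat (binc (P y) k) * fls_nth (gen_fun S P * Y y ^ k) (int N))"
      using binomial_series_nth[OF ord_gen_fun[OF insert.hyps(1) S(1)] ord_Y[OF S(2)]] S(2)
      by (auto simp: sites_def)
    also have "\<dots> = (\<Sum>k | k * snd y \<le> N. \<Sum>m\<in>configs S (N - k * snd y).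
        const_weight (vac (insert y S) P (m(y := k))) * of_rat (bin_weight (insert y S) P (m(y := k))))"
    proof (rule sum.cong)
      fix k assume "k \<in> {k. k * snd y \<le> N}"
      then have k: "k * snd y \<le> N" by simp
      show "of_rat (binc (P y) k) * fls_nth (gen_fun S P * Y y ^ k) (int N) =
          (\<Sum>m\<in>configs S (N - k * snd y). const_weight (vac (insert y S) P (m(y := k))) *
            of_rat (bin_weight (insert y S) P (m(y := k))))"
        unfolding nth[OF k] insert.IH[OF dS] sum_distrib_left bw cw of_rat_mult
        by (rule sum.cong) (simp_all only: mult_ac)
    qed simp
    also have "\<dots> = (\<Sum>m\<in>configs (insert y S) N. const_weight (vac (insert y S) P m) *
        of_rat (bin_weight (insert y S) P m))"
      by (rule sum_configs_insert[symmetric]) (use insert.hyps S y in auto)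
    finally show ?thesis .
  qed
qed

end

section \<open>The Q-system\<close>

text \<open>Hermite's identity is the case \<open>j = 0\<close>.\<close>

lemma sum_div_diff:
  fixes X k j :: nat
  assumes "0 < k"
  shows "(\<Sum>e<k. (X + k - 1 - e) div k - j) = X - k * j"
proof -
  have "(\<Sum>e<k. (X + k - 1 - e) div k - j) = (\<Sum>e<k. (X + e) div k - j)"
    by (rule sum.reindex_bij_witness[of _ "\<lambda>e. k - 1 - e" "\<lambda>e. k - 1 - e"]) auto
  also have "\<dots> = X - k * j"
  proof (induction X)
    case 0
    show ?case by simp
  next
    case (Suc X)
    let ?g = "\<lambda>y. y div k - j"
    have "(\<Sum>e<k. ?g (Suc X + e)) + ?g X = (\<Sum>e<Suc k. ?g (X + e))"
      by (simp add: sum.lessThan_Suc_shift del: sum.lessThan_Suc)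
    also have "\<dots> = (X - k * j) + ?g (X + k)"
      using Suc by simp
    also have "?g (X + k) = Suc (X div k) - j"
      using assms by simp
    finally have eq: "(\<Sum>e<k. ?g (Suc X + e)) + (X div k - j) = (X - k * j) + (Suc (X div k) - j)" .
    have "j \<le> X div k \<longleftrightarrow> k * j \<le> X"
      using assms by (metis less_eq_div_iff_mult_less_eq mult.commute)
    then show ?case using eq by (cases "k * j \<le> X") auto
  qed
  finally show ?thesis .
qed

context y_system
begin

definition xi :: "nat \<Rightarrow> 'k fls" where
  "xi a = fls_const (inverse (\<upsilon> a))"

text \<open>\<open>Q\<close> without its power of \<open>xi a\<close>, a series with constant term
  1. The exponents are chosen so that \<open>1 - Y (a, n)\<close> is the ratio
  \<open>Q a (n + 1) * Q a (n - 1) / Q a n ^ 2\<close>.\<close>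

definition G :: "nat \<Rightarrow> nat \<Rightarrow> 'k fls" where
  "G a n = (\<Prod>j\<in>{1..<n}. (1 - Y (a, j)) ^ (n - j))"

definition Q :: "nat \<Rightarrow> nat \<Rightarrow> 'k fls" where
  "Q a n = xi a ^ n * G a n"

lemma G_extend: "n \<le> M \<Longrightarrow> G a n = (\<Prod>j\<in>{1..<M}. (1 - Y (a, j)) ^ (n - j))"
  unfolding G_def by (rule prod.mono_neutral_left) auto

lemma xi_nonzero: "a \<in> {1..r} \<Longrightarrow> xi a \<noteq> 0"
  using \<upsilon>_nonzero by (simp add: xi_def)

lemma xi_eq: "xi a = inverse (fls_const (\<upsilon> a))"
  by (simp add: xi_def fls_inverse_const)

lemma site_iff: "(a, j) \<in> sites \<longleftrightarrow> a \<in> {1..r} \<and> 1 \<le> j"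
  by (auto simp: sites_def)

lemma one_unit_G: "a \<in> {1..r} \<Longrightarrow> one_unit (G a n)"
  unfolding G_def by (intro one_unit_prod one_unit_power one_unit_Y) (auto simp: site_iff)

lemma Q_nonzero: "a \<in> {1..r} \<Longrightarrow> Q a n \<noteq> 0"
  unfolding Q_def using one_unit_nonzero[OF one_unit_G] xi_nonzero by simp

lemma Q_0 [simp]: "Q a 0 = 1" and Q_1 [simp]: "Q a (Suc 0) = xi a"
  by (simp_all add: Q_def G_def)

lemma G_step: "G a (Suc (Suc n)) * G a n = G a (Suc n) ^ 2 * (1 - Y (a, Suc n))"
proof -
  let ?y = "\<lambda>j. 1 - Y (a, j)"
  have "G a (Suc (Suc n)) * G a n = (\<Prod>j\<in>{1..<Suc (Suc n)}. ?y j ^ (Suc (Suc n) - j) * ?y j ^ (n - j))"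
    by (simp only: G_extend[of "Suc (Suc n)" "Suc (Suc n)"] G_extend[of n "Suc (Suc n)"]
        prod.distrib le_SucI order_refl)
  also have "\<dots> = (\<Prod>j\<in>{1..<Suc (Suc n)}. (?y j ^ (Suc n - j)) ^ 2 * (if j = Suc n then ?y j else 1))"
  proof (rule prod.cong)
    fix j assume j: "j \<in> {1..<Suc (Suc n)}"
    show "?y j ^ (Suc (Suc n) - j) * ?y j ^ (n - j) =
        (?y j ^ (Suc n - j)) ^ 2 * (if j = Suc n then ?y j else 1)"
    proof (cases "j = Suc n")
      case False
      then have "Suc (Suc n) - j + (n - j) = (Suc n - j) * 2" using j by auto
      then show ?thesis
        using False by (simp flip: power_add power_mult)
    qed simp
  qed simp
  also have "\<dots> = G a (Suc n) ^ 2 * (\<Prod>j\<in>{1..<Suc (Suc n)}. if j = Suc n then ?y j else 1)"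
    by (simp only: prod.distrib G_extend[of "Suc n" "Suc (Suc n)"] prod_power_distrib le_SucI order_refl)
  also have "(\<Prod>j\<in>{1..<Suc (Suc n)}. if j = Suc n then ?y j else 1) = 1 - Y (a, Suc n)"
    by (subst prod.delta) auto
  finally show ?thesis .
qed

lemma Q_step: "Q a (Suc (Suc n)) * Q a n = Q a (Suc n) ^ 2 * (1 - Y (a, Suc n))"
proof -
  have "Q a (Suc (Suc n)) * Q a n = xi a ^ Suc (Suc n) * xi a ^ n * (G a (Suc (Suc n)) * G a n)"
    by (simp add: Q_def mult_ac)
  also have "xi a ^ Suc (Suc n) * xi a ^ n = (xi a ^ Suc n) ^ 2"
    by (simp add: power2_eq_square mult_ac)
  finally show ?thesis
    unfolding G_step Q_def power_mult_distrib by (simp only: mult_ac)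
qed

text \<open>The product defining \<open>Y\<close> is split by colours. Colour \<open>a\<close>
  contributes the inverse of \<open>Q a n ^ 2\<close>; for \<open>b \<noteq> a\<close>, Hermite's
  identity distributes the exponent \<open>c b a * n - c a b * j\<close> of
  \<open>1 - Y (b, j)\<close> over the \<open>c a b\<close> neighbours. Together with
  \<open>Q_step\<close> this is the Q-system.\<close>

lemma Q_system:
  assumes a: "a \<in> {1..r}" and "0 < n"
  shows "Q a n ^ 2 * Y (a, n) =
    fls_X ^ n * (\<Prod>b\<in>{1..r} - {a}. \<Prod>e<c a b. Q b (nbr_len a b n e))"
proof -
  \<comment> \<open>Any bound on \<open>n\<close>, on the indices of earlier sites and on the
    neighbour lengths would do; it gives all products the same range.\<close>
  define M where "M = n * d a + n + (\<Sum>b\<in>{1..r}. c b a * n + c a b) + 1"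
  let ?y = "\<lambda>b j. 1 - Y (b, j)"
  define E where "E b = fls_const (\<upsilon> b) powi kap (b, 0) (a, n) *
      (\<Prod>j\<in>{1..<M}. ?y b j powi (- kap (b, j) (a, n)))" for b
  let ?S = "{1..r} \<times> {1..<M}"
  have "earlier (a, n) \<subseteq> ?S"
  proof
    fix x assume x: "x \<in> earlier (a, n)"
    then have "0 < d (fst x)" using d_pos by (auto simp: earlier_def sites_def)
    then have "snd x \<le> time x" by (simp add: time_def)
    also have "\<dots> < n * d a" using x by (simp add: earlier_def time_def)
    finally have "snd x < M" by (simp add: M_def)
    then show "x \<in> ?S"
      using x by (cases x) (auto simp: earlier_def sites_def)
  qed
  then have "Y (a, n) = fls_X ^ snd (a, n) * (const_part (\<lambda>x. kap x (a, n)) *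
      (\<Prod>x\<in>?S. (1 - Y x) powi (- kap x (a, n))))"
    by (intro Y_eq_prod) (use a \<open>0 < n\<close> in \<open>auto simp: sites_def\<close>)
  also have "(\<Prod>x\<in>?S. (1 - Y x) powi (- kap x (a, n))) =
      (\<Prod>b\<in>{1..r}. \<Prod>j\<in>{1..<M}. ?y b j powi (- kap (b, j) (a, n)))"
    by (simp add: prod.cartesian_product case_prod_unfold)
  also have "const_part (\<lambda>x. kap x (a, n)) * \<dots> = (\<Prod>b\<in>{1..r}. E b)"
    unfolding const_part_def E_def prod.distrib ..
  also have "\<dots> = E a * (\<Prod>b\<in>{1..r} - {a}. E b)"
    using a by (simp add: prod.remove)
  finally have Y: "Y (a, n) = fls_X ^ n * (E a * (\<Prod>b\<in>{1..r} - {a}. E b))"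
    by simp
  have Ea: "Q a n ^ 2 * E a = 1"
  proof -
    have 1: "xi a ^ (2 * n) * fls_const (\<upsilon> a) powi kap (a, 0) (a, n) = 1"
    proof -
      have "kap (a, 0) (a, n) = int (2 * n)" by (simp add: kap_def)
      then have "fls_const (\<upsilon> a) powi kap (a, 0) (a, n) = fls_const (\<upsilon> a) ^ (2 * n)"
        by (simp only: power_int_of_nat)
      moreover have "xi a * fls_const (\<upsilon> a) = 1"
        using \<upsilon>_nonzero[OF a] by (simp add: xi_def)
      ultimately show ?thesis by (simp flip: power_mult_distrib)
    qed
    have 2: "G a n ^ 2 * (\<Prod>j\<in>{1..<M}. ?y a j powi (- kap (a, j) (a, n))) = 1"
    proof -
      have "n \<le> M" by (simp add: M_def)
      then have "G a n ^ 2 * (\<Prod>j\<in>{1..<M}. ?y a j powi (- kap (a, j) (a, n))) =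
          (\<Prod>j\<in>{1..<M}. (?y a j ^ (n - j)) ^ 2 * ?y a j powi (- kap (a, j) (a, n)))"
        by (simp add: G_extend[of n M] prod_power_distrib prod.distrib)
      also have "\<dots> = 1"
      proof (rule prod.neutral, rule ballI)
        fix j assume "j \<in> {1..<M}"
        then have nz: "?y a j \<noteq> 0" using Y_nonone a by (simp add: site_iff)
        have "- kap (a, j) (a, n) = - int ((n - j) * 2)" by (simp add: kap_def)
        then have "?y a j powi (- kap (a, j) (a, n)) = inverse ((?y a j ^ (n - j)) ^ 2)"
          by (simp only: power_int_minus power_int_of_nat power_mult)
        then show "(?y a j ^ (n - j)) ^ 2 * ?y a j powi (- kap (a, j) (a, n)) = 1"
          using nz by simp
      qed
      finally show ?thesis .
    qed
    have "Q a n ^ 2 * E a = (xi a ^ (2 * n) * fls_const (\<upsilon> a) powi kap (a, 0) (a, n)) *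
        (G a n ^ 2 * (\<Prod>j\<in>{1..<M}. ?y a j powi (- kap (a, j) (a, n))))"
      unfolding Q_def E_def power_mult_distrib mult.commute[of 2] power_mult by (simp only: mult_ac)
    then show ?thesis unfolding 1 2 by simp
  qed
  have Eb: "E b = (\<Prod>e<c a b. Q b (nbr_len a b n e))" if b: "b \<in> {1..r} - {a}" for b
  proof (cases "c a b = 0")
    case True
    have "c b a = 0"
      using symm[of a b] d_pos[of b] a b True by auto
    then show ?thesis
      using b True by (simp add: E_def kap_def)
  next
    case False
    let ?l = "nbr_len a b n"
    have suml: "(\<Sum>e<c a b. ?l e - j) = c b a * n - c a b * j" for j
      unfolding nbr_len_def by (rule sum_div_diff) (use False in simp)
    have lM: "?l e \<le> M" for e
    proof -
      have "?l e \<le> c b a * n + c a b - 1 - e"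
        unfolding nbr_len_def by (rule div_le_dividend)
      also have "\<dots> \<le> c b a * n + c a b" by simp
      also have "\<dots> \<le> (\<Sum>b\<in>{1..r}. c b a * n + c a b)"
        using b by (intro member_le_sum[of b]) auto
      finally show ?thesis by (simp add: M_def)
    qed
    have "(\<Prod>e<c a b. Q b (?l e)) =
        (\<Prod>e<c a b. xi b ^ ?l e) * (\<Prod>e<c a b. \<Prod>j\<in>{1..<M}. ?y b j ^ (?l e - j))"
      by (simp add: Q_def G_extend[OF lM] prod.distrib)
    also have "(\<Prod>e<c a b. xi b ^ ?l e) = xi b ^ (c b a * n)"
      using suml[of 0] by (simp flip: power_sum)
    also have "(\<Prod>e<c a b. \<Prod>j\<in>{1..<M}. ?y b j ^ (?l e - j)) =
        (\<Prod>j\<in>{1..<M}. ?y b j ^ (c b a * n - c a b * j))"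
      by (subst prod.swap) (simp add: suml flip: power_sum)
    finally have R: "(\<Prod>e<c a b. Q b (?l e)) =
        xi b ^ (c b a * n) * (\<Prod>j\<in>{1..<M}. ?y b j ^ (c b a * n - c a b * j))" .
    have kap: "kap (b, j) (a, n) = - int (c b a * n - c a b * j)" for j
    proof -
      have "int (x - y) = max 0 (int x - int y)" for x y :: nat by linarith
      then show ?thesis using b by (simp add: kap_def)
    qed
    have "fls_const (\<upsilon> b) powi kap (b, 0) (a, n) = xi b ^ (c b a * n)"
      unfolding kap power_int_minus power_int_of_nat xi_eq power_inverse by simp
    moreover have "?y b j powi (- kap (b, j) (a, n)) = ?y b j ^ (c b a * n - c a b * j)" for j
      unfolding kap by (simp only: minus_minus power_int_of_nat)
    ultimately show ?thesis
      unfolding R E_def by simp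
  qed
  have "Q a n ^ 2 * Y (a, n) = fls_X ^ n * ((Q a n ^ 2 * E a) * (\<Prod>b\<in>{1..r} - {a}. E b))"
    unfolding Y by (simp only: mult_ac)
  also have "(\<Prod>b\<in>{1..r} - {a}. E b) = (\<Prod>b\<in>{1..r} - {a}. \<Prod>e<c a b. Q b (nbr_len a b n e))"
    by (rule prod.cong) (use Eb in auto)
  finally show ?thesis by (simp add: Ea)
qed

text \<open>The specialization forgets \<open>s\<close> and turns the T-relation into the Q-system.
  Both recursions determine the next term after cancelling the nonzero \<open>Q a m\<close>.\<close>

lemma Q_eq_eval:
  assumes "a \<in> {1..r}"
  shows "mpol_eval (\<lambda>v. if fst v = 0 then fls_X else xi (fst v)) (T a n s) = Q a n"
  using assms
proof (induction "(n - 1) * d a" arbitrary: a n s rule: less_induct)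
  case less
  let ?ev = "mpol_eval (\<lambda>v. if fst v = 0 then fls_X else xi (fst v))"
  note a = less.prems
  have da: "0 < d a" using a d_pos by blast
  consider "n = 0" | "n = Suc 0" | m where "n = Suc (Suc m)"
    by (metis not0_implies_Suc)
  then show ?case
  proof cases
    case (3 m)
    have IH: "?ev (T a' m' s') = Q a' m'" if "a' \<in> {1..r}" "(m' - 1) * d a' < Suc m * d a" for a' m' s'
      using less.hyps[of m' a'] that 3 by simp
    have IHa: "?ev (T a i s') = Q a i" if "i \<le> Suc m" for i s'
    proof (rule IH[OF a])
      have "i - 1 < Suc m" using that by simp
      then show "(i - 1) * d a < Suc m * d a" using da by (rule mult_strict_right_mono)
    qed
    let ?s = "s + 2 * int (d a)"
    have rem: "?ev (T_rem a (Suc m) s) = (\<Prod>b\<in>{1..r} - {a}. \<Prod>e<c a b. Q b (nbr_len a b (Suc m) e))"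
      unfolding T_rem_def nbr_prod_def mpol_eval_prod
    proof (intro prod.cong refl)
      fix b e assume b: "b \<in> {1..r} - {a}" and e: "e \<in> {..<c a b}"
      show "?ev (T b (nbr_len a b (Suc m) e) (s + int (min (d a) (d b)) + 2 * int (d a) * int e)) =
          Q b (nbr_len a b (Suc m) e)"
        by (rule IH) (use nbr_len_measure[of a b e "Suc m"] a b e in auto)
    qed
    have "?ev (T a (Suc m) s * T a (Suc m) ?s) = ?ev (T a n s * T a m ?s + zeta ^ Suc m * T_rem a (Suc m) s)"
      using T_relation_all[OF a, of "Suc m"] 3 unfolding T_relation_def by simp
    then have "Q a (Suc m) ^ 2 = ?ev (T a n s) * Q a m + Q a (Suc m) ^ 2 * Y (a, Suc m)"
      unfolding mpol_eval_add mpol_eval_mult mpol_eval_power rem Q_system[OF a zero_less_Suc]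
      by (simp add: IHa zeta_def power2_eq_square)
    then have "?ev (T a n s) * Q a m = Q a (Suc m) ^ 2 * (1 - Y (a, Suc m))"
      by (simp add: algebra_simps)
    also have "\<dots> = Q a n * Q a m"
      using Q_step[of a m] 3 by simp
    finally show ?thesis
      using Q_nonzero[OF a] by simp
  qed (use a in simp_all)
qed

lemma Q_in_subring:
  assumes "a \<in> {1..r}" and "fls_X \<in> A" "\<And>b. xi b \<in> A" and "1 \<in> A"
    and "\<And>x y. x \<in> A \<Longrightarrow> y \<in> A \<Longrightarrow> x - y \<in> A"
    and "\<And>x y. x \<in> A \<Longrightarrow> y \<in> A \<Longrightarrow> x * y \<in> A"
  shows "Q a n \<in> A"
  unfolding Q_eq_eval[OF assms(1), of n 0, symmetric]
  by (rule mpol_eval_in_subring) (use assms in auto)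

text \<open>Abel summation: replacing each \<open>1 - Y (a, j)\<close> by its ratio of
  \<open>Q\<close>'s produces second differences of \<open>p\<close> inside and two boundary
  factors. The shift by -1 in the exponents leaves a single factor \<open>xi a = Q a 1\<close>, and
  this factor forces the vanishing of constant terms later on.\<close>

lemma column_product:
  assumes a: "a \<in> {1..r}"
  shows "fls_const (\<upsilon> a) powi p 0 * (\<Prod>j\<in>{1..s}. (1 - Y (a, j)) powi (- p j - 1)) =
    xi a * (\<Prod>j\<in>{1..s}. Q a j powi (2 * p j - p (j + 1) - p (j - 1))) *
      Q a s powi (p (s + 1) + 1) * Q a (s + 1) powi (- p s - 1)"
proof (induction s)
  case 0
  have "fls_const (\<upsilon> a) powi p 0 = xi a powi (- p 0)"
    by (simp add: xi_eq power_int_minus power_int_inverse)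
  also have "\<dots> = xi a * xi a powi (- p 0 - 1)"
    using power_int_add_1'[of "xi a" "- p 0 - 1"] xi_nonzero[OF a] by simp
  finally show ?case by simp
next
  case (Suc s)
  let ?q = "\<lambda>j. Q a j"
  have nz: "?q j \<noteq> 0" for j using Q_nonzero[OF a] .
  define P where "P = p (s + 1) + 1"
  have y: "1 - Y (a, Suc s) = ?q (Suc (Suc s)) * ?q s * ?q (Suc s) powi (- 2)"
    using Q_step[of a s] nz[of "Suc s"] by (simp add: power_int_minus field_simps)
  have "(1 - Y (a, Suc s)) powi (- p (Suc s) - 1) =
      ?q (Suc (Suc s)) powi (- P) * ?q s powi (- P) * ?q (Suc s) powi (2 * P)"
  proof -
    have "- p (Suc s) - 1 = - P" "- 2 * - P = 2 * P" by (simp_all add: P_def)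
    then show ?thesis
      unfolding y power_int_mult_distrib power_int_mult[symmetric] by simp
  qed
  then have "fls_const (\<upsilon> a) powi p 0 * (\<Prod>j\<in>{1..Suc s}. (1 - Y (a, j)) powi (- p j - 1)) =
      xi a * (\<Prod>j\<in>{1..s}. ?q j powi (2 * p j - p (j + 1) - p (j - 1))) *
      (?q s powi P * ?q s powi (- P)) * (?q (s + 1) powi (- p s - 1) * ?q (Suc s) powi (2 * P)) *
      ?q (Suc (Suc s)) powi (- P)"
    using Suc by (simp add: P_def mult_ac)
  also have "?q s powi P * ?q s powi (- P) = 1"
    using nz[of s] by (simp add: power_int_minus)
  also have "?q (s + 1) powi (- p s - 1) * ?q (Suc s) powi (2 * P) =
      ?q (Suc s) powi (2 * p (Suc s) - p (Suc s + 1) - p (Suc s - 1)) * ?q (Suc s) powi (p (Suc s + 1) + 1)"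
  proof -
    have "(- p s - 1) + 2 * P = (2 * p (Suc s) - p (Suc s + 1) - p (Suc s - 1)) + (p (Suc s + 1) + 1)"
      by (simp add: P_def)
    then show ?thesis
      unfolding Suc_eq_plus1[symmetric] power_int_add[OF disjI1[OF nz], symmetric] by (simp only:)
  qed
  finally show ?case by (simp add: P_def mult_ac)
qed

end

section \<open>Vanishing of constant terms\<close>

definition nonpos :: "'b::comm_ring_1 fls \<Rightarrow> bool" where
  "nonpos f \<longleftrightarrow> (\<forall>n>0. fls_nth f n = 0)"

lemma nonpos_mult: "nonpos f \<Longrightarrow> nonpos g \<Longrightarrow> nonpos (f * g)"
  unfolding nonpos_def
proof (intro allI impI)
  fix n :: int
  assume f: "\<forall>n>0. fls_nth f n = 0" and g: "\<forall>n>0. fls_nth g n = 0" and n: "0 < n"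
  have "fls_nth f i * fls_nth g (n - i) = 0" for i
    using f g n by (cases "0 < i") auto
  then show "fls_nth (f * g) n = 0"
    unfolding fls_times_nth(2) by (intro sum.neutral ballI)
qed

lemma nonpos_diff: "nonpos f \<Longrightarrow> nonpos g \<Longrightarrow> nonpos (f - g)"
  by (simp add: nonpos_def)

lemma nonpos_const [simp]: "nonpos (fls_const x)"
  by (simp add: nonpos_def)

lemma nonpos_0 [simp]: "nonpos 0" and nonpos_1 [simp]: "nonpos 1"
  by (simp_all add: nonpos_def)

lemma nonpos_sum: "(\<And>x. x \<in> A \<Longrightarrow> nonpos (f x)) \<Longrightarrow> nonpos (sum f A)"
  by (simp add: nonpos_def fls_nth_sum')

text \<open>The outer variable is the grading \<open>fls_X\<close>, the inner one belongs to a
  distinguished colour. As Laurent series are bounded below, each coefficient is a polynomial in the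
  inverse of the inner variable.\<close>

definition coeffs_nonpos :: "'b::field fls fls set" where
  "coeffs_nonpos = {F. \<forall>N. nonpos (fls_nth F N)}"

lemma coeffs_nonpos_mult: "F \<in> coeffs_nonpos \<Longrightarrow> G \<in> coeffs_nonpos \<Longrightarrow> F * G \<in> coeffs_nonpos"
  unfolding coeffs_nonpos_def mem_Collect_eq fls_times_nth(2)
  by (intro allI nonpos_sum nonpos_mult) auto

lemma coeffs_nonpos_diff: "F \<in> coeffs_nonpos \<Longrightarrow> G \<in> coeffs_nonpos \<Longrightarrow> F - G \<in> coeffs_nonpos"
  by (simp add: coeffs_nonpos_def nonpos_diff)

lemma coeffs_nonpos_const: "nonpos f \<Longrightarrow> fls_const f \<in> coeffs_nonpos"
  by (simp add: coeffs_nonpos_def)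

lemma coeffs_nonpos_1 [simp]: "1 \<in> coeffs_nonpos"
  by (simp add: coeffs_nonpos_def)

lemma coeffs_nonpos_X [simp]: "fls_X \<in> coeffs_nonpos"
  by (simp add: coeffs_nonpos_def)

lemma coeffs_nonpos_power: "F \<in> coeffs_nonpos \<Longrightarrow> F ^ n \<in> coeffs_nonpos"
  by (induction n) (simp_all add: coeffs_nonpos_mult)

lemma coeffs_nonpos_prod: "(\<And>x. x \<in> A \<Longrightarrow> f x \<in> coeffs_nonpos) \<Longrightarrow> prod f A \<in> coeffs_nonpos"
  by (induction A rule: infinite_finite_induct) (simp_all add: coeffs_nonpos_mult)

text \<open>With constant term 1 the recursion for the coefficients of the inverse is free of
  divisions, so only sums and products of series without positive powers arise.\<close>

lemma coeffs_nonpos_inverse: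
  fixes F :: "'b::field fls fls"
  assumes F: "F \<in> coeffs_nonpos" and u: "one_unit F"
  shows "inverse F \<in> coeffs_nonpos"
proof -
  let ?G = "inverse F"
  have uG: "one_unit ?G" by (rule one_unit_inverse[OF u])
  note F0 = one_unit_subdegree[OF u] and G0 = one_unit_subdegree[OF uG]
  have nat: "nonpos (fls_nth ?G (int N))" for N
  proof (induction N rule: less_induct)
    case (less N)
    show ?case
    proof (cases "N = 0")
      case True
      then show ?thesis by (simp only: of_nat_0 G0(2) nonpos_1)
    next
      case False
      have "F * ?G = 1" using one_unit_nonzero[OF u] by simp
      then have "0 = fls_nth (F * ?G) (int N)" using False by simp
      also have "\<dots> = (\<Sum>i=0..int N. fls_nth F i * fls_nth ?G (int N - i))"
        unfolding fls_times_nth(2) F0(1) G0(1) by simp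
      also have "\<dots> = fls_nth ?G (int N) + (\<Sum>i\<in>{0<..int N}. fls_nth F i * fls_nth ?G (int N - i))"
      proof -
        have "{0..int N} = insert 0 {0<..int N}" by auto
        then show ?thesis by (simp add: F0(2))
      qed
      finally have "fls_nth ?G (int N) + (\<Sum>i\<in>{0<..int N}. fls_nth F i * fls_nth ?G (int N - i)) = 0"
        by (rule sym)
      then have eq: "fls_nth ?G (int N) = 0 - (\<Sum>i\<in>{0<..int N}. fls_nth F i * fls_nth ?G (int N - i))"
        by (simp only: eq_diff_eq)
      have "nonpos (fls_nth F i * fls_nth ?G (int N - i))" if "i \<in> {0<..int N}" for i
      proof (rule nonpos_mult)
        show "nonpos (fls_nth F i)" using F by (simp add: coeffs_nonpos_def)
        have "int N - i = int (nat (int N - i))" "nat (int N - i) < N"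
          using that by auto
        then show "nonpos (fls_nth ?G (int N - i))" using less by metis
      qed
      then show ?thesis
        unfolding eq by (intro nonpos_diff nonpos_0 nonpos_sum)
    qed
  qed
  have "nonpos (fls_nth ?G N)" for N
  proof (cases "N < 0")
    case True
    then show ?thesis using G0(3) by (simp add: ord_ge_def)
  next
    case False
    then show ?thesis using nat[of "nat N"] by simp
  qed
  then show ?thesis by (simp add: coeffs_nonpos_def)
qed

lemma coeffs_nonpos_power_int_nonneg:
  "F \<in> coeffs_nonpos \<Longrightarrow> 0 \<le> n \<Longrightarrow> F powi n \<in> coeffs_nonpos"
  by (simp add: power_int_def coeffs_nonpos_power)

lemma coeffs_nonpos_power_int:
  "F \<in> coeffs_nonpos \<Longrightarrow> one_unit F \<Longrightarrow> F powi n \<in> coeffs_nonpos"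
  by (simp add: power_int_def coeffs_nonpos_power coeffs_nonpos_inverse)

section \<open>Constant terms in the variable of one distinguished colour\<close>

locale graded_y_system = y_system r c d \<upsilon>
  for r :: nat and c :: "nat \<Rightarrow> nat \<Rightarrow> nat" and d :: "nat \<Rightarrow> nat"
    and \<upsilon> :: "nat \<Rightarrow> 'b::field_char_0 fls" +
  fixes a0 :: nat and w :: "nat \<Rightarrow> 'b"
  assumes a0: "a0 \<in> {1..r}" and \<upsilon>_a0: "\<upsilon> a0 = fls_X"
    and \<upsilon>_const: "a \<noteq> a0 \<Longrightarrow> \<upsilon> a = fls_const (w a)"
begin

lemma xi_nonpos: "xi a \<in> coeffs_nonpos"
proof (cases "a = a0")
  case True
  have "nonpos (fls_X_inv :: 'b fls)" by (simp add: nonpos_def)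
  then show ?thesis
    by (simp add: xi_def True \<upsilon>_a0 coeffs_nonpos_const fls_inverse_X)
next
  case False
  then show ?thesis
    by (simp add: xi_def \<upsilon>_const coeffs_nonpos_const fls_inverse_const)
qed

lemma Q_nonpos: "a \<in> {1..r} \<Longrightarrow> Q a n \<in> coeffs_nonpos"
  by (rule Q_in_subring) (auto simp: xi_nonpos coeffs_nonpos_diff coeffs_nonpos_mult)

lemma column_nonpos:
  assumes a: "a \<in> {1..r}" "a \<noteq> a0"
  shows "fls_const (\<upsilon> a) powi k * (\<Prod>j\<in>{1..s}. (1 - Y (a, j)) powi p j) \<in> coeffs_nonpos"
proof -
  have inv: "inverse (xi a) \<in> coeffs_nonpos"
    using a by (simp add: xi_eq \<upsilon>_const coeffs_nonpos_const)
  have G: "G a n \<in> coeffs_nonpos" for n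
  proof -
    have "G a n = inverse (xi a) ^ n * Q a n"
      using xi_nonzero[OF a(1)] by (simp add: Q_def power_inverse)
    then show ?thesis
      using inv Q_nonpos[OF a(1)] by (simp add: coeffs_nonpos_mult coeffs_nonpos_power)
  qed
  have "1 - Y (a, j) \<in> coeffs_nonpos" if j: "j \<in> {1..s}" for j
  proof -
    obtain n where n: "j = Suc n" using j by (cases j) auto
    have nz: "G a (Suc n) \<noteq> 0" using one_unit_nonzero one_unit_G[OF a(1)] by blast
    have "1 - Y (a, j) = G a (Suc (Suc n)) * G a n * inverse (G a (Suc n)) ^ 2"
      using nz by (simp add: G_step n power_inverse)
    then show ?thesis
      using G coeffs_nonpos_inverse[OF G one_unit_G[OF a(1)]]
      by (simp add: coeffs_nonpos_mult coeffs_nonpos_power)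
  qed
  then have "(\<Prod>j\<in>{1..s}. (1 - Y (a, j)) powi p j) \<in> coeffs_nonpos"
    using a by (intro coeffs_nonpos_prod coeffs_nonpos_power_int one_unit_Y) (auto simp: site_iff)
  moreover have "fls_const (\<upsilon> a) powi k \<in> coeffs_nonpos"
    using a by (simp add: \<upsilon>_const coeffs_nonpos_const flip: fls_const_power_int)
  ultimately show ?thesis
    by (rule coeffs_nonpos_mult[rotated])
qed

text \<open>The conditions on \<open>P\<close> make all exponents in \<open>column_product\<close>
  for \<open>a0\<close> nonnegative. The leftover factor \<open>xi a0\<close> is the inverse of the
  inner variable and pushes every exponent below zero.\<close>

lemma gen_fun_vanish:
  assumes S: "S = {x \<in> sites. snd x \<le> s (fst x)}"
    and neg: "P (a0, s a0) < 0" and nonneg: "0 \<le> P (a0, s a0 + 1)"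
    and conv: "\<And>j. j \<in> {1..s a0} \<Longrightarrow> P (a0, j + 1) + P (a0, j - 1) \<le> 2 * P (a0, j)"
    and "0 \<le> n"
  shows "fls_nth (fls_nth (gen_fun S P) N) n = 0"
proof -
  let ?\<phi> = "\<lambda>a. fls_const (\<upsilon> a) powi P (a, 0) *
    (\<Prod>j\<in>{1..s a}. (1 - Y (a, j)) powi (- P (a, j) - 1))"
  have "S = (SIGMA a:{1..r}. {1..s a})"
    unfolding S sites_def by auto
  then have "(\<Prod>x\<in>S. (1 - Y x) powi (- P x - 1)) =
      (\<Prod>a\<in>{1..r}. \<Prod>j\<in>{1..s a}. (1 - Y (a, j)) powi (- P (a, j) - 1))"
    by (simp only:) (subst prod.Sigma, auto simp: case_prod_unfold)
  then have "gen_fun S P = (\<Prod>a\<in>{1..r}. ?\<phi> a)"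
    by (simp only: gen_fun_def const_part_def prod.distrib)
  also have "\<dots> = ?\<phi> a0 * (\<Prod>a\<in>{1..r} - {a0}. ?\<phi> a)"
    using a0 by (simp add: prod.remove)
  also have "?\<phi> a0 = xi a0 * (\<Prod>j\<in>{1..s a0}. Q a0 j powi (2 * P (a0, j) - P (a0, j + 1) - P (a0, j - 1))) *
      Q a0 (s a0) powi (P (a0, s a0 + 1) + 1) * Q a0 (s a0 + 1) powi (- P (a0, s a0) - 1)"
    using column_product[OF a0, of "\<lambda>j. P (a0, j)"] by simp
  finally have "gen_fun S P = xi a0 * ((\<Prod>j\<in>{1..s a0}. Q a0 j powi (2 * P (a0, j) - P (a0, j + 1) - P (a0, j - 1))) *
      Q a0 (s a0) powi (P (a0, s a0 + 1) + 1) * Q a0 (s a0 + 1) powi (- P (a0, s a0) - 1) *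
      (\<Prod>a\<in>{1..r} - {a0}. ?\<phi> a))" (is "_ = _ * ?R")
    by (simp only: mult_ac)
  moreover have "?R \<in> coeffs_nonpos"
    by (intro coeffs_nonpos_mult coeffs_nonpos_prod coeffs_nonpos_power_int_nonneg Q_nonpos a0
        column_nonpos) (use conv neg nonneg in \<open>auto simp: algebra_simps\<close>)
  ultimately have "fls_nth (gen_fun S P) N = fls_X_inv * fls_nth ?R N" "nonpos (fls_nth ?R N)"
    by (simp_all add: xi_def \<upsilon>_a0 fls_inverse_X coeffs_nonpos_def)
  then show ?thesis
    using \<open>0 \<le> n\<close> by (simp add: nonpos_def fls_X_inv_times_conv_shift)
qed

lemma const_weight_nth_0:
  "fls_nth (const_weight P) 0 =
    (if P (a0, 0) = 0 then \<Prod>a\<in>{1..r} - {a0}. w a powi P (a, 0) else 0)"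
proof -
  have "const_weight P = fls_X powi P (a0, 0) * (\<Prod>a\<in>{1..r} - {a0}. fls_const (w a powi P (a, 0)))"
    unfolding const_weight_def using a0
    by (simp add: prod.remove \<upsilon>_a0 \<upsilon>_const fls_const_power_int)
  also have "(\<Prod>a\<in>A. fls_const (f a)) = fls_const (\<Prod>a\<in>A. f a)" for f :: "nat \<Rightarrow> 'b" and A
    by (induction A rule: infinite_finite_induct) simp_all
  finally show ?thesis
    by (simp add: fls_X_power_int fls_X_intpow_times_conv_shift)
qed

end

section \<open>Comparison of the two fermionic sums\<close>

text \<open>Coefficients are chosen one coordinate at a time; a new one only has to avoid the
  finitely many integers that would annihilate some \<open>q\<close> with nonzero entry
  there.\<close>

lemma separating_functional:
  fixes A :: "('i \<Rightarrow> int) set"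
  assumes "finite I" "finite A" "\<And>q. q \<in> A \<Longrightarrow> \<exists>a\<in>I. q a \<noteq> 0"
  shows "\<exists>e. \<forall>q\<in>A. (\<Sum>a\<in>I. e a * q a) \<noteq> (0::int)"
  using assms
proof (induction I arbitrary: A rule: finite_induct)
  case empty
  then show ?case by auto
next
  case (insert i I)
  let ?A0 = "{q \<in> A. \<exists>a\<in>I. q a \<noteq> 0}"
  have "\<exists>e. \<forall>q\<in>?A0. (\<Sum>a\<in>I. e a * q a) \<noteq> 0"
    by (rule insert.IH) (use insert.prems in auto)
  then obtain e where e: "\<And>q. q \<in> ?A0 \<Longrightarrow> (\<Sum>a\<in>I. e a * q a) \<noteq> 0" by blast
  let ?S = "\<lambda>q. \<Sum>a\<in>I. e a * q a"
  have "finite ((\<lambda>q. (- ?S q) div q i) ` A)" using insert.prems by simp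
  then obtain x where x: "x \<notin> (\<lambda>q. (- ?S q) div q i) ` A"
    using ex_new_if_finite[OF infinite_UNIV_int] by blast
  have "(\<Sum>a\<in>insert i I. (e(i := x)) a * q a) \<noteq> 0" if q: "q \<in> A" for q
  proof
    assume "(\<Sum>a\<in>insert i I. (e(i := x)) a * q a) = 0"
    moreover have "(\<Sum>a\<in>I. (e(i := x)) a * q a) = ?S q"
      by (rule sum.cong) (use insert.hyps in auto)
    ultimately have eq: "x * q i + ?S q = 0"
      using insert.hyps by simp
    show False
    proof (cases "q i = 0")
      case True
      then have "q \<in> ?A0" using q insert.prems(2)[OF q] by auto
      then show False using e eq True by simp
    next
      case False
      have "- ?S q = x * q i" using eq by simp
      then have "(- ?S q) div q i = x" using False by simp
      then show False using x q by blast
    qed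
  qed
  then show ?case by blast
qed

lemma prod_power_int:
  fixes z :: "'a::field"
  shows "z \<noteq> 0 \<Longrightarrow> (\<Prod>a\<in>A. z powi f a) = z powi (\<Sum>a\<in>A. f a)"
  by (induction A rule: infinite_finite_induct) (simp_all add: power_int_add)

context cartan_data
begin

text \<open>The spin of \<open>a0\<close> is the exponent of the distinguished variable. The other
  spins enter through one further variable with exponents \<open>e\<close>, so chosen that on the
  finitely many configurations its total exponent vanishes only if all these spins do.\<close>

theorem fiber_sum_zero:
  assumes S: "S = {x \<in> sites. snd x \<le> s (fst x)}" and "down_closed S" and a0: "a0 \<in> {1..r}"
    and "P (a0, s a0) < 0" "0 \<le> P (a0, s a0 + 1)"
    and "\<And>j. j \<in> {1..s a0} \<Longrightarrow> P (a0, j + 1) + P (a0, j - 1) \<le> 2 * P (a0, j)"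
  shows "(\<Sum>m\<in>{m \<in> configs S N. \<forall>a\<in>{1..r}. vac S P m (a, 0) = 0}. bin_weight S P m) = 0"
proof -
  have "S = (SIGMA a:{1..r}. {1..s a})"
    unfolding S sites_def by auto
  then have fS: "finite S" by simp
  have SS: "S \<subseteq> sites" using S by auto
  have fin: "finite (configs S N)" by (rule finite_configs[OF fS SS])
  let ?q = "\<lambda>m a. vac S P m (a, 0)" and ?I = "{1..r} - {a0}"
  have "\<exists>e. \<forall>q\<in>{q \<in> ?q ` configs S N. \<exists>a\<in>?I. q a \<noteq> 0}. (\<Sum>a\<in>?I. e a * q a) \<noteq> (0::int)"
    by (rule separating_functional) (use fin in auto)
  then obtain e :: "nat \<Rightarrow> int" where
    "\<forall>q\<in>{q \<in> ?q ` configs S N. \<exists>a\<in>?I. q a \<noteq> 0}. (\<Sum>a\<in>?I. e a * q a) \<noteq> 0"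
    by (rule exE)
  from bspec[OF this, of "?q _"]
  have e: "(\<Sum>a\<in>?I. e a * ?q m a) \<noteq> 0" if "m \<in> configs S N" "\<exists>a\<in>?I. ?q m a \<noteq> 0" for m
    using that by simp
  define w where "w a = (fls_X powi e a :: rat fls)" for a
  define \<upsilon> where "\<upsilon> a = (if a = a0 then fls_X else fls_const (w a))" for a
  interpret graded_y_system r c d \<upsilon> a0 w
    by unfold_locales (use a0 in \<open>auto simp: \<upsilon>_def w_def power_int_eq_0_iff\<close>)
  have coeff: "fls_nth (fls_nth (const_weight (vac S P m) * of_rat (bin_weight S P m)) 0) 0 =
      (if \<forall>a\<in>{1..r}. ?q m a = 0 then bin_weight S P m else 0)" if m: "m \<in> configs S N" for m
  proof -
    have "(\<Prod>a\<in>?I. w a powi ?q m a) = fls_X powi (\<Sum>a\<in>?I. e a * ?q m a)"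
      unfolding w_def power_int_mult[symmetric] by (rule prod_power_int) simp
    moreover have "fls_nth (fls_X powi (\<Sum>a\<in>?I. e a * ?q m a) :: rat fls) 0 =
        (if \<forall>a\<in>?I. ?q m a = 0 then 1 else 0)"
      using e[OF m] by (auto simp: fls_X_power_int)
    moreover have "(\<forall>a\<in>{1..r}. ?q m a = 0) \<longleftrightarrow> ?q m a0 = 0 \<and> (\<forall>a\<in>?I. ?q m a = 0)"
      using a0 by blast
    moreover have "fls_nth (fls_nth (const_weight (vac S P m) * of_rat (bin_weight S P m)) 0) 0 =
        fls_nth (fls_nth (const_weight (vac S P m)) 0) 0 * bin_weight S P m"
      by (simp flip: fls_const_of_rat)
    ultimately show ?thesis
      by (simp add: const_weight_nth_0)
  qed
  \<comment> \<open>The coefficients are taken in the grading variable, in the variable of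
    \<open>a0\<close> and in the separating variable, in this order.\<close>
  have "0 = fls_nth (fls_nth (fls_nth (gen_fun S P) (int N)) 0) 0"
    using gen_fun_vanish[OF S, of P 0 "int N"] assms by simp
  also have "\<dots> = (\<Sum>m\<in>configs S N. if \<forall>a\<in>{1..r}. ?q m a = 0 then bin_weight S P m else 0)"
    by (simp add: gen_fun_nth[OF fS \<open>down_closed S\<close>] fls_nth_sum' coeff)
  also have "\<dots> = (\<Sum>m\<in>{m \<in> configs S N. \<forall>a\<in>{1..r}. ?q m a = 0}. bin_weight S P m)"
    using fin by (simp add: sum.inter_filter)
  finally show ?thesis ..
qed

text \<open>For different colours \<open>kap\<close> is minus the positive part of an affine
  function, hence concave. For equal colours it is convex, but affine as long as the index stays
  before \<open>y\<close>; the time bound serves this case.\<close>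

lemma kap_concave:
  assumes y: "j * d a < time y" "fst y \<in> {1..r}" and "a \<in> {1..r}" "1 \<le> j"
  shows "kap (a, j + 1) y + kap (a, j - 1) y \<le> 2 * kap (a, j) y"
proof (cases "a = fst y")
  case True
  then have "j < snd y" using y by (simp add: time_def)
  then show ?thesis using True \<open>1 \<le> j\<close> by (simp add: kap_def of_nat_diff)
next
  case False
  let ?u = "int (c a (fst y)) * int (snd y)" and ?v = "int (c (fst y) a)"
  have kap: "kap (a, i) y = - max 0 (?u - ?v * int i)" for i
    using False by (simp add: kap_def)
  have 1: "?v * int (j + 1) = ?v * int j + ?v" and 2: "?v * int (j - 1) = ?v * int j - ?v"
    using \<open>1 \<le> j\<close> by (simp_all add: algebra_simps of_nat_diff)
  have "2 * max 0 (U - W) \<le> max 0 (U - (W + V)) + max 0 (U - (W - V))" for U V W :: int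
    by (simp add: max_def)
  from this[of ?u "?v * int j" ?v] show ?thesis
    unfolding kap 1 2 by simp
qed

section \<open>The two fermionic sums as sums over configurations\<close>

context
  fixes Cm :: "nat \<Rightarrow> nat \<Rightarrow> int" and t :: "nat \<Rightarrow> nat" and k K :: nat
    and l :: "nat \<Rightarrow> nat" and n :: "nat \<Rightarrow> nat \<Rightarrow> nat"
  assumes diag: "\<And>a. a \<in> {1..r} \<Longrightarrow> Cm a a = 2"
    and off: "\<And>a b. a \<in> {1..r} \<Longrightarrow> b \<in> {1..r} \<Longrightarrow> a \<noteq> b \<Longrightarrow> Cm a b = - int (c a b)"
    and tk: "\<And>a. a \<in> {1..r} \<Longrightarrow> d a * (t a * k) = K"
    and inj: "\<And>x :: nat \<Rightarrow> int. (\<And>a. a \<in> {1..r} \<Longrightarrow> (\<Sum>b=1..r. Cm a b * x b) = 0) \<Longrightarrow>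
      (\<And>b. b \<in> {1..r} \<Longrightarrow> x b = 0)"
begin

definition box :: "(nat \<times> nat) set" where
  "box = {x \<in> sites. time x \<le> K}"

text \<open>The part of \<open>q_a + p_{a,i}\<close> that does not involve \<open>m\<close>:
  \<open>min i j - j\<close> equals minus the positive part of \<open>j - i\<close>.\<close>

definition base :: "nat \<times> nat \<Rightarrow> int" where
  "base x = int (l (fst x)) -
     (\<Sum>j=1..t (fst x) * k. max 0 (int j - int (snd x)) * int (n (fst x) j))"

lemma box_eq: "box = (SIGMA a:{1..r}. {1..t a * k})"
proof -
  have "i * d a \<le> K \<longleftrightarrow> i \<le> t a * k" if "a \<in> {1..r}" for a i
    using tk[OF that] d_pos[OF that] by (metis mult.commute mult_le_cancel2)
  then show ?thesis
    by (auto simp: box_def sites_def time_def)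
qed

lemma finite_box [simp]: "finite box" by (simp add: box_eq)

lemma box_sites: "box \<subseteq> sites" by (auto simp: box_def)

lemma kap_Cm:
  assumes "a \<in> {1..r}" "fst y \<in> {1..r}"
  shows "kap (a, i) y = sgn (Cm a (fst y)) *
    max 0 (\<bar>Cm a (fst y)\<bar> * int (snd y) - \<bar>Cm (fst y) a\<bar> * int i)"
proof (cases "a = fst y")
  case True
  then show ?thesis using diag assms by (simp add: kap_def max_def)
next
  case False
  have "c (fst y) a = 0" if "c a (fst y) = 0"
    using symm[OF assms False] d_pos[OF assms(2)] that by simp
  then show ?thesis
    using off[OF assms False] off[of "fst y" a] assms False
    by (cases "c a (fst y) = 0") (auto simp: kap_def)
qed

lemma sum_box: "(\<Sum>y\<in>box. f y) = (\<Sum>b=1..r. \<Sum>j=1..t b * k. f (b, j))"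
  unfolding box_eq by (subst sum.Sigma) auto

text \<open>The linear terms of the spin complete each minimum to a positive part, by
  \<open>min u v = u - max 0 (u - v)\<close>. Where the spins vanish, \<open>vac\<close> is
  therefore the vacancy number, and at index 0 it is the spin.\<close>

lemma spin_vacancy:
  assumes a: "a \<in> {1..r}"
  shows "total_spin r Cm t k l n m a + vacancy r Cm t k n m a i = vac box base (case_prod m) (a, i)"
proof -
  have m: "sgn C * max 0 (\<bar>C\<bar> * int j - \<bar>C'\<bar> * int i) * x =
      int j * C * x - sgn C * (min (\<bar>C\<bar> * int j) (\<bar>C'\<bar> * int i) * x)" for C C' x :: int and j
  proof -
    have 1: "max 0 (u - v) = u - min u v" for u v :: int by simp
    have "sgn C * (\<bar>C\<bar> * int j) = C * int j"
      by (simp add: sgn_if abs_if)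
    then show ?thesis
      unfolding 1 right_diff_distrib left_diff_distrib by simp
  qed
  have "(\<Sum>y\<in>box. kap (a, i) y * int (case_prod m y)) =
      (\<Sum>b=1..r. \<Sum>j=1..t b * k. int j * Cm a b * int (m b j)) -
      (\<Sum>b=1..r. sgn (Cm a b) * (\<Sum>j=1..t b * k. min (\<bar>Cm a b\<bar> * int j) (\<bar>Cm b a\<bar> * int i) * int (m b j)))"
    unfolding sum_box sum_distrib_left sum_subtractf[symmetric]
  proof (intro sum.cong refl)
    fix b j assume "b \<in> {1..r}"
    then have "kap (a, i) (b, j) = sgn (Cm a b) * max 0 (\<bar>Cm a b\<bar> * int j - \<bar>Cm b a\<bar> * int i)"
      using kap_Cm[OF a, of "(b, j)" i] by simp
    then show "kap (a, i) (b, j) * int (case_prod m (b, j)) = int j * Cm a b * int (m b j) -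
        sgn (Cm a b) * (min (\<bar>Cm a b\<bar> * int j) (\<bar>Cm b a\<bar> * int i) * int (m b j))"
      by (simp add: m)
  qed
  moreover have "(\<Sum>j=1..t a * k. max 0 (int j - int i) * int (n a j)) =
      (\<Sum>j=1..t a * k. int j * int (n a j)) - (\<Sum>j=1..t a * k. int (min i j) * int (n a j))"
  proof -
    have "max 0 (int j - int i) * x = int j * x - int (min i j) * x" for j x
      by (simp add: max_def min_def algebra_simps)
    then show ?thesis by (simp add: sum_subtractf)
  qed
  ultimately show ?thesis
    unfolding vac_def total_spin_def vacancy_def base_def by simp
qed

lemma spin_eq: "a \<in> {1..r} \<Longrightarrow> total_spin r Cm t k l n m a = vac box base (case_prod m) (a, 0)"
  using spin_vacancy[of a m 0] by (simp add: vacancy_def min_absorb2)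

definition admissible :: "(nat \<times> nat \<Rightarrow> nat) set" where
  "admissible = {m. (\<forall>x. x \<notin> box \<longrightarrow> m x = 0) \<and> (\<forall>a\<in>{1..r}. vac box base m (a, 0) = 0)}"

text \<open>The spin conditions are linear in the sums of \<open>j * m (b, j)\<close> over
  \<open>j\<close>, and an injective Cartan matrix determines these sums. The common weight makes
  the admissible configurations finite in number and places them in a single coefficient of the
  generating function.\<close>

lemma admissible_weight:
  assumes "m \<in> admissible" "m' \<in> admissible"
  shows "(\<Sum>x\<in>box. snd x * m x) = (\<Sum>x\<in>box. snd x * m' x)"
proof -
  let ?x = "\<lambda>b. \<Sum>j=1..t b * k. int j * (int (m (b, j)) - int (m' (b, j)))"
  have "(\<Sum>b=1..r. Cm a b * ?x b) = 0" if a: "a \<in> {1..r}" for a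
  proof -
    have "vac box base m (a, 0) - vac box base m' (a, 0) = (\<Sum>b=1..r. Cm a b * ?x b)"
    proof -
      have "vac box base m (a, 0) - vac box base m' (a, 0) =
          (\<Sum>y\<in>box. kap (a, 0) y * (int (m y) - int (m' y)))"
        by (simp add: vac_def right_diff_distrib sum_subtractf)
      also have "\<dots> = (\<Sum>b=1..r. Cm a b * ?x b)"
        unfolding sum_box sum_distrib_left
      proof (intro sum.cong refl)
        fix b j assume "b \<in> {1..r}"
        then have "kap (a, 0) (b, j) = Cm a b * int j"
          using kap_Cm[of a "(b, j)" 0] a by (simp add: sgn_mult_abs flip: mult.assoc)
        then show "kap (a, 0) (b, j) * (int (m (b, j)) - int (m' (b, j))) =
            Cm a b * (int j * (int (m (b, j)) - int (m' (b, j))))"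
          by simp
      qed
      finally show ?thesis .
    qed
    then show ?thesis using assms a by (simp add: admissible_def)
  qed
  then have "?x b = 0" if "b \<in> {1..r}" for b
    using inj[of ?x] that by blast
  then have "(\<Sum>b=1..r. ?x b) = 0" by simp
  then have "(\<Sum>x\<in>box. int (snd x) * (int (m x) - int (m' x))) = 0"
    by (simp add: sum_box)
  then have "int (\<Sum>x\<in>box. snd x * m x) = int (\<Sum>x\<in>box. snd x * m' x)"
    by (simp add: right_diff_distrib sum_subtractf)
  then show ?thesis by linarith
qed

lemma finite_admissible: "finite admissible"
proof (cases "admissible = {}")
  case False
  then obtain m0 where m0: "m0 \<in> admissible" by blast
  have "admissible \<subseteq> configs box (\<Sum>x\<in>box. snd x * m0 x)"
    using admissible_weight[OF _ m0] by (auto simp: configs_def admissible_def)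
  then show ?thesis
    using finite_configs[OF finite_box box_sites] finite_subset by blast
qed simp

text \<open>Interpolates between the two sums: positivity is imposed only at times after
  \<open>\<theta>\<close>, so \<open>\<theta> = K\<close> means no condition and
  \<open>\<theta> = 0\<close> all of them.\<close>

definition partial_sum :: "nat \<Rightarrow> rat" where
  "partial_sum \<theta> = (\<Sum>m\<in>{m \<in> admissible. \<forall>x\<in>box. \<theta> < time x \<longrightarrow> 0 \<le> vac box base m x}.
     bin_weight box base m)"

text \<open>The two sums differ by the configurations whose last violation is at time
  \<open>Suc \<theta>\<close>. Within a group with fixed later values the later binomials factor
  out, and the sum over the rest is an instance of \<open>fiber_sum_zero\<close>.\<close>

lemma partial_sum_step:
  assumes "\<theta> < K"
  shows "partial_sum (Suc \<theta>) = partial_sum \<theta>"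
proof -
  let ?\<theta> = "Suc \<theta>"
  let ?p = "vac box base"
  define later where "later = {x \<in> box. ?\<theta> < time x}"
  define S where "S = {x \<in> sites. time x \<le> ?\<theta>}"
  define A where "A = {m \<in> admissible. \<forall>x\<in>later. 0 \<le> ?p m x}"
  define D where "D = {m \<in> A. \<exists>x\<in>box. time x = ?\<theta> \<and> ?p m x < 0}"
  have SB: "S \<subseteq> box" using assms by (auto simp: S_def box_def)
  have box_S: "box - S = later" "later \<subseteq> box" "later \<inter> S = {}" "S \<union> later = box"
    using SB by (auto simp: S_def later_def box_def)
  have fS: "finite S" and fl: "finite later"
    using SB box_S finite_subset[OF _ finite_box] by auto
  define g where "g m = (\<lambda>x. if x \<in> later then m x else (0::nat))" for m
  define low where "low m = (\<lambda>x. if x \<in> S then m x else (0::nat))" for m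
  have "(\<Sum>m\<in>{m \<in> D. g m = g m1}. bin_weight box base m) = 0" if m1: "m1 \<in> D" for m1
  proof -
    define P where "P x = base x + (\<Sum>y\<in>later. kap x y * int (m1 y))" for x
    have p_eq: "?p m x = vac S P (low m) x" if "g m = g m1" for m x
    proof -
      have "m y = m1 y" if "y \<in> later" for y
        using \<open>g m = g m1\<close> that unfolding g_def by metis
      then have "(\<Sum>y\<in>later. kap x y * int (m y)) = (\<Sum>y\<in>later. kap x y * int (m1 y))"
        by (intro sum.cong) auto
      moreover have "(\<Sum>y\<in>S. kap x y * int (low m y)) = (\<Sum>y\<in>S. kap x y * int (m y))"
        by (rule sum.cong) (auto simp: low_def)
      moreover have "(\<Sum>y\<in>box. kap x y * int (m y)) =
          (\<Sum>y\<in>S. kap x y * int (m y)) + (\<Sum>y\<in>later. kap x y * int (m y))"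
        unfolding box_S(4)[symmetric] using fS fl box_S(3) by (intro sum.union_disjoint) auto
      ultimately show ?thesis
        by (simp add: vac_def P_def)
    qed
    \<comment> \<open>From time \<open>Suc \<theta>\<close> on, vacancy numbers do not see the sites
      in \<open>S\<close>; violation at \<open>Suc \<theta>\<close> and positivity afterwards are
      therefore properties of the whole group.\<close>
    have vac_late: "vac S P m' x = P x" if "fst x \<in> {1..r}" "?\<theta> \<le> time x" for m' x
    proof -
      have "kap x y = 0" if "y \<in> S" for y
        using that \<open>?\<theta> \<le> time x\<close> \<open>fst x \<in> {1..r}\<close>
        by (intro kap_eq_0) (auto simp: S_def sites_def)
      then show ?thesis by (simp add: vac_def)
    qed
    have fst_box: "fst x \<in> {1..r}" if "x \<in> box" for x
      using that by (auto simp: box_def sites_def)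
    have p_late: "?p m x = P x" if "g m = g m1" "x \<in> box" "?\<theta> \<le> time x" for m x
      using p_eq[OF that(1)] vac_late[OF fst_box[OF that(2)] that(3)] by simp
    define N where "N = (\<Sum>x\<in>S. snd x * low m1 x)"
    have low_weight: "(\<Sum>x\<in>S. snd x * low m x) = N" if "m \<in> admissible" "g m = g m1" for m
    proof -
      have split: "(\<Sum>x\<in>box. snd x * m x) = (\<Sum>x\<in>S. snd x * low m x) + (\<Sum>x\<in>later. snd x * g m x)" for m
      proof -
        have "(\<Sum>x\<in>box. snd x * m x) = (\<Sum>x\<in>S. snd x * m x) + (\<Sum>x\<in>later. snd x * m x)"
          unfolding box_S(4)[symmetric] using fS fl box_S(3) by (intro sum.union_disjoint) auto
        moreover have "(\<Sum>x\<in>S. snd x * low m x) = (\<Sum>x\<in>S. snd x * m x)"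
          by (rule sum.cong) (auto simp: low_def)
        moreover have "(\<Sum>x\<in>later. snd x * g m x) = (\<Sum>x\<in>later. snd x * m x)"
          by (rule sum.cong) (auto simp: g_def)
        ultimately show ?thesis by simp
      qed
      have "m1 \<in> admissible" using m1 by (simp add: D_def A_def)
      from admissible_weight[OF that(1) this] show ?thesis
        unfolding split N_def that(2) by simp
    qed
    have "(\<Sum>m\<in>{m \<in> D. g m = g m1}. bin_weight box base m) =
        (\<Sum>m'\<in>{m' \<in> configs S N. \<forall>a\<in>{1..r}. vac S P m' (a, 0) = 0}.
          (\<Prod>x\<in>later. binc (P x) (m1 x)) * bin_weight S P m')"
    proof (rule sum.reindex_bij_witness[of _ "\<lambda>m' x. if x \<in> S then m' x else g m1 x" low])
      fix m assume m: "m \<in> {m \<in> D. g m = g m1}"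
      then have gm: "g m = g m1" and adm: "m \<in> admissible" by (auto simp: D_def A_def)
      have later_eq: "m x = m1 x" if "x \<in> later" for x
        using gm that unfolding g_def by metis
      show "(\<lambda>x. if x \<in> S then low m x else g m1 x) = m"
      proof
        fix x
        show "(if x \<in> S then low m x else g m1 x) = m x"
        proof (cases "x \<in> box")
          case True
          then show ?thesis using box_S(4) later_eq by (auto simp: low_def g_def)
        next
          case False
          then have "m x = 0" using adm unfolding admissible_def by blast
          then show ?thesis using False box_S SB by (auto simp: low_def g_def)
        qed
      qed
      show "low m \<in> {m' \<in> configs S N. \<forall>a\<in>{1..r}. vac S P m' (a, 0) = 0}"
        using adm low_weight[OF adm gm] p_eq[OF gm]
        by (auto simp: configs_def low_def admissible_def)
      have "(\<Prod>x\<in>later. binc (?p m x) (m x)) = (\<Prod>x\<in>later. binc (P x) (m1 x))"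
        by (rule prod.cong) (use later_eq p_late[OF gm] in \<open>auto simp: later_def\<close>)
      moreover have "(\<Prod>x\<in>S. binc (?p m x) (m x)) = bin_weight S P (low m)"
        unfolding bin_weight_def by (rule prod.cong) (auto simp: p_eq[OF gm] low_def)
      moreover have "bin_weight box base m =
          (\<Prod>x\<in>S. binc (?p m x) (m x)) * (\<Prod>x\<in>later. binc (?p m x) (m x))"
        unfolding bin_weight_def box_S(4)[symmetric] using fS fl box_S(3)
        by (intro prod.union_disjoint) auto
      ultimately show "(\<Prod>x\<in>later. binc (P x) (m1 x)) * bin_weight S P (low m) = bin_weight box base m"
        by simp
    next
      fix m' assume m': "m' \<in> {m' \<in> configs S N. \<forall>a\<in>{1..r}. vac S P m' (a, 0) = 0}"
      let ?m = "\<lambda>x. if x \<in> S then m' x else g m1 x"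
      show low: "low ?m = m'"
        using m' by (auto simp: low_def configs_def)
      have "x \<notin> S" if "x \<in> later" for x
        using box_S(3) that by blast
      then have gm: "g ?m = g m1"
        unfolding g_def by (intro ext) (simp split: if_split)
      have "?m \<in> admissible"
        using m' p_eq[OF gm] box_S SB unfolding low by (auto simp: admissible_def g_def)
      moreover have "0 \<le> ?p ?m x" if "x \<in> later" for x
      proof -
        have x: "x \<in> box" "?\<theta> \<le> time x" using that by (auto simp: later_def)
        have "?p ?m x = ?p m1 x" using p_late[OF gm x] p_late[OF refl x] by simp
        then show ?thesis using m1 that by (simp add: D_def A_def)
      qed
      moreover have "\<exists>x\<in>box. time x = ?\<theta> \<and> ?p ?m x < 0"
      proof -
        obtain x where x: "x \<in> box" "time x = ?\<theta>" "?p m1 x < 0"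
          using m1 by (auto simp: D_def)
        then have "?p ?m x = ?p m1 x" using p_late[OF gm x(1)] p_late[OF refl x(1)] by simp
        then show ?thesis using x by auto
      qed
      ultimately show "?m \<in> {m \<in> D. g m = g m1}"
        using gm by (simp add: D_def A_def)
    qed
    also have "\<dots> = (\<Prod>x\<in>later. binc (P x) (m1 x)) *
        (\<Sum>m'\<in>{m' \<in> configs S N. \<forall>a\<in>{1..r}. vac S P m' (a, 0) = 0}. bin_weight S P m')"
      by (simp add: sum_distrib_left)
    also have "(\<Sum>m'\<in>{m' \<in> configs S N. \<forall>a\<in>{1..r}. vac S P m' (a, 0) = 0}. bin_weight S P m') = 0"
    proof -
      obtain x0 where x0: "x0 \<in> box" "time x0 = ?\<theta>" "?p m1 x0 < 0"
        using m1 by (auto simp: D_def)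
      define a0 i0 where "a0 = fst x0" and "i0 = snd x0"
      define s where "s a = ?\<theta> div d a" for a
      have a0: "a0 \<in> {1..r}" using fst_box[OF x0(1)] by (simp add: a0_def)
      have da: "0 < d a0" using d_pos a0 by blast
      have i0: "i0 * d a0 = ?\<theta>" using x0(2) by (simp add: time_def a0_def i0_def)
      have s0: "s a0 = i0" unfolding s_def i0[symmetric] using da by simp
      show ?thesis
      proof (rule fiber_sum_zero[where s = s and ?a0.0 = a0])
        have "snd x * d (fst x) \<le> ?\<theta> \<longleftrightarrow> snd x \<le> s (fst x)" if "x \<in> sites" for x
          using d_pos[of "fst x"] that unfolding s_def
          by (subst less_eq_div_iff_mult_less_eq) (auto simp: sites_def)
        then show "S = {x \<in> sites. snd x \<le> s (fst x)}"
          unfolding S_def time_def by blast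
        show "down_closed S"
          by (auto simp: down_closed_def S_def earlier_def)
        show "P (a0, s a0) < 0"
          unfolding s0 using x0 p_late[OF refl x0(1)] by (simp add: a0_def i0_def)
        show "0 \<le> P (a0, s a0 + 1)"
        proof (cases "(a0, i0 + 1) \<in> box")
          case True
          then have l: "(a0, i0 + 1) \<in> later"
            using i0 da by (simp add: later_def time_def)
          then have "P (a0, i0 + 1) = ?p m1 (a0, i0 + 1)"
            using p_late[OF refl True] by (simp add: later_def)
          then show ?thesis using m1 l by (simp add: s0 D_def A_def)
        next
          case False
          \<comment> \<open>The next site is beyond the box. All later multiplicities and all
            \<open>n\<close> lie at or before it and contribute nothing, so the value is the
            coefficient \<open>l a0\<close> of the dominant weight.\<close>
          have large: "t a0 * k < i0 + 1" using False a0 by (simp add: box_eq)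
          have "K = (t a0 * k) * d a0" using tk[OF a0] by (simp add: mult_ac)
          also have "\<dots> \<le> (i0 + 1) * d a0" using large by (intro mult_le_mono1) simp
          finally have K: "K \<le> time (a0, i0 + 1)" by (simp add: time_def)
          have "kap (a0, i0 + 1) y = 0" if "y \<in> later" for y
            by (rule kap_eq_0) (use that a0 K in \<open>auto simp: later_def box_def sites_def\<close>)
          then have "P (a0, s a0 + 1) = base (a0, i0 + 1)"
            by (simp add: P_def s0)
          also have "\<dots> = int (l a0)"
            using large by (auto simp: base_def intro!: sum.neutral)
          finally show ?thesis by simp
        qed
        fix j assume "j \<in> {1..s a0}"
        then have j: "1 \<le> j" "j * d a0 \<le> ?\<theta>" unfolding s0 i0[symmetric] by auto
        have "(\<Sum>y\<in>later. kap (a0, j + 1) y * int (m1 y)) + (\<Sum>y\<in>later. kap (a0, j - 1) y * int (m1 y)) \<le>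
            2 * (\<Sum>y\<in>later. kap (a0, j) y * int (m1 y))"
          unfolding sum.distrib[symmetric] sum_distrib_left
        proof (rule sum_mono)
          fix y assume y: "y \<in> later"
          have "kap (a0, j + 1) y + kap (a0, j - 1) y \<le> 2 * kap (a0, j) y"
            by (rule kap_concave) (use y j a0 in \<open>auto simp: later_def box_def sites_def\<close>)
          then have "(kap (a0, j + 1) y + kap (a0, j - 1) y) * int (m1 y) \<le> 2 * kap (a0, j) y * int (m1 y)"
            by (intro mult_right_mono) auto
          then show "kap (a0, j + 1) y * int (m1 y) + kap (a0, j - 1) y * int (m1 y) \<le>
              2 * (kap (a0, j) y * int (m1 y))"
            by (simp add: algebra_simps)
        qed
        moreover have "base (a0, j + 1) + base (a0, j - 1) \<le> 2 * base (a0, j)"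
        proof -
          let ?f = "\<lambda>i. \<Sum>j'=1..t a0 * k. max 0 (int j' - int i) * int (n a0 j')"
          have "2 * ?f j \<le> ?f (j + 1) + ?f (j - 1)"
            unfolding sum.distrib[symmetric] sum_distrib_left
          proof (rule sum_mono)
            fix j'
            have "2 * max 0 (int j' - int j) \<le> max 0 (int j' - int (j + 1)) + max 0 (int j' - int (j - 1))"
              using j by (simp add: max_def of_nat_diff)
            then have "2 * max 0 (int j' - int j) * int (n a0 j') \<le>
                (max 0 (int j' - int (j + 1)) + max 0 (int j' - int (j - 1))) * int (n a0 j')"
              by (intro mult_right_mono) auto
            then show "2 * (max 0 (int j' - int j) * int (n a0 j')) \<le>
                max 0 (int j' - int (j + 1)) * int (n a0 j') + max 0 (int j' - int (j - 1)) * int (n a0 j')"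
              by (simp add: algebra_simps)
          qed
          then show ?thesis by (simp add: base_def)
        qed
        ultimately have "(\<Sum>y\<in>later. kap (a0, j + 1) y * int (m1 y)) +
            (\<Sum>y\<in>later. kap (a0, j - 1) y * int (m1 y)) + (base (a0, j + 1) + base (a0, j - 1)) \<le>
            2 * (\<Sum>y\<in>later. kap (a0, j) y * int (m1 y)) + 2 * base (a0, j)"
          by (rule add_mono)
        then show "P (a0, j + 1) + P (a0, j - 1) \<le> 2 * P (a0, j)"
          unfolding P_def distrib_left by (simp only: ac_simps)
      qed (rule a0)
    qed
    finally show ?thesis by simp
  qed
  then have "(\<Sum>h\<in>g ` D. \<Sum>m\<in>{m \<in> D. g m = h}. bin_weight box base m) = 0"
    by (intro sum.neutral) auto
  moreover have fA: "finite A" and fD: "finite D"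
    using finite_admissible by (auto simp: A_def D_def)
  ultimately have D0: "(\<Sum>m\<in>D. bin_weight box base m) = 0"
    using sum.image_gen[OF fD, of "bin_weight box base" g] by simp
  have "{m \<in> admissible. \<forall>x\<in>box. \<theta> < time x \<longrightarrow> 0 \<le> ?p m x} = A - D"
  proof -
    have "\<theta> < u \<longleftrightarrow> u = ?\<theta> \<or> ?\<theta> < u" for u by linarith
    then show ?thesis
      unfolding A_def D_def later_def not_less[symmetric] by blast
  qed
  then have "partial_sum \<theta> = (\<Sum>m\<in>A - D. bin_weight box base m)"
    by (simp add: partial_sum_def)
  also have "\<dots> = (\<Sum>m\<in>A. bin_weight box base m) - (\<Sum>m\<in>D. bin_weight box base m)"
    by (rule sum_diff[OF fA]) (auto simp: D_def)
  also have "(\<Sum>m\<in>A. bin_weight box base m) = partial_sum ?\<theta>"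
    by (auto simp: partial_sum_def A_def later_def intro!: sum.cong)
  finally show ?thesis using D0 by simp
qed

theorem M_sum_eq_N_sum: "M_sum r Cm t k l n = N_sum r Cm t k l n"
proof -
  have const: "partial_sum \<theta> = partial_sum 0" if "\<theta> \<le> K" for \<theta>
    using that by (induction \<theta>) (simp_all add: partial_sum_step)
  have coll: "(m \<in> collections r t k \<and> (\<forall>a\<in>{1..r}. total_spin r Cm t k l n m a = 0)) \<longleftrightarrow>
      case_prod m \<in> admissible" for m
    by (auto simp: collections_def admissible_def box_eq spin_eq)
  have vacancy: "vacancy r Cm t k n m a i = vac box base (case_prod m) (a, i)"
    if "case_prod m \<in> admissible" "a \<in> {1..r}" for m a i
    using spin_vacancy[OF that(2), of m i] coll[of m] that by auto
  have weight: "weight_product r Cm t k n m = bin_weight box base (case_prod m)"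
    if "case_prod m \<in> admissible" for m
  proof -
    have "bin_weight box base (case_prod m) =
        (\<Prod>a=1..r. \<Prod>i=1..t a * k. binc (vac box base (case_prod m) (a, i)) (m a i))"
      unfolding bin_weight_def box_eq by (subst prod.Sigma) (auto simp: case_prod_unfold)
    also have "\<dots> = weight_product r Cm t k n m"
      unfolding weight_product_def binc_def
      by (intro prod.cong refl) (simp add: vacancy[OF that])
    finally show ?thesis ..
  qed
  have "N_sum r Cm t k l n = partial_sum K"
    unfolding N_sum_def partial_sum_def
  proof (rule sum.reindex_bij_witness[of _ "\<lambda>m a i. m (a, i)" case_prod])
    fix m
    assume m: "m \<in> {m \<in> collections r t k. \<forall>a\<in>{1..r}. total_spin r Cm t k l n m a = 0}"
    then have adm: "case_prod m \<in> admissible" using coll[of m] by blast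
    show "(\<lambda>a i. (case_prod m) (a, i)) = m" by simp
    show "case_prod m \<in> {m \<in> admissible. \<forall>x\<in>box. K < time x \<longrightarrow> 0 \<le> vac box base m x}"
      using adm by (simp add: box_def)
    show "bin_weight box base (case_prod m) = weight_product r Cm t k n m"
      using weight[OF adm] by simp
  next
    fix m assume m: "m \<in> {m \<in> admissible. \<forall>x\<in>box. K < time x \<longrightarrow> 0 \<le> vac box base m x}"
    show "case_prod (\<lambda>a i. m (a, i)) = m" by simp
    then show "(\<lambda>a i. m (a, i)) \<in> {m \<in> collections r t k. \<forall>a\<in>{1..r}. total_spin r Cm t k l n m a = 0}"
      using m coll[of "\<lambda>a i. m (a, i)"] by simp
  qed
  moreover have "M_sum r Cm t k l n = partial_sum 0"
    unfolding M_sum_def partial_sum_def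
  proof (rule sum.reindex_bij_witness[of _ "\<lambda>m a i. m (a, i)" case_prod])
    have nonneg: "(\<forall>a\<in>{1..r}. \<forall>i\<in>{1..t a * k}. 0 \<le> vacancy r Cm t k n m a i) \<longleftrightarrow>
        (\<forall>x\<in>box. 0 < time x \<longrightarrow> 0 \<le> vac box base (case_prod m) x)"
      if "case_prod m \<in> admissible" for m
      using time_pos box_sites vacancy[OF that] by (fastforce simp: box_eq)
    fix m
    assume m: "m \<in> {m \<in> collections r t k. (\<forall>a\<in>{1..r}. total_spin r Cm t k l n m a = 0) \<and>
        (\<forall>a\<in>{1..r}. \<forall>i\<in>{1..t a * k}. 0 \<le> vacancy r Cm t k n m a i)}"
    then have adm: "case_prod m \<in> admissible" using coll[of m] by blast
    show "(\<lambda>a i. (case_prod m) (a, i)) = m" by simp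
    show "case_prod m \<in> {m \<in> admissible. \<forall>x\<in>box. 0 < time x \<longrightarrow> 0 \<le> vac box base m x}"
      using m adm nonneg[OF adm] by blast
    show "bin_weight box base (case_prod m) = weight_product r Cm t k n m"
      using weight[OF adm] by simp
  next
    fix m assume m: "m \<in> {m \<in> admissible. \<forall>x\<in>box. 0 < time x \<longrightarrow> 0 \<le> vac box base m x}"
    let ?m = "\<lambda>a i. m (a, i)"
    show cm: "case_prod ?m = m" by simp
    have "0 \<le> vacancy r Cm t k n ?m a i" if "a \<in> {1..r}" "i \<in> {1..t a * k}" for a i
    proof -
      have "(a, i) \<in> box" using that by (simp add: box_eq)
      then have "0 < time (a, i)" using time_pos box_sites by blast
      then show ?thesis
        using m that \<open>(a, i) \<in> box\<close> vacancy[of ?m a i] by simp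
    qed
    then show "?m \<in> {m \<in> collections r t k. (\<forall>a\<in>{1..r}. total_spin r Cm t k l n m a = 0) \<and>
        (\<forall>a\<in>{1..r}. \<forall>i\<in>{1..t a * k}. 0 \<le> vacancy r Cm t k n m a i)}"
      using m coll[of ?m] unfolding cm by blast
  qed
  ultimately show ?thesis
    using const[of K] by simp
qed

end

end

section \<open>The Killing form\<close>

context lie_algebra
begin

definition lin :: "('g \<Rightarrow> 'g) \<Rightarrow> bool" where
  "lin f \<longleftrightarrow> (\<forall>x y. f (x + y) = f x + f y) \<and> (\<forall>c x. f (scale c x) = scale c (f x))"

lemma lin_br: "lin (br x)"
  by (simp add: lin_def br_add_right br_scale_right)

lemma lin_comp: "lin f \<Longrightarrow> lin g \<Longrightarrow> lin (\<lambda>x. f (g x))"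
  by (simp add: lin_def)

lemma lin_0: "lin f \<Longrightarrow> f 0 = 0"
  unfolding lin_def by (metis scale_zero_left)

lemma lin_sum: "lin f \<Longrightarrow> f (sum g A) = (\<Sum>x\<in>A. f (g x))"
  by (induction A rule: infinite_finite_induct) (simp_all add: lin_0, simp add: lin_def)

lemma br_0_left [simp]: "br 0 y = 0"
  using br_scale_left[of 0 0 y] by simp

lemma br_0_right [simp]: "br x 0 = 0"
  using br_scale_right[of x 0 0] by simp

lemma br_minus_right: "br x (- y) = - br x y"
  using br_add_right[of x y "- y"] by (simp add: eq_neg_iff_add_eq_0 add.commute)

lemma br_diff_right: "br x (y - z) = br x y - br x z"
  using br_add_right[of x y "- z"] by (simp add: br_minus_right)

lemma br_anticomm: "br x y = - br y x"
proof -
  have "br (x + y) (x + y) = (br x x + br x y) + (br y x + br y y)"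
    unfolding br_add_left br_add_right by (simp only: add_ac)
  then have "br x y + br y x = 0"
    by (simp add: br_self)
  then show ?thesis by (simp add: eq_neg_iff_add_eq_0)
qed

lemma br_br_left: "br (br x y) z = br x (br y z) - br y (br x z)"
  using jacobi[of x y z] br_anticomm[of z "br x y"] br_anticomm[of z x]
  by (simp add: br_minus_right algebra_simps)

abbreviation is_basis :: "'g set \<Rightarrow> bool" where
  "is_basis B \<equiv> independent B \<and> span B = UNIV"

lemma finite_basis: "is_basis B \<Longrightarrow> finite B"
  using finiteI_independent by blast

lemma basis_expand: "is_basis B \<Longrightarrow> (\<Sum>b\<in>B. scale (representation B x b) b) = x"
  using sum_representation_eq[of B x B] finite_basis by auto

text \<open>Expanding in the other basis between the two maps and swapping the double sum. Two bases
  at once give independence of the basis, with \<open>g\<close> the identity, as well as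
  \<open>tr (f g) = tr (g f)\<close>.\<close>

lemma trace_exchange:
  assumes B: "is_basis B" and B': "is_basis B'" and f: "lin f" and g: "lin g"
  shows "(\<Sum>b\<in>B. representation B (f (g b)) b) = (\<Sum>b\<in>B'. representation B' (g (f b)) b)"
proof -
  have expand: "representation B1 (f1 u) y =
      (\<Sum>b\<in>B2. representation B2 u b * representation B1 (f1 b) y)"
    if B1: "is_basis B1" and B2: "is_basis B2" and f1: "lin f1" for B1 B2 f1 u y
  proof -
    have "f1 u = f1 (\<Sum>b\<in>B2. scale (representation B2 u b) b)"
      by (simp add: basis_expand[OF B2])
    also have "\<dots> = (\<Sum>b\<in>B2. scale (representation B2 u b) (f1 b))"
      using f1 by (simp add: lin_sum) (simp add: lin_def)
    finally show ?thesis
      using B1 by (simp add: representation_sum representation_scale)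
  qed
  have "(\<Sum>b\<in>B. representation B (f (g b)) b) =
      (\<Sum>b\<in>B. \<Sum>b'\<in>B'. representation B' (g b) b' * representation B (f b') b)"
    by (simp add: expand[OF B B' f, of "g _"])
  also have "\<dots> = (\<Sum>b'\<in>B'. \<Sum>b\<in>B. representation B (f b') b * representation B' (g b) b')"
    by (subst sum.swap) (simp add: mult.commute)
  also have "\<dots> = (\<Sum>b\<in>B'. representation B' (g (f b)) b)"
    by (simp add: expand[OF B' B g, of "f _"])
  finally show ?thesis .
qed

lemma is_basis_Basis: "is_basis Basis"
  using independent_Basis span_Basis by simp

lemma trace_basis:
  assumes "is_basis B" "lin f"
  shows "trace f = (\<Sum>b\<in>B. representation B (f b) b)"
  using trace_exchange[OF is_basis_Basis assms, of id] unfolding trace_def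
  by (simp add: lin_def)

lemma trace_comm: "lin f \<Longrightarrow> lin g \<Longrightarrow> trace (\<lambda>x. f (g x)) = trace (\<lambda>x. g (f x))"
  unfolding trace_def by (rule trace_exchange[OF is_basis_Basis is_basis_Basis])

lemma trace_add: "trace (\<lambda>x. f x + g x) = trace f + trace g"
  using is_basis_Basis by (simp add: trace_def representation_add sum.distrib)

lemma trace_diff: "trace (\<lambda>x. f x - g x) = trace f - trace g"
  using is_basis_Basis by (simp add: trace_def representation_diff sum_subtractf)

lemma trace_scale: "trace (\<lambda>x. scale c (f x)) = c * trace f"
  using is_basis_Basis by (simp add: trace_def representation_scale sum_distrib_left)

lemma killing_sym: "killing x y = killing y x"
  unfolding killing_def by (rule trace_comm[OF lin_br lin_br])

lemma killing_add_left: "killing (x + y) z = killing x z + killing y z"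
  by (simp add: killing_def br_add_left trace_add)

lemma killing_scale_left: "killing (scale c x) y = c * killing x y"
  by (simp add: killing_def br_scale_left trace_scale)

lemma killing_add_right: "killing x (y + z) = killing x y + killing x z"
  using killing_add_left killing_sym by metis

lemma killing_scale_right: "killing x (scale c y) = c * killing x y"
  using killing_scale_left killing_sym by metis

lemma killing_0_left [simp]: "killing 0 y = 0"
  using killing_scale_left[of 0 0 y] by simp

lemma killing_0_right [simp]: "killing y 0 = 0"
  using killing_sym[of y 0] by simp

lemma killing_minus_left: "killing (- x) y = - killing x y"
  using killing_scale_left[of "-1" x y] by simp

lemma killing_sum_left: "killing (sum f A) y = (\<Sum>x\<in>A. killing (f x) y)"
  by (induction A rule: infinite_finite_induct) (simp_all add: killing_add_left)

lemma killing_sum_right: "killing x (sum f A) = (\<Sum>y\<in>A. killing x (f y))"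
  by (induction A rule: infinite_finite_induct) (simp_all add: killing_add_right)

lemma killing_invariant: "killing (br x y) z = killing x (br y z)"
proof -
  have "trace (\<lambda>w. br y (br x (br z w))) = trace (\<lambda>w. br x (br z (br y w)))"
    by (rule trace_comm[OF lin_br lin_comp[OF lin_br lin_br]])
  then show ?thesis
    by (simp add: killing_def br_br_left br_diff_right trace_diff)
qed

section \<open>Weight spaces\<close>

lemma eigenvectors_independent:
  assumes "finite \<Lambda>" "lin f" "\<And>c. c \<in> \<Lambda> \<Longrightarrow> f (z c) = scale c (z c)" "(\<Sum>c\<in>\<Lambda>. z c) = 0"
  shows "\<forall>c\<in>\<Lambda>. z c = 0"
  using assms
proof (induction \<Lambda> arbitrary: z rule: finite_induct)
  case (insert m \<Lambda>)
  have "0 = f (\<Sum>c\<in>insert m \<Lambda>. z c) - scale m (\<Sum>c\<in>insert m \<Lambda>. z c)"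
    using insert.prems lin_0 by simp
  also have "\<dots> = (\<Sum>c\<in>insert m \<Lambda>. f (z c) - scale m (z c))"
    using insert.prems(1) by (simp only: lin_sum scale_sum_right sum_subtractf)
  also have "\<dots> = (\<Sum>c\<in>\<Lambda>. scale (c - m) (z c))"
    using insert.hyps insert.prems(2) by (simp add: scale_left_diff_distrib)
  finally have s0: "(\<Sum>c\<in>\<Lambda>. scale (c - m) (z c)) = 0" by simp
  have "\<forall>c\<in>\<Lambda>. scale (c - m) (z c) = 0"
  proof (rule insert.IH)
    show "f (scale (c - m) (z c)) = scale c (scale (c - m) (z c))" if "c \<in> \<Lambda>" for c
      using insert.prems(1,2) that by (simp add: lin_def mult.commute)
  qed (use insert.prems s0 in auto)
  then have "\<forall>c\<in>\<Lambda>. z c = 0"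
    using insert.hyps by auto
  then show ?case
    using insert.prems(3) insert.hyps by simp
qed simp

lemma eigenvector_decomposition:
  assumes f: "lin f" and "span {x. \<exists>c. f x = scale c x} = UNIV"
  shows "\<exists>\<Lambda> y. finite \<Lambda> \<and> (\<forall>c. f (y c) = scale c (y c)) \<and> x = (\<Sum>c\<in>\<Lambda>. y c)"
proof -
  \<comment> \<open>Vanishing outside \<open>\<Lambda>\<close> allows a new eigenvalue to be
    inserted without changing the sum.\<close>
  let ?P = "\<lambda>x. \<exists>\<Lambda> y. finite \<Lambda> \<and> (\<forall>c. f (y c) = scale c (y c)) \<and> (\<forall>c. c \<notin> \<Lambda> \<longrightarrow> y c = 0) \<and>
      x = (\<Sum>c\<in>\<Lambda>. y c)"
  have "x \<in> span {x. \<exists>c. f x = scale c x}" using assms(2) by simp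
  then have "?P x"
  proof (induction rule: span_induct_alt)
    case base
    show ?case
      by (rule exI[of _ "{}"], rule exI[of _ "\<lambda>_. 0"]) (simp add: lin_0[OF f])
  next
    case (step k u v)
    then obtain m where m: "f u = scale m u" by blast
    from step obtain \<Lambda> y where y: "finite \<Lambda>" "\<And>c. f (y c) = scale c (y c)"
      "\<And>c. c \<notin> \<Lambda> \<Longrightarrow> y c = 0" "v = (\<Sum>c\<in>\<Lambda>. y c)" by blast
    let ?y = "y(m := scale k u + y m)"
    have "f (?y c) = scale c (?y c)" for c
      using f m y(2) by (simp add: lin_def scale_right_distrib mult.commute)
    moreover have "v = (\<Sum>c\<in>insert m \<Lambda>. y c)"
      using y by (cases "m \<in> \<Lambda>") (simp_all add: insert_absorb)
    then have "scale k u + v = (\<Sum>c\<in>insert m \<Lambda>. ?y c)"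
    proof -
      have "(\<Sum>c\<in>insert m \<Lambda>. g c) = g m + (\<Sum>c\<in>\<Lambda> - {m}. g c)" for g :: "complex \<Rightarrow> 'g"
        using y(1) by (simp add: sum.insert_remove)
      then show ?thesis
        using \<open>v = (\<Sum>c\<in>insert m \<Lambda>. y c)\<close> by (simp add: add.assoc)
    qed
    ultimately show ?case
      using y(1,3) by (intro exI[of _ "insert m \<Lambda>"] exI[of _ ?y]) auto
  qed
  then show ?thesis by blast
qed

definition common_eigenvectors :: "'g set \<Rightarrow> 'g set" where
  "common_eigenvectors K = {x. \<forall>h\<in>K. \<exists>c. br h x = scale c x}"

text \<open>Let \<open>x\<close> be a common eigenvector of \<open>K\<close> and \<open>y c\<close>
  its components along the eigenspaces of a further \<open>h\<close>. The defects
  \<open>br k (y c) - scale m (y c)\<close> are again eigenvectors of \<open>h\<close> and sum to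
  zero, so each vanishes: the components stay eigenvectors for \<open>K\<close>.\<close>

lemma span_common_eigenvectors:
  assumes H: "cartan_subalgebra H" and "finite K" "K \<subseteq> H"
  shows "span (common_eigenvectors K) = UNIV"
  using assms(2,3)
proof (induction K rule: finite_induct)
  case empty
  have "common_eigenvectors {} = UNIV" by (simp add: common_eigenvectors_def)
  then show ?case by (metis UNIV_I span_superset subsetI subset_antisym top_greatest)
next
  case (insert h K)
  have h: "h \<in> H" and K: "K \<subseteq> H" using insert.prems by auto
  have "common_eigenvectors K \<subseteq> span (common_eigenvectors (insert h K))"
  proof
    fix x assume x: "x \<in> common_eigenvectors K"
    have "span {x. \<exists>c. br h x = scale c x} = UNIV"
      using H h unfolding cartan_subalgebra_def by blast
    from eigenvector_decomposition[OF lin_br this, of x]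
    obtain \<Lambda> y where y: "finite \<Lambda>" "\<And>c. br h (y c) = scale c (y c)" "x = (\<Sum>c\<in>\<Lambda>. y c)" by blast
    have "y c \<in> common_eigenvectors (insert h K)" if c: "c \<in> \<Lambda>" for c
      unfolding common_eigenvectors_def
    proof (intro CollectI ballI)
      fix k assume "k \<in> insert h K"
      then consider "k = h" | "k \<in> K" by blast
      then show "\<exists>m. br k (y c) = scale m (y c)"
      proof cases
        case 2
        then obtain m where m: "br k x = scale m x"
          using x by (auto simp: common_eigenvectors_def)
        let ?z = "\<lambda>c. br k (y c) - scale m (y c)"
        have comm: "br h (br k v) = br k (br h v)" for v
        proof -
          have "br h k = 0" using H h K 2 unfolding cartan_subalgebra_def by blast
          then show ?thesis using br_br_left[of h k v] by simp
        qed
        have "\<forall>c\<in>\<Lambda>. ?z c = 0"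
        proof (rule eigenvectors_independent[OF y(1) lin_br[of h]])
          show "br h (?z c) = scale c (?z c)" for c
            by (simp add: br_diff_right comm y(2) br_scale_right scale_right_diff_distrib mult.commute)
          show "(\<Sum>c\<in>\<Lambda>. ?z c) = 0"
            using m unfolding y(3) by (simp add: sum_subtractf lin_sum[OF lin_br] scale_sum_right)
        qed
        then show ?thesis using c by auto
      qed (use y(2) in blast)
    qed
    then show "x \<in> span (common_eigenvectors (insert h K))"
      unfolding y(3) by (intro span_sum span_base)
  qed
  then have "span (common_eigenvectors K) \<subseteq> span (common_eigenvectors (insert h K))"
    by (simp add: span_minimal subspace_span)
  then show ?case using insert.IH K by auto
qed

text \<open>A basis of \<open>H\<close> suffices, since the elements having a fixed \<open>x\<close>
  as eigenvector form a subspace.\<close>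

lemma span_common_eigenvectors_H:
  assumes H: "cartan_subalgebra H"
  shows "span (common_eigenvectors H) = UNIV"
proof -
  obtain K where K: "K \<subseteq> H" "independent K" "H \<subseteq> span K"
    by (rule maximal_independent_subset)
  have "finite K" by (rule finiteI_independent[OF K(2)])
  have "common_eigenvectors K \<subseteq> common_eigenvectors H"
  proof
    fix x assume x: "x \<in> common_eigenvectors K"
    have "subspace {h. \<exists>c. br h x = scale c x}"
    proof (rule subspaceI)
      have "br 0 x = scale 0 x" by simp
      then show "0 \<in> {h. \<exists>c. br h x = scale c x}" by blast
    next
      fix u v assume "u \<in> {h. \<exists>c. br h x = scale c x}" "v \<in> {h. \<exists>c. br h x = scale c x}"
      then obtain c c' where "br u x = scale c x" "br v x = scale c' x" by blast
      then have "br (u + v) x = scale (c + c') x"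
        by (simp add: br_add_left scale_left_distrib)
      then show "u + v \<in> {h. \<exists>c. br h x = scale c x}" by blast
    next
      fix c u assume "u \<in> {h. \<exists>c. br h x = scale c x}"
      then obtain c' where "br u x = scale c' x" by blast
      then have "br (scale c u) x = scale (c * c') x"
        by (simp add: br_scale_left)
      then show "scale c u \<in> {h. \<exists>c. br h x = scale c x}" by blast
    qed
    moreover have "K \<subseteq> {h. \<exists>c. br h x = scale c x}"
      using x by (auto simp: common_eigenvectors_def)
    ultimately have "span K \<subseteq> {h. \<exists>c. br h x = scale c x}"
      by (rule span_minimal[rotated])
    then show "x \<in> common_eigenvectors H"
      using K(3) by (auto simp: common_eigenvectors_def)
  qed
  then have "span (common_eigenvectors K) \<subseteq> span (common_eigenvectors H)"
    by (rule span_mono)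
  then show ?thesis
    using span_common_eigenvectors[OF H \<open>finite K\<close> K(1)] by auto
qed

end

section \<open>Eigenbasis and weights\<close>

locale cartan_setting = simple_lie_algebra scale Basis br
  for scale :: "complex \<Rightarrow> 'g::ab_group_add \<Rightarrow> 'g" and Basis :: "'g set"
    and br :: "'g \<Rightarrow> 'g \<Rightarrow> 'g" +
  fixes H :: "'g set"
  assumes cartan: "cartan_subalgebra H"
begin

lemma subspace_H: "subspace H"
  using cartan by (simp add: cartan_subalgebra_def)

lemma H_commute: "h \<in> H \<Longrightarrow> h' \<in> H \<Longrightarrow> br h h' = 0"
  using cartan unfolding cartan_subalgebra_def by blast

lemma H_self_centralizing: "(\<And>h. h \<in> H \<Longrightarrow> br h x = 0) \<Longrightarrow> x \<in> H"
  using cartan unfolding cartan_subalgebra_def by blast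

definition EB :: "'g set" where
  "EB = (SOME B. B \<subseteq> common_eigenvectors H \<and> is_basis B)"

lemma EB: "EB \<subseteq> common_eigenvectors H" "is_basis EB"
proof -
  obtain B where B: "B \<subseteq> common_eigenvectors H" "independent B" "common_eigenvectors H \<subseteq> span B"
    by (rule maximal_independent_subset)
  have "span (common_eigenvectors H) \<subseteq> span B"
    using B(3) by (simp add: span_minimal subspace_span)
  then have "span B = UNIV"
    using span_common_eigenvectors_H[OF cartan] by auto
  then have "\<exists>B. B \<subseteq> common_eigenvectors H \<and> is_basis B"
    using B by blast
  then have "EB \<subseteq> common_eigenvectors H \<and> is_basis EB"
    unfolding EB_def by (rule someI_ex)
  then show "EB \<subseteq> common_eigenvectors H" "is_basis EB" by auto
qed

lemma finite_EB: "finite EB"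
  using finite_basis[OF EB(2)] .

lemma EB_nonzero: "b \<in> EB \<Longrightarrow> b \<noteq> 0"
  using EB(2) dependent_zero by blast

definition wt :: "'g \<Rightarrow> 'g \<Rightarrow> complex" where
  "wt b h = (if h \<in> H then THE c. br h b = scale c b else 0)"

lemma br_wt: "b \<in> EB \<Longrightarrow> h \<in> H \<Longrightarrow> br h b = scale (wt b h) b"
proof -
  assume b: "b \<in> EB" and h: "h \<in> H"
  have "\<exists>c. br h b = scale c b"
    using EB(1) b h by (auto simp: common_eigenvectors_def)
  then have "\<exists>!c. br h b = scale c b"
    using EB_nonzero[OF b] by (auto simp: scale_cancel_right)
  then have "br h b = scale (THE c. br h b = scale c b) b"
    by (rule theI')
  then show ?thesis using h by (simp add: wt_def)
qed

lemma root_spaceD: "x \<in> root_space H \<phi> \<Longrightarrow> h \<in> H \<Longrightarrow> br h x = scale (\<phi> h) x"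
  by (simp add: root_space_def)

lemma wt_root_space: "b \<in> EB \<Longrightarrow> b \<in> root_space H (wt b)"
  by (simp add: root_space_def br_wt)

lemma root_space_cong: "(\<And>h. h \<in> H \<Longrightarrow> \<phi> h = \<psi> h) \<Longrightarrow> root_space H \<phi> = root_space H \<psi>"
  by (auto simp: root_space_def)

lemma root_space_0: "(\<And>h. h \<in> H \<Longrightarrow> \<phi> h = 0) \<Longrightarrow> root_space H \<phi> = H"
  using H_commute H_self_centralizing by (auto simp: root_space_def)

lemma root_space_scale: "x \<in> root_space H \<phi> \<Longrightarrow> scale c x \<in> root_space H \<phi>"
  by (simp add: root_space_def br_scale_right mult.commute)

lemma zero_root_space [simp]: "0 \<in> root_space H \<phi>"
  by (simp add: root_space_def)

lemma root_space_br:
  assumes "x \<in> root_space H \<phi>" "y \<in> root_space H \<psi>"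
  shows "br x y \<in> root_space H (\<lambda>h. \<phi> h + \<psi> h)"
  unfolding root_space_def
proof (intro CollectI ballI)
  fix h assume h: "h \<in> H"
  have "br h (br x y) = br (br h x) y + br x (br h y)"
    by (simp add: br_br_left)
  then show "br h (br x y) = scale (\<phi> h + \<psi> h) (br x y)"
    using assms h by (simp add: root_spaceD br_scale_left br_scale_right scale_left_distrib)
qed

lemma rep_nonzero_wt:
  assumes x: "x \<in> root_space H \<phi>" and b: "b \<in> EB" "representation EB x b \<noteq> 0" and h: "h \<in> H"
  shows "wt b h = \<phi> h"
proof -
  have "br h x = br h (\<Sum>b\<in>EB. scale (representation EB x b) b)"
    by (simp add: basis_expand[OF EB(2)])
  also have "\<dots> = (\<Sum>b\<in>EB. scale (representation EB x b * wt b h) b)"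
    by (simp add: lin_sum[OF lin_br] br_scale_right br_wt h)
  finally have "representation EB (br h x) b =
      representation EB (\<Sum>b\<in>EB. scale (representation EB x b * wt b h) b) b" by simp
  also have "\<dots> = (\<Sum>b'\<in>EB. representation EB x b' * wt b' h * representation EB b' b)"
    using EB(2) by (simp add: representation_sum representation_scale)
  also have "\<dots> = (\<Sum>b'\<in>EB. if b' = b then representation EB x b * wt b h else 0)"
    using EB(2) by (intro sum.cong) (auto simp: representation_basis)
  also have "\<dots> = representation EB x b * wt b h"
    using b(1) finite_EB by simp
  also have "representation EB (br h x) b = \<phi> h * representation EB x b"
    using EB(2) by (simp add: root_spaceD[OF x h] representation_scale)
  finally show ?thesis using b(2) by simp
qed

lemma weight_exists:
  assumes "x \<in> root_space H \<phi>" "x \<noteq> 0"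
  shows "\<exists>b\<in>EB. representation EB x b \<noteq> 0 \<and> (\<forall>h\<in>H. wt b h = \<phi> h)"
proof -
  have "\<exists>b\<in>EB. representation EB x b \<noteq> 0"
  proof (rule ccontr)
    assume "\<not> ?thesis"
    then have "(\<Sum>b\<in>EB. scale (representation EB x b) b) = 0" by simp
    then show False using assms(2) by (simp add: basis_expand[OF EB(2)])
  qed
  then show ?thesis using rep_nonzero_wt[OF assms(1)] by blast
qed

lemma killing_H:
  assumes "h \<in> H" "h' \<in> H"
  shows "killing h h' = (\<Sum>b\<in>EB. wt b h * wt b h')"
proof -
  have "killing h h' = (\<Sum>b\<in>EB. representation EB (br h (br h' b)) b)"
    unfolding killing_def by (rule trace_basis[OF EB(2) lin_comp[OF lin_br lin_br]])
  also have "\<dots> = (\<Sum>b\<in>EB. wt b h * wt b h')"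
  proof (rule sum.cong)
    fix b assume b: "b \<in> EB"
    have "br h (br h' b) = scale (wt b h * wt b h') b"
      by (simp add: br_wt b assms br_scale_right mult.commute)
    then show "representation EB (br h (br h' b)) b = wt b h * wt b h'"
      using EB(2) b by (simp add: representation_scale representation_basis)
  qed simp
  finally show ?thesis .
qed

lemma central_eq_0:
  assumes "\<And>y. br z y = 0" shows "z = 0"
proof -
  have "lie_ideal {z. \<forall>y. br z y = 0}"
    unfolding lie_ideal_def by (auto intro!: subspaceI simp: br_add_left br_scale_left br_br_left)
  then have "{z. \<forall>y. br z y = 0} = {0} \<or> {z. \<forall>y. br z y = 0} = UNIV"
    by (rule no_ideals)
  moreover have "{z. \<forall>y. br z y = 0} \<noteq> UNIV"
    using nonabelian by blast
  ultimately show ?thesis using assms by blast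
qed

lemma lin_eq_0_on_EB:
  assumes "lin f" "\<And>b. b \<in> EB \<Longrightarrow> f b = 0" shows "f x = 0"
proof -
  have "f x = f (\<Sum>b\<in>EB. scale (representation EB x b) b)"
    by (simp add: basis_expand[OF EB(2)])
  also have "\<dots> = (\<Sum>b\<in>EB. scale (representation EB x b) (f b))"
    using assms(1) by (simp add: lin_sum) (simp add: lin_def)
  finally show ?thesis using assms(2) by simp
qed

lemma H_eq_0:
  assumes "h \<in> H" "\<And>b. b \<in> EB \<Longrightarrow> wt b h = 0" shows "h = 0"
proof (rule central_eq_0)
  show "br h y = 0" for y
    by (rule lin_eq_0_on_EB[OF lin_br]) (use assms br_wt in auto)
qed

section \<open>Strings of weight vectors and integrality\<close>

lemma string_stops:
  assumes x: "\<And>n. x n \<in> root_space H (\<lambda>h. \<psi> h + of_nat n * \<phi> h)" and h0: "h0 \<in> H" "\<phi> h0 \<noteq> 0"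
  shows "\<exists>n. x n = (0 :: 'g)"
proof (rule ccontr)
  assume "\<nexists>n. x n = 0"
  then have "\<exists>b\<in>EB. wt b h0 = \<psi> h0 + of_nat n * \<phi> h0" for n
    using weight_exists[OF x[of n]] h0(1) by blast
  then have "(\<lambda>n. \<psi> h0 + of_nat n * \<phi> h0) ` UNIV \<subseteq> (\<lambda>b. wt b h0) ` EB"
    by (metis (no_types, lifting) imageE image_eqI subsetI)
  then have "finite (range (\<lambda>n::nat. \<psi> h0 + of_nat n * \<phi> h0))"
    using finite_EB finite_subset by blast
  moreover have "inj (\<lambda>n::nat. \<psi> h0 + of_nat n * \<phi> h0)"
    using h0(2) by (auto intro!: injI)
  ultimately show False
    using finite_imageD infinite_UNIV_nat by blast
qed

lemma iterate_root_space:
  assumes "v \<in> root_space H \<psi>" "e \<in> root_space H \<phi>"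
  shows "(br e ^^ n) v \<in> root_space H (\<lambda>h. \<psi> h + of_nat n * \<phi> h)"
proof (induction n)
  case 0
  then show ?case using assms(1) by simp
next
  case (Suc n)
  have "br e ((br e ^^ n) v) \<in> root_space H (\<lambda>h. \<phi> h + (\<psi> h + of_nat n * \<phi> h))"
    by (rule root_space_br[OF assms(2) Suc])
  then show ?case by (simp add: algebra_simps)
qed

text \<open>The representation theory of \<open>sl\<^sub>2\<close> enters only through the lowest weight vector \<open>v\<close>.\<close>

lemma lowest_weight:
  assumes e: "e \<in> root_space H \<phi>" and f: "f \<in> root_space H (\<lambda>h. - \<phi> h)"
    and \<phi>: "h0 \<in> H" "\<phi> h0 \<noteq> 0" and h: "br e f \<in> H"
    and v: "v \<in> root_space H \<psi>" "v \<noteq> 0" "br f v = 0"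
  shows "\<exists>N::nat. \<psi> (br e f) = - \<phi> (br e f) * of_nat N / 2 \<and> (N = 0 \<longrightarrow> br e v = 0)"
proof -
  let ?h = "br e f"
  let ?u = "\<lambda>n. (br e ^^ n) v"
  note u = iterate_root_space[OF v(1) e]
  \<comment> \<open>The \<open>sl_2\<close> identity for lowering a raised lowest weight vector,
    without normalizing \<open>\<phi> (br e f)\<close> to 2.\<close>
  have step: "br f (?u (Suc n)) =
      scale (- (of_nat (Suc n) * (\<psi> ?h + of_nat n * \<phi> ?h / 2))) (?u n)" for n
  proof (induction n)
    case 0
    have "br f (br e v) = br e (br f v) - br ?h v"
      by (simp add: br_br_left)
    then show ?case using v(3) root_spaceD[OF v(1) h] by simp
  next
    case (Suc n)
    have "br f (br e (?u (Suc n))) = br e (br f (?u (Suc n))) - br ?h (?u (Suc n))"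
      by (simp add: br_br_left)
    also have "br e (br f (?u (Suc n))) =
        scale (- (of_nat (Suc n) * (\<psi> ?h + of_nat n * \<phi> ?h / 2))) (?u (Suc n))"
      unfolding Suc br_scale_right by simp
    also have "br ?h (?u (Suc n)) = scale (\<psi> ?h + of_nat (Suc n) * \<phi> ?h) (?u (Suc n))"
      by (rule root_spaceD[OF u h])
    also have "scale (- (of_nat (Suc n) * (\<psi> ?h + of_nat n * \<phi> ?h / 2))) (?u (Suc n)) -
        scale (\<psi> ?h + of_nat (Suc n) * \<phi> ?h) (?u (Suc n)) =
        scale (- (of_nat (Suc n) * (\<psi> ?h + of_nat n * \<phi> ?h / 2)) - (\<psi> ?h + of_nat (Suc n) * \<phi> ?h)) (?u (Suc n))"
      by (rule scale_left_diff_distrib[symmetric])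
    also have "- (of_nat (Suc n) * (\<psi> ?h + of_nat n * \<phi> ?h / 2)) - (\<psi> ?h + of_nat (Suc n) * \<phi> ?h) =
        - (of_nat (Suc (Suc n)) * (\<psi> ?h + of_nat (Suc n) * \<phi> ?h / 2))"
      by (simp add: field_simps)
    finally show ?case by simp
  qed
  have ex: "\<exists>n. ?u n = 0"
    by (rule string_stops[OF u \<phi>])
  define n where "n = (LEAST n. ?u n = 0)"
  have n: "?u n = 0" unfolding n_def by (rule LeastI_ex[OF ex])
  have "n \<noteq> 0" using n v(2) by (metis funpow_0)
  then obtain N where N: "n = Suc N" by (cases n) auto
  have "?u N \<noteq> 0"
    using not_less_Least[of N "\<lambda>n. ?u n = 0"] N unfolding n_def by simp
  moreover have "br f (?u (Suc N)) = 0" using n N by simp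
  ultimately have "of_nat (Suc N) * (\<psi> ?h + of_nat N * \<phi> ?h / 2) = 0"
    using step[of N] by (metis neg_equal_0_iff_equal scale_eq_0_iff)
  then have "\<psi> ?h + of_nat N * \<phi> ?h / 2 = 0"
    by (metis mult_eq_0_iff of_nat_eq_0_iff nat.distinct(1))
  then have "\<psi> ?h = - \<phi> ?h * of_nat N / 2"
    by (simp add: eq_neg_iff_add_eq_0 mult.commute)
  moreover have "br e v = 0" if "N = 0"
    using n N that by simp
  ultimately show ?thesis by blast
qed

text \<open>Applying \<open>f\<close> until the string stops gives a lowest weight vector of weight
  \<open>\<psi>\<close> minus a multiple of \<open>\<phi>\<close>. The case
  \<open>\<phi> (br e f) = 0\<close> is covered, so the result is available before the Killing form
  is known to be nondegenerate.\<close>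

lemma weight_integral:
  assumes e: "e \<in> root_space H \<phi>" and f: "f \<in> root_space H (\<lambda>h. - \<phi> h)"
    and \<phi>: "h0 \<in> H" "\<phi> h0 \<noteq> 0" and h: "br e f \<in> H"
    and v: "v \<in> root_space H \<psi>" "v \<noteq> 0"
  shows "\<exists>q::int. \<psi> (br e f) = \<phi> (br e f) * of_int q / 2"
proof -
  let ?u = "\<lambda>n. (br f ^^ n) v"
  note u = iterate_root_space[OF v(1) f]
  have ex: "\<exists>n. ?u n = 0"
    by (rule string_stops[OF u \<phi>(1)]) (use \<phi>(2) in simp)
  define n where "n = (LEAST n. ?u n = 0)"
  have n: "?u n = 0" unfolding n_def by (rule LeastI_ex[OF ex])
  have "n \<noteq> 0" using n v(2) by (metis funpow_0)
  then obtain p where p: "n = Suc p" by (cases n) auto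
  have "?u p \<noteq> 0"
    using not_less_Least[of p "\<lambda>n. ?u n = 0"] p unfolding n_def by simp
  moreover have "br f (?u p) = 0" using n p by simp
  ultimately obtain N :: nat where "\<psi> (br e f) + of_nat p * - \<phi> (br e f) = - \<phi> (br e f) * of_nat N / 2"
    using lowest_weight[OF e f \<phi> h u] by blast
  then have "\<psi> (br e f) = \<phi> (br e f) * of_int (2 * int p - int N) / 2"
    by (simp add: field_simps)
  then show ?thesis by blast
qed

end

section \<open>Nondegeneracy of the Killing form and the roots\<close>

context cartan_setting
begin

lemma bracket_in_H:
  assumes "e \<in> root_space H \<phi>" "f \<in> root_space H (\<lambda>h. - \<phi> h)"
  shows "br e f \<in> H"
  using root_space_br[OF assms] root_space_0[of "\<lambda>h. \<phi> h + - \<phi> h"] by simp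

lemma killing_orthogonal:
  assumes x: "x \<in> root_space H \<phi>" and y: "y \<in> root_space H \<psi>" and h: "h \<in> H" "\<phi> h + \<psi> h \<noteq> 0"
  shows "killing x y = 0"
proof -
  have "killing (br h x) y = - killing (br x h) y"
    using br_anticomm[of h x] by (simp add: killing_minus_left)
  also have "\<dots> = - killing x (br h y)"
    by (simp add: killing_invariant)
  finally have "(\<phi> h + \<psi> h) * killing x y = 0"
    using root_spaceD[OF x h(1)] root_spaceD[OF y h(1)]
    by (simp add: killing_scale_left killing_scale_right algebra_simps)
  then show ?thesis using h(2) by simp
qed

text \<open>With \<open>h = br e f\<close>, the value \<open>killing h h\<close> is
  \<open>(\<phi> h / 2)^2\<close> times a sum of squares of integers, among them that of
  \<open>\<phi>\<close> itself, which is 2 if \<open>\<phi> h \<noteq> 0\<close>. So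
  \<open>\<phi> h = 0\<close>, and by integrality every weight vanishes on \<open>h\<close>.\<close>

lemma bracket_eq_0_if_killing_0:
  assumes zero: "\<And>x y. killing x y = 0"
    and e: "e \<in> root_space H \<phi>" and f: "f \<in> root_space H (\<lambda>h. - \<phi> h)" and h0: "h0 \<in> H" "\<phi> h0 \<noteq> 0"
  shows "br e f = 0"
proof (cases "e = 0")
  case False
  have h: "br e f \<in> H" by (rule bracket_in_H[OF e f])
  have "\<exists>q::int. wt b (br e f) = \<phi> (br e f) * of_int q / 2" if "b \<in> EB" for b
    by (rule weight_integral[OF e f h0 h wt_root_space[OF that] EB_nonzero[OF that]])
  then obtain q :: "'g \<Rightarrow> int" where q: "\<And>b. b \<in> EB \<Longrightarrow> wt b (br e f) = \<phi> (br e f) * of_int (q b) / 2"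
    by metis
  have "\<phi> (br e f) = 0"
  proof (rule ccontr)
    assume nz: "\<phi> (br e f) \<noteq> 0"
    obtain b0 where b0: "b0 \<in> EB" "wt b0 (br e f) = \<phi> (br e f)"
      using weight_exists[OF e False] h by blast
    have "0 = (\<Sum>b\<in>EB. wt b (br e f) * wt b (br e f))"
      using killing_H[OF h h] zero by simp
    also have "\<dots> = (\<phi> (br e f) / 2) ^ 2 * of_int (\<Sum>b\<in>EB. (q b) ^ 2)"
      by (simp add: q sum_distrib_left power2_eq_square mult_ac)
    finally have "(\<Sum>b\<in>EB. (q b) ^ 2) = 0"
      using nz by (simp del: of_int_sum)
    then have "q b0 = 0"
      using b0(1) finite_EB by (simp add: sum_nonneg_eq_0_iff)
    then show False using q[OF b0(1)] b0(2) nz by simp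
  qed
  then show ?thesis
    using q by (intro H_eq_0[OF h]) simp
qed simp

definition nonzero_weight :: "('g \<Rightarrow> complex) \<Rightarrow> bool" where
  "nonzero_weight \<phi> \<longleftrightarrow> (\<exists>h\<in>H. \<phi> h \<noteq> 0)"

lemma H_nontrivial: "\<exists>h\<in>H. h \<noteq> 0"
proof (rule ccontr)
  assume "\<not> ?thesis"
  then have H0: "h = 0" if "h \<in> H" for h using that by blast
  have "x \<in> H" for x
  proof (rule H_self_centralizing)
    fix h assume "h \<in> H"
    then show "br h x = 0" using H0[of h] by simp
  qed
  then show False using H_commute nonabelian by blast
qed

lemma lie_ideal_span:
  assumes gen: "\<And>b y. b \<in> EB \<Longrightarrow> y \<in> S \<Longrightarrow> br b y \<in> span S"
  shows "lie_ideal (span S)"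
  unfolding lie_ideal_def
proof (intro conjI allI ballI)
  show "subspace (span S)" by simp
  fix x y assume "y \<in> span S"
  have "subspace {y. br x y \<in> span S}"
    by (rule subspaceI) (auto simp: br_add_right br_scale_right span_zero span_add span_scale)
  moreover have "S \<subseteq> {y. br x y \<in> span S}"
  proof
    fix y assume y: "y \<in> S"
    have "br x y = - br y (\<Sum>b\<in>EB. scale (representation EB x b) b)"
      using br_anticomm[of x y] by (simp add: basis_expand[OF EB(2)])
    also have "\<dots> = (\<Sum>b\<in>EB. scale (representation EB x b) (- br y b))"
      by (simp add: lin_sum[OF lin_br] br_scale_right sum_negf)
    also have "\<dots> = (\<Sum>b\<in>EB. scale (representation EB x b) (br b y))"
      by (intro sum.cong refl) (metis br_anticomm)
    also have "\<dots> \<in> span S"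
      by (intro span_sum span_scale gen[OF _ y])
    finally show "y \<in> {y. br x y \<in> span S}" by simp
  qed
  ultimately have "span S \<subseteq> {y. br x y \<in> span S}"
    by (rule span_minimal[rotated])
  then show "br x y \<in> span S" using \<open>y \<in> span S\<close> by blast
qed

text \<open>If the form vanished, opposite root spaces would commute and the nonzero weight spaces
  would span an ideal. The zero ideal would make all of \<open>H\<close> act by zero; the whole
  algebra would leave no weight vector of weight zero. Either way \<open>H\<close> would be
  trivial.\<close>

lemma killing_not_0: "\<exists>x y. killing x y \<noteq> 0"
proof (rule ccontr)
  assume "\<nexists>x y. killing x y \<noteq> 0"
  then have zero: "killing x y = 0" for x y by blast
  define I where "I = span (\<Union>\<phi>\<in>Collect nonzero_weight. root_space H \<phi>)"
  have base: "y \<in> I" if "nonzero_weight \<phi>" "y \<in> root_space H \<phi>" for \<phi> y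
    unfolding I_def using that by (intro span_base) auto
  have gen: "br b y \<in> I" if b: "b \<in> EB" and \<phi>: "nonzero_weight \<phi>" and y: "y \<in> root_space H \<phi>" for b y \<phi>
  proof (cases "nonzero_weight (\<lambda>h. wt b h + \<phi> h)")
    case True
    then show ?thesis using root_space_br[OF wt_root_space[OF b] y] base by blast
  next
    case False
    then have neg: "wt b h = - \<phi> h" if "h \<in> H" for h
      using that by (auto simp: nonzero_weight_def eq_neg_iff_add_eq_0)
    then have "b \<in> root_space H (\<lambda>h. - \<phi> h)"
      using wt_root_space[OF b] root_space_cong[of "wt b" "\<lambda>h. - \<phi> h"] by blast
    then have "br y b = 0"
      using bracket_eq_0_if_killing_0[OF zero y] \<phi> by (auto simp: nonzero_weight_def)
    then show ?thesis
      using br_anticomm[of b y] by (simp add: I_def span_zero)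
  qed
  have "lie_ideal I"
    unfolding I_def by (rule lie_ideal_span) (use gen in \<open>unfold I_def, blast\<close>)
  then consider "I = {0}" | "I = UNIV" using no_ideals by blast
  then show False
  proof cases
    case 1
    have "wt b h = 0" if "b \<in> EB" "h \<in> H" for b h
      using base[of "wt b" b] wt_root_space[OF that(1)] EB_nonzero[OF that(1)] 1 that
      by (auto simp: nonzero_weight_def)
    then have "h = 0" if "h \<in> H" for h
      using that by (intro H_eq_0) auto
    then show False using H_nontrivial by blast
  next
    case 2
    have "representation EB y b = 0" if b: "b \<in> EB" "\<And>h. h \<in> H \<Longrightarrow> wt b h = 0" for y b
    proof -
      have "subspace {y. representation EB y b = 0}"
        using EB(2) by (intro subspaceI)
          (auto simp: representation_add representation_scale representation_zero)
      moreover have "(\<Union>\<phi>\<in>Collect nonzero_weight. root_space H \<phi>) \<subseteq> {y. representation EB y b = 0}"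
        using rep_nonzero_wt[OF _ b(1)] b(2) by (fastforce simp: nonzero_weight_def)
      ultimately have "I \<subseteq> {y. representation EB y b = 0}"
        unfolding I_def by (rule span_minimal[rotated])
      then show ?thesis using 2 by blast
    qed
    note rep0 = this
    have nz: "nonzero_weight (wt b)" if b: "b \<in> EB" for b
    proof (rule ccontr)
      assume "\<not> ?thesis"
      then have "representation EB b b = 0"
        using rep0[OF b] by (simp add: nonzero_weight_def)
      then show False using EB(2) b by (simp add: representation_basis)
    qed
    have "h = 0" if h: "h \<in> H" for h
    proof (rule ccontr)
      assume "h \<noteq> 0"
      have "h \<in> root_space H (\<lambda>_. 0)" using root_space_0[of "\<lambda>_. 0"] h by simp
      from weight_exists[OF this \<open>h \<noteq> 0\<close>] obtain b where "b \<in> EB" "\<forall>h\<in>H. wt b h = 0"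
        by blast
      then show False using nz[of b] by (simp add: nonzero_weight_def)
    qed
    then show False using H_nontrivial by blast
  qed
qed

lemma killing_nondegenerate:
  assumes "\<And>y. killing x y = 0" shows "x = 0"
proof -
  have "lie_ideal {x. \<forall>y. killing x y = 0}"
    unfolding lie_ideal_def
    by (auto intro!: subspaceI simp: killing_add_left killing_scale_left)
      (metis br_anticomm killing_invariant killing_minus_left neg_0_equal_iff_equal)
  then have "{x. \<forall>y. killing x y = 0} = {0} \<or> {x. \<forall>y. killing x y = 0} = UNIV"
    by (rule no_ideals)
  moreover have "{x. \<forall>y. killing x y = 0} \<noteq> UNIV"
    using killing_not_0 by blast
  ultimately show ?thesis using assms by blast
qed

lemma killing_eq_0_if_on_EB:
  assumes "\<And>b. b \<in> EB \<Longrightarrow> killing x b = 0" shows "killing x y = 0"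
proof -
  have "killing x y = killing x (\<Sum>b\<in>EB. scale (representation EB y b) b)"
    by (simp add: basis_expand[OF EB(2)])
  then show ?thesis
    using assms by (simp add: killing_sum_right killing_scale_right)
qed

text \<open>By invariance a weight vector is orthogonal to every weight space except the opposite
  one, so nondegeneracy must show itself there.\<close>

lemma root_pair:
  assumes x: "x \<in> root_space H \<phi>" "x \<noteq> 0"
  shows "\<exists>y\<in>root_space H (\<lambda>h. - \<phi> h). killing x y \<noteq> 0"
proof -
  obtain b where b: "b \<in> EB" "killing x b \<noteq> 0"
    using killing_nondegenerate killing_eq_0_if_on_EB x(2) by blast
  have "wt b h = - \<phi> h" if "h \<in> H" for h
    using killing_orthogonal[OF x(1) wt_root_space[OF b(1)] that] b(2)
    by (auto simp: eq_neg_iff_add_eq_0 add.commute)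
  then have "b \<in> root_space H (\<lambda>h. - \<phi> h)"
    using wt_root_space[OF b(1)] root_space_cong[of "wt b" "\<lambda>h. - \<phi> h"] by blast
  then show ?thesis using b(2) by blast
qed

lemma killing_H_nondegenerate:
  assumes "h \<in> H" "\<And>h'. h' \<in> H \<Longrightarrow> killing h h' = 0" shows "h = 0"
proof (rule ccontr)
  assume "h \<noteq> 0"
  moreover have "h \<in> root_space H (\<lambda>_. 0)" using root_space_0[of "\<lambda>_. 0"] assms(1) by simp
  ultimately obtain y where "y \<in> root_space H (\<lambda>h. - 0)" "killing h y \<noteq> 0"
    using root_pair[of h "\<lambda>_. 0"] by blast
  then show False using assms(2)[of y] root_space_0[of "\<lambda>h. - 0"] by simp
qed

lemma killing_bracket:
  assumes "f \<in> root_space H (\<lambda>h. - \<phi> h)" "h \<in> H"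
  shows "killing (br e f) h = \<phi> h * killing e f"
proof -
  have "br f h = scale (\<phi> h) f"
    using br_anticomm[of f h] root_spaceD[OF assms] by simp
  then show ?thesis by (simp add: killing_invariant killing_scale_right)
qed

lemma rootsD:
  assumes "\<phi> \<in> roots H"
  shows "\<phi> \<in> dual H" "nonzero_weight \<phi>" "\<exists>x\<in>root_space H \<phi>. x \<noteq> 0"
proof -
  show d: "\<phi> \<in> dual H" using assms by (simp add: roots_def)
  have "\<phi> \<noteq> (\<lambda>_. 0)" using assms by (simp add: roots_def)
  then show "nonzero_weight \<phi>"
    using d unfolding nonzero_weight_def dual_def by blast
  show "\<exists>x\<in>root_space H \<phi>. x \<noteq> 0"
    using assms zero_root_space[of \<phi>] unfolding roots_def by blast
qed

lemma rootsI:
  assumes "\<phi> \<in> dual H" "nonzero_weight \<phi>" "x \<in> root_space H \<phi>" "x \<noteq> 0"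
  shows "\<phi> \<in> roots H"
  using assms unfolding roots_def nonzero_weight_def by auto

text \<open>Existence comes from rescaling a bracket \<open>br e f\<close> with
  \<open>killing e f \<noteq> 0\<close>, uniqueness from nondegeneracy on \<open>H\<close>; hence
  the description operator in \<open>dual_vec\<close> denotes for every root.\<close>

lemma dual_vec:
  assumes "\<phi> \<in> roots H"
  shows "dual_vec H \<phi> \<in> H" "\<And>h. h \<in> H \<Longrightarrow> killing (dual_vec H \<phi>) h = \<phi> h"
proof -
  obtain e where e: "e \<in> root_space H \<phi>" "e \<noteq> 0" using rootsD(3)[OF assms] by blast
  obtain f where f: "f \<in> root_space H (\<lambda>h. - \<phi> h)" "killing e f \<noteq> 0" using root_pair[OF e] by blast
  let ?u = "scale (1 / killing e f) (br e f)"
  have "?u \<in> H"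
    using bracket_in_H[OF e(1) f(1)] subspace_H by (simp add: subspace_scale)
  moreover have "killing ?u h = \<phi> h" if "h \<in> H" for h
    using killing_bracket[OF f(1) that, of e] f(2) by (simp add: killing_scale_left)
  moreover have "v = ?u" if "v \<in> H \<and> (\<forall>h\<in>H. killing v h = \<phi> h)" for v
  proof -
    have "killing (v - ?u) h = 0" if h: "h \<in> H" for h
      using killing_add_left[of v "- ?u" h] calculation(2)[OF h] \<open>v \<in> H \<and> _\<close> h
      by (simp add: killing_minus_left)
    moreover have "v - ?u \<in> H"
      using that \<open>?u \<in> H\<close> subspace_H by (simp add: subspace_diff)
    ultimately show ?thesis using killing_H_nondegenerate[of "v - ?u"] by simp
  qed
  ultimately have "\<exists>!u. u \<in> H \<and> (\<forall>h\<in>H. killing u h = \<phi> h)" by blast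
  then have "dual_vec H \<phi> \<in> H \<and> (\<forall>h\<in>H. killing (dual_vec H \<phi>) h = \<phi> h)"
    unfolding dual_vec_def by (rule theI')
  then show "dual_vec H \<phi> \<in> H" "\<And>h. h \<in> H \<Longrightarrow> killing (dual_vec H \<phi>) h = \<phi> h" by auto
qed

lemma bracket_dual_vec:
  assumes \<phi>: "\<phi> \<in> roots H" and e: "e \<in> root_space H \<phi>" and f: "f \<in> root_space H (\<lambda>h. - \<phi> h)"
  shows "br e f = scale (killing e f) (dual_vec H \<phi>)"
proof -
  let ?v = "br e f - scale (killing e f) (dual_vec H \<phi>)"
  have "?v \<in> H"
    using bracket_in_H[OF e f] dual_vec(1)[OF \<phi>] subspace_H by (simp add: subspace_diff subspace_scale)
  moreover have "killing ?v h = 0" if h: "h \<in> H" for h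
    using killing_add_left[of "br e f" "- scale (killing e f) (dual_vec H \<phi>)" h]
      killing_bracket[OF f h, of e] dual_vec(2)[OF \<phi> h]
    by (simp add: killing_minus_left killing_scale_left)
  ultimately show ?thesis using killing_H_nondegenerate[of ?v] by simp
qed

lemma root_triple:
  assumes \<phi>: "\<phi> \<in> roots H"
  obtains e f where "e \<in> root_space H \<phi>" "e \<noteq> 0" "f \<in> root_space H (\<lambda>h. - \<phi> h)" "br e f = dual_vec H \<phi>"
proof -
  obtain e where e: "e \<in> root_space H \<phi>" "e \<noteq> 0" by (rule bexE[OF rootsD(3)[OF \<phi>]])
  obtain f where f: "f \<in> root_space H (\<lambda>h. - \<phi> h)" "killing e f \<noteq> 0" by (rule bexE[OF root_pair[OF e]])
  have "scale (1 / killing e f) f \<in> root_space H (\<lambda>h. - \<phi> h)"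
    using f(1) by (rule root_space_scale)
  moreover have "br e (scale (1 / killing e f) f) = dual_vec H \<phi>"
    using bracket_dual_vec[OF \<phi> e(1) f(1)] f(2) by (simp add: br_scale_right)
  ultimately show ?thesis by (rule that[OF e])
qed

lemma weight_dual_vec:
  assumes \<phi>: "\<phi> \<in> roots H" and v: "v \<in> root_space H \<psi>" "v \<noteq> 0"
  shows "\<exists>q::int. \<psi> (dual_vec H \<phi>) = \<phi> (dual_vec H \<phi>) * of_int q / 2"
proof -
  obtain e f where "e \<in> root_space H \<phi>" "e \<noteq> 0" "f \<in> root_space H (\<lambda>h. - \<phi> h)"
    "br e f = dual_vec H \<phi>"
    by (rule root_triple[OF \<phi>])
  note ef = this(1,3,4)
  obtain h0 where h0: "h0 \<in> H" "\<phi> h0 \<noteq> 0" using rootsD(2)[OF \<phi>] by (auto simp: nonzero_weight_def)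
  show ?thesis
    using weight_integral[OF ef(1,2) h0 bracket_in_H[OF ef(1,2)] v] unfolding ef(3) .
qed

text \<open>With \<open>t\<close> the dual vector, \<open>\<phi> t = killing t t\<close> is a sum of
  squares of half-integral multiples of \<open>\<phi> t\<close>. Cancelling once leaves
  \<open>\<phi> t\<close> as the inverse of a nonnegative real number.\<close>

lemma root_norm:
  assumes \<phi>: "\<phi> \<in> roots H"
  shows "\<exists>s>0. \<phi> (dual_vec H \<phi>) = of_real s"
proof -
  let ?t = "dual_vec H \<phi>"
  have "\<exists>q::int. wt b ?t = \<phi> ?t * of_int q / 2" if "b \<in> EB" for b
    by (rule weight_dual_vec[OF \<phi> wt_root_space[OF that] EB_nonzero[OF that]])
  then have "\<forall>b\<in>EB. \<exists>q::int. wt b ?t = \<phi> ?t * of_int q / 2" by blast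
  from bchoice[OF this] obtain q :: "'g \<Rightarrow> int" where
    "\<forall>b\<in>EB. wt b ?t = \<phi> ?t * of_int (q b) / 2" ..
  note q = bspec[OF this]
  have "\<phi> ?t \<noteq> 0"
  proof
    assume "\<phi> ?t = 0"
    then have "?t = 0" using q by (intro H_eq_0[OF dual_vec(1)[OF \<phi>]]) simp
    then have "\<phi> h = 0" if "h \<in> H" for h using dual_vec(2)[OF \<phi> that] by simp
    then show False using rootsD(2)[OF \<phi>] by (simp add: nonzero_weight_def)
  qed
  have "\<phi> ?t = killing ?t ?t"
    using dual_vec[OF \<phi>] by simp
  also have "\<dots> = (\<Sum>b\<in>EB. wt b ?t * wt b ?t)"
    using dual_vec(1)[OF \<phi>] by (simp add: killing_H)
  also have "\<dots> = \<phi> ?t * \<phi> ?t * of_real (\<Sum>b\<in>EB. (of_int (q b) / 2) ^ 2)"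
    by (simp add: q sum_distrib_left power2_eq_square mult_ac)
  finally have "\<phi> ?t * of_real (\<Sum>b\<in>EB. (of_int (q b) / 2) ^ 2) = 1"
    using \<open>\<phi> ?t \<noteq> 0\<close> by (simp add: mult.assoc del: of_real_sum)
  then have eq: "\<phi> ?t * of_real S = 1" if "S = (\<Sum>b\<in>EB. (of_int (q b) / 2 :: real) ^ 2)" for S
    using that by blast
  define S where "S = (\<Sum>b\<in>EB. (of_int (q b) / 2 :: real) ^ 2)"
  have "S \<ge> 0" unfolding S_def by (intro sum_nonneg) simp
  moreover have "S \<noteq> 0" using eq[OF S_def] by auto
  ultimately have "0 < inverse S" by simp
  moreover have "\<phi> ?t = of_real (inverse S)"
    using eq[OF S_def] \<open>S \<noteq> 0\<close> by (simp add: field_simps)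
  ultimately show ?thesis by blast
qed

lemma dual_neg: "\<phi> \<in> dual H \<Longrightarrow> (\<lambda>h. - \<phi> h) \<in> dual H"
  by (simp add: dual_def)

lemma dual_add: "\<phi> \<in> dual H \<Longrightarrow> \<psi> \<in> dual H \<Longrightarrow> (\<lambda>h. \<phi> h + \<psi> h) \<in> dual H"
  by (simp add: dual_def algebra_simps)

lemma roots_neg:
  assumes "\<phi> \<in> roots H" shows "(\<lambda>h. - \<phi> h) \<in> roots H"
proof -
  obtain e where e: "e \<in> root_space H \<phi>" "e \<noteq> 0" using rootsD(3)[OF assms] by blast
  obtain f where f: "f \<in> root_space H (\<lambda>h. - \<phi> h)" "killing e f \<noteq> 0" using root_pair[OF e] by blast
  then have "f \<noteq> 0" by auto
  then show ?thesis
    using rootsD[OF assms] f by (intro rootsI dual_neg) (auto simp: nonzero_weight_def)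
qed

lemma dual_form_eq:
  assumes "\<phi> \<in> roots H" "\<psi> \<in> roots H"
  shows "dual_form H \<phi> \<psi> = \<psi> (dual_vec H \<phi>)" "dual_form H \<phi> \<psi> = \<phi> (dual_vec H \<psi>)"
proof -
  show "dual_form H \<phi> \<psi> = \<phi> (dual_vec H \<psi>)"
    using dual_vec[OF assms(1)] dual_vec(1)[OF assms(2)] by (simp add: dual_form_def)
  show "dual_form H \<phi> \<psi> = \<psi> (dual_vec H \<phi>)"
    using dual_vec[OF assms(2)] dual_vec(1)[OF assms(1)] killing_sym[of "dual_vec H \<phi>"]
    by (simp add: dual_form_def)
qed

end

section \<open>Simple roots and the Cartan matrix\<close>

locale simple_root_setting = cartan_setting scale Basis br H
  for scale :: "complex \<Rightarrow> 'g::ab_group_add \<Rightarrow> 'g" and Basis :: "'g set"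
    and br :: "'g \<Rightarrow> 'g \<Rightarrow> 'g" and H :: "'g set" +
  fixes r :: nat and \<alpha> :: "nat \<Rightarrow> 'g \<Rightarrow> complex"
  assumes simple: "simple_roots H r \<alpha>"
begin

abbreviation I\<^sub>r :: "nat set" where "I\<^sub>r \<equiv> {1..r}"

definition comb :: "(nat \<Rightarrow> int) \<Rightarrow> 'g \<Rightarrow> complex" where
  "comb c h = (\<Sum>a\<in>I\<^sub>r. of_int (c a) * \<alpha> a h)"

lemma \<alpha>_root: "a \<in> I\<^sub>r \<Longrightarrow> \<alpha> a \<in> roots H"
  using simple by (simp add: simple_roots_def)

lemma \<alpha>_independent:
  assumes "\<And>h. h \<in> H \<Longrightarrow> (\<Sum>a\<in>I\<^sub>r. c a * \<alpha> a h) = 0" "a \<in> I\<^sub>r" shows "c a = 0"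
  using simple assms unfolding simple_roots_def by blast

lemma comb_unique:
  assumes "\<And>h. h \<in> H \<Longrightarrow> comb c h = comb c' h" "a \<in> I\<^sub>r" shows "c a = c' a"
proof -
  have "(\<Sum>a\<in>I\<^sub>r. of_int (c a - c' a) * \<alpha> a h) = 0" if "h \<in> H" for h
    using assms(1)[OF that] by (simp add: comb_def left_diff_distrib sum_subtractf)
  then have "(of_int (c a - c' a) :: complex) = 0"
    by (rule \<alpha>_independent[OF _ assms(2)])
  then show ?thesis by simp
qed

lemma root_comb:
  assumes "\<beta> \<in> roots H"
  shows "\<exists>c. ((\<forall>a\<in>I\<^sub>r. 0 \<le> c a) \<or> (\<forall>a\<in>I\<^sub>r. c a \<le> 0)) \<and> (\<forall>h\<in>H. \<beta> h = comb c h)"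
  using simple assms unfolding simple_roots_def comb_def by blast

lemma comb_add: "comb c h + comb c' h = comb (\<lambda>a. c a + c' a) h"
  by (simp add: comb_def distrib_right sum.distrib)

lemma comb_neg: "- comb c h = comb (\<lambda>a. - c a) h"
  by (simp add: comb_def sum_negf)

lemma comb_\<alpha>: "a \<in> I\<^sub>r \<Longrightarrow> \<alpha> a h = comb (\<lambda>b. if b = a then 1 else 0) h"
  by (simp add: comb_def if_distrib[of of_int] if_distrib[of "\<lambda>x. x * _"] cong: if_cong)

lemma comb_nonzero:
  assumes "a \<in> I\<^sub>r" "c a \<noteq> 0" shows "\<exists>h\<in>H. comb c h \<noteq> 0"
proof (rule ccontr)
  assume "\<not> ?thesis"
  then have "comb c h = comb (\<lambda>_. 0) h" if "h \<in> H" for h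
    using that by (simp add: comb_def)
  from comb_unique[OF this assms(1)] show False using assms(2) by simp
qed

lemma dual_scale: "\<phi> \<in> dual H \<Longrightarrow> (\<lambda>h. k * \<phi> h) \<in> dual H"
  by (simp add: dual_def algebra_simps)

lemma dual_comb: "comb c \<in> dual H"
proof -
  have "(\<lambda>h. \<Sum>a\<in>A. of_int (c a) * \<alpha> a h) \<in> dual H" if "A \<subseteq> I\<^sub>r" for A
    using finite_subset[OF that finite_atLeastAtMost] that
  proof (induction A rule: finite_induct)
    case empty
    show ?case by (simp add: dual_def)
  next
    case (insert a A)
    then have "(\<lambda>h. of_int (c a) * \<alpha> a h) \<in> dual H"
      using \<alpha>_root rootsD(1) by (intro dual_scale) auto
    then show ?case using insert dual_add by fastforce
  qed
  then show ?thesis unfolding comb_def by blast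
qed

lemma comb_root:
  assumes "x \<in> root_space H (comb c)" "x \<noteq> 0" "a \<in> I\<^sub>r" "c a \<noteq> 0"
  shows "comb c \<in> roots H"
  by (rule rootsI[OF dual_comb _ assms(1,2)])
    (use comb_nonzero[of a c] assms in \<open>simp add: nonzero_weight_def\<close>)

lemma comb_root_sign:
  assumes "comb c \<in> roots H" shows "(\<forall>a\<in>I\<^sub>r. 0 \<le> c a) \<or> (\<forall>a\<in>I\<^sub>r. c a \<le> 0)"
proof -
  obtain c' where c': "(\<forall>a\<in>I\<^sub>r. 0 \<le> c' a) \<or> (\<forall>a\<in>I\<^sub>r. c' a \<le> 0)" "\<forall>h\<in>H. comb c h = comb c' h"
    using root_comb[OF assms] by blast
  then have "c a = c' a" if "a \<in> I\<^sub>r" for a using comb_unique that by blast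
  then show ?thesis using c'(1) by simp
qed

lemma opposite_signs_zero:
  assumes "x \<in> root_space H (comb c)" "a \<in> I\<^sub>r" "0 < c a" "b \<in> I\<^sub>r" "c b < 0"
  shows "x = 0"
  using comb_root[OF assms(1) _ assms(2)] comb_root_sign[of c] assms by fastforce

definition tvec :: "nat \<Rightarrow> 'g" where "tvec a = dual_vec H (\<alpha> a)"

definition len :: "nat \<Rightarrow> real" where "len a = Re (dual_form H (\<alpha> a) (\<alpha> a))"

abbreviation C :: "nat \<Rightarrow> nat \<Rightarrow> int" where "C \<equiv> cartan_matrix H \<alpha>"

definition gram :: "nat \<Rightarrow> nat \<Rightarrow> real" where "gram a b = len a * C a b / 2"

lemma len: "a \<in> I\<^sub>r \<Longrightarrow> 0 < len a" "a \<in> I\<^sub>r \<Longrightarrow> \<alpha> a (tvec a) = of_real (len a)"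
  using root_norm[OF \<alpha>_root[of a]] dual_form_eq[OF \<alpha>_root[of a] \<alpha>_root[of a]]
  by (auto simp: len_def tvec_def)

lemma tvec_H: "a \<in> I\<^sub>r \<Longrightarrow> tvec a \<in> H"
  unfolding tvec_def by (rule dual_vec(1)[OF \<alpha>_root])

text \<open>Integrality of weights makes the quotient in \<open>cartan_matrix\<close> an integer, so
  \<open>Re\<close> and the floor are exact and the entries of \<open>gram\<close> are the values of
  the form.\<close>

lemma \<alpha>_tvec:
  assumes a: "a \<in> I\<^sub>r" and b: "b \<in> I\<^sub>r"
  shows "\<alpha> b (tvec a) = of_real (gram a b)"
proof -
  obtain v where v: "v \<in> root_space H (\<alpha> b)" "v \<noteq> 0"
    using rootsD(3)[OF \<alpha>_root[OF b]] by blast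
  obtain q :: int where q: "\<alpha> b (tvec a) = of_real (len a) * of_int q / 2"
    using weight_dual_vec[OF \<alpha>_root[OF a] v] len(2)[OF a] unfolding tvec_def by auto
  have "dual_form H (\<alpha> a) (\<alpha> b) = of_real (len a) * of_int q / 2"
    using q dual_form_eq(1)[OF \<alpha>_root[OF a] \<alpha>_root[OF b]] by (simp add: tvec_def)
  moreover have "dual_form H (\<alpha> a) (\<alpha> a) = of_real (len a)"
    using len(2)[OF a] dual_form_eq(1)[OF \<alpha>_root[OF a] \<alpha>_root[OF a]] by (simp add: tvec_def)
  ultimately have "2 * dual_form H (\<alpha> a) (\<alpha> b) / dual_form H (\<alpha> a) (\<alpha> a) =
      2 * (of_real (len a) * of_int q / 2) / of_real (len a)"
    by (simp only:)
  also have "\<dots> = of_int q"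
    using len(1)[OF a] by simp
  finally have "C a b = q"
    unfolding cartan_matrix_def by simp
  then show ?thesis using q by (simp add: gram_def)
qed

lemma gram_sym: "a \<in> I\<^sub>r \<Longrightarrow> b \<in> I\<^sub>r \<Longrightarrow> gram a b = gram b a"
  using \<alpha>_tvec[of a b] \<alpha>_tvec[of b a] dual_form_eq[OF \<alpha>_root[of a] \<alpha>_root[of b]]
  by (simp add: tvec_def)

lemma gram_diag: "a \<in> I\<^sub>r \<Longrightarrow> gram a a = len a"
  using \<alpha>_tvec[of a a] len(2)[of a] by simp

lemma C_diag: "a \<in> I\<^sub>r \<Longrightarrow> C a a = 2"
  using gram_diag[of a] len(1)[of a] by (simp add: gram_def)

text \<open>\<open>\<alpha> b - \<alpha> a\<close> has coefficients of both signs, so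
  \<open>f\<close> annihilates a root vector of \<open>\<alpha> b\<close>. That vector is of lowest
  weight for \<open>\<alpha> a\<close>, and \<open>C a b\<close> is minus the number
  \<open>N\<close> of \<open>lowest_weight\<close>.\<close>

lemma C_nonpos:
  assumes a: "a \<in> I\<^sub>r" and b: "b \<in> I\<^sub>r" and ab: "a \<noteq> b"
  shows "C a b \<le> 0"
proof -
  obtain v where v: "v \<in> root_space H (\<alpha> b)" "v \<noteq> 0"
    using rootsD(3)[OF \<alpha>_root[OF b]] by blast
  obtain e f where "e \<in> root_space H (\<alpha> a)" "e \<noteq> 0" "f \<in> root_space H (\<lambda>h. - \<alpha> a h)"
    "br e f = dual_vec H (\<alpha> a)"
    by (rule root_triple[OF \<alpha>_root[OF a]])
  note ef = this(1,3,4)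
  obtain h0 where h0: "h0 \<in> H" "\<alpha> a h0 \<noteq> 0"
    using rootsD(2)[OF \<alpha>_root[OF a]] by (auto simp: nonzero_weight_def)
  let ?c = "\<lambda>x. (if x = b then 1 else 0) - (if x = a then 1 else (0::int))"
  have "(\<lambda>h. - \<alpha> a h + \<alpha> b h) = comb ?c"
    by (rule ext) (simp add: comb_\<alpha>[OF a] comb_\<alpha>[OF b] comb_neg comb_add)
  then have "br f v \<in> root_space H (comb ?c)"
    using root_space_br[OF ef(2) v(1)] by simp
  then have "br f v = 0"
    by (rule opposite_signs_zero[OF _ b _ a]) (use ab in auto)
  then obtain N :: nat where "\<alpha> b (tvec a) = - \<alpha> a (tvec a) * of_nat N / 2"
    using lowest_weight[OF ef(1,2) h0 bracket_in_H[OF ef(1,2)] v] unfolding ef(3) tvec_def by blast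
  then have "of_real (gram a b) = (of_real (- len a * of_nat N / 2) :: complex)"
    using len(2)[OF a] \<alpha>_tvec[OF a b] by simp
  then have "gram a b = - len a * of_nat N / 2"
    by (simp only: of_real_eq_iff)
  then have "len a * (real_of_int (C a b) + real N) = 0"
    by (simp add: gram_def algebra_simps)
  then have "real_of_int (C a b) + real N = 0"
    using len(1)[OF a] by simp
  then show ?thesis by linarith
qed

lemma gram_nonpos: "a \<in> I\<^sub>r \<Longrightarrow> b \<in> I\<^sub>r \<Longrightarrow> a \<noteq> b \<Longrightarrow> gram a b \<le> 0"
  using C_nonpos[of a b] len(1)[of a] by (simp add: gram_def mult_nonneg_nonpos)

text \<open>The double sum equals \<open>killing X X\<close>, a sum of squares of the numbers
  \<open>wt b X\<close>. They are real by integrality on each \<open>tvec a\<close>, and they vanish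
  together only for \<open>X = 0\<close>, which linear independence of the simple roots
  excludes.\<close>

lemma gram_positive:
  fixes x :: "nat \<Rightarrow> real"
  assumes "a0 \<in> I\<^sub>r" "x a0 \<noteq> 0"
  shows "0 < (\<Sum>a\<in>I\<^sub>r. \<Sum>b\<in>I\<^sub>r. x a * x b * gram a b)" (is "0 < ?Q")
proof -
  define X where "X = (\<Sum>a\<in>I\<^sub>r. scale (of_real (x a)) (tvec a))"
  have X: "X \<in> H"
    unfolding X_def using subspace_H tvec_H by (intro subspace_sum subspace_scale) auto
  have kX: "killing X h = (\<Sum>a\<in>I\<^sub>r. of_real (x a) * \<alpha> a h)" if h: "h \<in> H" for h
    unfolding X_def using dual_vec(2)[OF \<alpha>_root h]
    by (simp add: killing_sum_left killing_scale_left tvec_def)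
  have \<alpha>X: "\<alpha> a X = (\<Sum>b\<in>I\<^sub>r. of_real (x b * gram a b))" if a: "a \<in> I\<^sub>r" for a
  proof -
    have "\<alpha> a X = killing X (tvec a)"
      using dual_vec(2)[OF \<alpha>_root[OF a] X] killing_sym by (simp add: tvec_def)
    then show ?thesis using kX[OF tvec_H[OF a]] \<alpha>_tvec[OF a] by simp
  qed
  have "killing X X = of_real ?Q"
    using kX[OF X] \<alpha>X by (simp add: sum_distrib_left mult_ac)
  moreover have "killing X X = (\<Sum>b\<in>EB. wt b X * wt b X)"
    by (rule killing_H[OF X X])
  moreover have "\<exists>y::real. wt b X = of_real y" if b: "b \<in> EB" for b
  proof -
    have wt_real: "wt b (tvec a) \<in> \<real>" if a: "a \<in> I\<^sub>r" for a
    proof -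
      obtain q :: int where "wt b (tvec a) = of_real (len a) * of_int q / 2"
        using weight_dual_vec[OF \<alpha>_root[OF a] wt_root_space[OF b] EB_nonzero[OF b]] len(2)[OF a]
        unfolding tvec_def by auto
      then have "wt b (tvec a) = of_real (len a * of_int q / 2)" by simp
      then show ?thesis by (simp only: Reals_of_real)
    qed
    have "br X b = scale (\<Sum>a\<in>I\<^sub>r. of_real (x a) * wt b (tvec a)) b"
    proof -
      have "br (\<Sum>a\<in>A. scale (of_real (x a)) (tvec a)) b = scale (\<Sum>a\<in>A. of_real (x a) * wt b (tvec a)) b"
        if "A \<subseteq> I\<^sub>r" for A
        using finite_subset[OF that finite_atLeastAtMost] that
        by (induction A rule: finite_induct)
          (use br_wt[OF b] tvec_H in \<open>auto simp: br_add_left br_scale_left scale_left_distrib\<close>)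
      then show ?thesis unfolding X_def by blast
    qed
    then have "wt b X = (\<Sum>a\<in>I\<^sub>r. of_real (x a) * wt b (tvec a))"
      using br_wt[OF b X] EB_nonzero[OF b] by (simp add: scale_cancel_right)
    moreover have "(\<Sum>a\<in>I\<^sub>r. of_real (x a) * wt b (tvec a)) \<in> \<real>"
      using wt_real by (intro sum_in_Reals Reals_mult Reals_of_real)
    ultimately show ?thesis by (auto elim: Reals_cases)
  qed
  then have "\<forall>b\<in>EB. \<exists>y::real. wt b X = of_real y" by blast
  from bchoice[OF this] obtain y :: "'g \<Rightarrow> real" where y: "\<forall>b\<in>EB. wt b X = of_real (y b)" ..
  ultimately have "of_real ?Q = (of_real (\<Sum>b\<in>EB. y b * y b) :: complex)"
    by simp
  then have Q: "?Q = (\<Sum>b\<in>EB. y b * y b)"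
    by (simp only: of_real_eq_iff)
  have "?Q \<noteq> 0"
  proof
    assume "?Q = 0"
    then have "\<forall>b\<in>EB. y b * y b = 0"
      unfolding Q using finite_EB by (subst (asm) sum_nonneg_eq_0_iff) auto
    then have "X = 0" using y by (intro H_eq_0[OF X]) auto
    then have "(\<Sum>a\<in>I\<^sub>r. of_real (x a) * \<alpha> a h) = 0" if "h \<in> H" for h
      using kX[OF that] by simp
    then have "(of_real (x a0) :: complex) = 0"
      by (rule \<alpha>_independent[OF _ assms(1)])
    then show False using assms(2) by simp
  qed
  moreover have "0 \<le> ?Q" unfolding Q by (intro sum_nonneg) simp
  ultimately show ?thesis by linarith
qed

end

section \<open>Connectedness of the Dynkin diagram\<close>

context simple_root_setting
begin

text \<open>Within \<open>I\<^sub>r\<close>, \<open>J\<close> is a union of connected components of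
  the Dynkin diagram.\<close>

definition split_by :: "nat set \<Rightarrow> bool" where
  "split_by J \<longleftrightarrow> (\<forall>a\<in>I\<^sub>r. \<forall>b\<in>I\<^sub>r. (a \<in> J) \<noteq> (b \<in> J) \<longrightarrow> C a b = 0)"

definition mixed :: "nat set \<Rightarrow> (nat \<Rightarrow> int) \<Rightarrow> bool" where
  "mixed J c \<longleftrightarrow> (\<exists>a\<in>I\<^sub>r. \<exists>b\<in>I\<^sub>r. (a \<in> J) \<noteq> (b \<in> J) \<and> c a \<noteq> 0 \<and> c b \<noteq> 0)"

lemma comb_tvec:
  assumes "a \<in> I\<^sub>r" shows "comb c (tvec a) = of_real (\<Sum>b\<in>I\<^sub>r. c b * gram a b)"
  unfolding comb_def using \<alpha>_tvec[OF assms] by simp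

text \<open>The positive norm of the root, expanded along the simple roots, must have a positive
  term.\<close>

lemma descend:
  assumes \<beta>: "comb c \<in> roots H" and pos: "\<And>a. a \<in> I\<^sub>r \<Longrightarrow> 0 \<le> c a"
  shows "\<exists>a\<in>I\<^sub>r. 0 < c a \<and> 0 < (\<Sum>b\<in>I\<^sub>r. c b * gram a b)"
proof (rule ccontr)
  assume neg: "\<not> ?thesis"
  let ?t = "dual_vec H (comb c)"
  have "comb c ?t = (\<Sum>a\<in>I\<^sub>r. of_int (c a) * \<alpha> a ?t)" by (simp add: comb_def)
  also have "\<dots> = (\<Sum>a\<in>I\<^sub>r. of_int (c a) * comb c (tvec a))"
  proof (rule sum.cong)
    fix a assume "a \<in> I\<^sub>r"
    then show "of_int (c a) * \<alpha> a ?t = of_int (c a) * comb c (tvec a)"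
      using dual_form_eq[OF \<beta> \<alpha>_root[of a]] by (simp add: tvec_def)
  qed simp
  also have "\<dots> = of_real (\<Sum>a\<in>I\<^sub>r. c a * (\<Sum>b\<in>I\<^sub>r. c b * gram a b))"
    using comb_tvec by simp
  finally have eq: "comb c ?t = of_real (\<Sum>a\<in>I\<^sub>r. c a * (\<Sum>b\<in>I\<^sub>r. c b * gram a b))" .
  have "(\<Sum>a\<in>I\<^sub>r. c a * (\<Sum>b\<in>I\<^sub>r. c b * gram a b)) \<le> 0"
  proof (rule sum_nonpos)
    fix a assume a: "a \<in> I\<^sub>r"
    show "c a * (\<Sum>b\<in>I\<^sub>r. c b * gram a b) \<le> 0"
    proof (cases "c a = 0")
      case False
      then have "0 < c a" using pos[OF a] by simp
      moreover have "(\<Sum>b\<in>I\<^sub>r. c b * gram a b) \<le> 0"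
        using neg a \<open>0 < c a\<close> by (meson not_le)
      ultimately show ?thesis by (intro mult_nonneg_nonpos) auto
    qed simp
  qed
  moreover obtain s where s: "0 < s" "comb c ?t = of_real s"
    using root_norm[OF \<beta>] by blast
  then have "(\<Sum>a\<in>I\<^sub>r. c a * (\<Sum>b\<in>I\<^sub>r. c b * gram a b)) = s"
    using eq by (simp only: of_real_eq_iff)
  ultimately show False
    using s(1) by simp
qed

text \<open>Induction on the height. Subtracting a simple root \<open>\<alpha> a\<close> of positive
  pairing gives a root which, by induction, is supported on the side of \<open>J\<close> away from
  \<open>a\<close> and hence is orthogonal to \<open>\<alpha> a\<close>. Then \<open>f\<close>
  annihilates the opposite root space, and invariance makes \<open>u = br f v\<close> orthogonal to
  it, against \<open>root_pair\<close>.\<close>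

lemma no_mixed_positive_root:
  assumes J: "split_by J" and \<beta>: "comb c \<in> roots H" and pos: "\<And>a. a \<in> I\<^sub>r \<Longrightarrow> 0 \<le> c a"
  shows "\<not> mixed J c"
  using \<beta> pos
proof (induction "nat (\<Sum>a\<in>I\<^sub>r. c a)" arbitrary: c rule: less_induct)
  case (less c)
  show ?case
  proof
    assume mix: "mixed J c"
    obtain a where a: "a \<in> I\<^sub>r" "0 < c a" "0 < (\<Sum>b\<in>I\<^sub>r. c b * gram a b)"
      using descend[OF less.prems] by blast
    obtain b where b: "b \<in> I\<^sub>r" "c b \<noteq> 0" "(a \<in> J) \<noteq> (b \<in> J)"
      using mix unfolding mixed_def by blast
    then have ab: "a \<noteq> b" by blast
    define c' where "c' x = c x - (if x = a then 1 else 0)" for x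
    obtain e f where ef: "e \<in> root_space H (\<alpha> a)" "e \<noteq> 0" "f \<in> root_space H (\<lambda>h. - \<alpha> a h)"
      and ef_t: "br e f = dual_vec H (\<alpha> a)"
      by (rule root_triple[OF \<alpha>_root[OF a(1)]])
    have t: "br e f = tvec a" using ef_t by (simp add: tvec_def)
    have tH: "br e f \<in> H" unfolding t by (rule tvec_H[OF a(1)])
    obtain h0 where h0: "h0 \<in> H" "\<alpha> a h0 \<noteq> 0"
      using rootsD(2)[OF \<alpha>_root[OF a(1)]] by (auto simp: nonzero_weight_def)
    have shift: "(\<lambda>h. - \<alpha> a h + comb k h) = comb (\<lambda>x. k x - (if x = a then 1 else 0))" for k
      by (rule ext) (simp add: comb_\<alpha>[OF a(1)] comb_neg comb_add)
    obtain v where v: "v \<in> root_space H (comb c)" "v \<noteq> 0"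
      using rootsD(3)[OF less.prems(1)] by blast
    define u where "u = br f v"
    have u: "u \<in> root_space H (comb c')"
      using root_space_br[OF ef(3) v(1)] unfolding shift c'_def u_def .
    \<comment> \<open>Otherwise \<open>v\<close> would be of lowest weight for
      \<open>\<alpha> a\<close>, and its pairing with \<open>\<alpha> a\<close> could not be
      positive.\<close>
    have "u \<noteq> 0"
    proof
      assume "u = 0"
      then obtain N :: nat where "comb c (tvec a) = - \<alpha> a (tvec a) * of_nat N / 2"
        using lowest_weight[OF ef(1,3) h0 tH v] unfolding t u_def by blast
      then have "of_real (\<Sum>b\<in>I\<^sub>r. c b * gram a b) = (of_real (- len a * of_nat N / 2) :: complex)"
        using comb_tvec[OF a(1)] len(2)[OF a(1)] by simp
      then have "(\<Sum>b\<in>I\<^sub>r. c b * gram a b) = - len a * of_nat N / 2"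
        by (simp only: of_real_eq_iff)
      moreover have "0 \<le> len a * of_nat N" using len(1)[OF a(1)] by simp
      ultimately show False using a(3) by simp
    qed
    have cb: "c' b = c b" "0 < c b" using ab b less.prems(2)[OF b(1)] by (auto simp: c'_def)
    have \<gamma>: "comb c' \<in> roots H"
      by (rule comb_root[OF u \<open>u \<noteq> 0\<close> b(1)]) (use cb in simp)
    have c'_pos: "0 \<le> c' x" if "x \<in> I\<^sub>r" for x
      using less.prems(2)[OF that] a(2) by (simp add: c'_def)
    have "(\<Sum>x\<in>I\<^sub>r. c' x) = (\<Sum>x\<in>I\<^sub>r. c x) - 1"
      using a(1) by (simp add: c'_def sum_subtractf)
    moreover have "0 < (\<Sum>x\<in>I\<^sub>r. c x)"
      using a less.prems(2) by (intro sum_pos2[of _ a]) auto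
    ultimately have "nat (\<Sum>x\<in>I\<^sub>r. c' x) < nat (\<Sum>x\<in>I\<^sub>r. c x)" by simp
    from less.hyps[OF this \<gamma> c'_pos] have "\<not> mixed J c'" .
    then have same: "c' x = 0" if "x \<in> I\<^sub>r" "(x \<in> J) = (a \<in> J)" for x
      using that b cb unfolding mixed_def by (metis less_irrefl)
    have \<gamma>_t: "comb c' (tvec a) = 0"
    proof -
      have "c' x * gram a x = 0" if x: "x \<in> I\<^sub>r" for x
      proof (cases "(x \<in> J) = (a \<in> J)")
        case True
        then show ?thesis using same x by simp
      next
        case False
        then have "C a x = 0" using J a(1) x unfolding split_by_def by blast
        then show ?thesis by (simp add: gram_def)
      qed
      then have "(\<Sum>x\<in>I\<^sub>r. c' x * gram a x) = 0" by (intro sum.neutral) blast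
      then show ?thesis unfolding comb_tvec[OF a(1)] by (simp only: of_real_0)
    qed
    \<comment> \<open>\<open>lowest_weight\<close> with \<open>e\<close> and \<open>f\<close>
      exchanged: \<open>e\<close> annihilates \<open>y\<close> by opposite signs, and the weight of
      \<open>y\<close> on \<open>br f e\<close> is zero, so \<open>N = 0\<close>.\<close>
    have "br f y = 0" if y: "y \<in> root_space H (\<lambda>h. - comb c' h)" for y
    proof (cases "y = 0")
      case False
      have "br e y \<in> root_space H (comb (\<lambda>x. (if x = a then 1 else 0) + - c' x))"
      proof -
        have "(\<lambda>h. \<alpha> a h + - comb c' h) = comb (\<lambda>x. (if x = a then 1 else 0) + - c' x)"
          by (rule ext) (simp only: comb_\<alpha>[OF a(1)] comb_neg comb_add)
        then show ?thesis using root_space_br[OF ef(1) y] by simp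
      qed
      then have ey: "br e y = 0"
        by (rule opposite_signs_zero[OF _ a(1) _ b(1)]) (use same[OF a(1)] cb ab in auto)
      have "br f e = - tvec a" using br_anticomm[of f e] t by simp
      then have fH: "br f e \<in> H" using tvec_H[OF a(1)] subspace_H by (simp add: subspace_neg)
      have e': "e \<in> root_space H (\<lambda>h. - (- \<alpha> a h))" using ef(1) by simp
      have val: "\<phi> (br f e) = - \<phi> (tvec a)" if \<phi>: "\<phi> \<in> dual H" for \<phi>
      proof -
        have "\<phi> (scale (- 1) (tvec a)) = - 1 * \<phi> (tvec a)"
          using \<phi> tvec_H[OF a(1)] unfolding dual_def by blast
        then show ?thesis using \<open>br f e = - tvec a\<close> by simp
      qed
      obtain N :: nat where N: "- comb c' (br f e) = - (- \<alpha> a (br f e)) * of_nat N / 2"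
        "N = 0 \<longrightarrow> br f y = 0"
        using lowest_weight[OF ef(3) e' h0(1) _ fH y False ey] h0(2) by auto
      have "- comb c' (br f e) = 0"
        using val[OF dual_comb] \<gamma>_t by simp
      moreover have "\<alpha> a (br f e) \<noteq> 0"
        using val[OF rootsD(1)[OF \<alpha>_root[OF a(1)]]] len[OF a(1)] by simp
      ultimately have "N = 0" using N(1) by simp
      then show ?thesis using N(2) by blast
    qed simp
    then have "killing u y = 0" if "y \<in> root_space H (\<lambda>h. - comb c' h)" for y
      using that br_anticomm[of f v] unfolding u_def
      by (simp add: killing_minus_left killing_invariant)
    then show False
      using root_pair[OF u \<open>u \<noteq> 0\<close>] by blast
  qed
qed

lemma no_mixed_root:
  assumes J: "split_by J" and \<beta>: "comb c \<in> roots H"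
  shows "\<not> mixed J c"
  using comb_root_sign[OF \<beta>]
proof
  assume "\<forall>a\<in>I\<^sub>r. 0 \<le> c a"
  then show ?thesis using no_mixed_positive_root[OF J \<beta>] by blast
next
  assume neg: "\<forall>a\<in>I\<^sub>r. c a \<le> 0"
  have "comb (\<lambda>a. - c a) \<in> roots H"
    using roots_neg[OF \<beta>] unfolding comb_neg .
  then have "\<not> mixed J (\<lambda>a. - c a)"
    by (rule no_mixed_positive_root[OF J]) (use neg in auto)
  then show ?thesis by (simp add: mixed_def)
qed

lemma wt_dual:
  assumes b: "b \<in> EB" shows "wt b \<in> dual H"
proof -
  have "scale (wt b (x + y)) b = scale (wt b x + wt b y) b" if "x \<in> H" "y \<in> H" for x y
    using br_wt[OF b] that subspace_H
    by (metis br_add_left scale_left_distrib subspace_add)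
  moreover have "scale (wt b (scale c x)) b = scale (c * wt b x) b" if "x \<in> H" for c x
    using br_wt[OF b] that subspace_H
    by (metis br_scale_left scale_scale subspace_scale)
  ultimately show ?thesis
    using EB_nonzero[OF b] unfolding dual_def by (simp add: scale_cancel_right wt_def)
qed

lemma EB_cases:
  assumes "b \<in> EB"
  obtains "b \<in> H" | c a where "b \<in> root_space H (comb c)" "comb c \<in> roots H" "a \<in> I\<^sub>r" "c a \<noteq> 0"
proof (cases "nonzero_weight (wt b)")
  case False
  then have "b \<in> H"
    using wt_root_space[OF assms] root_space_0[of "wt b"] by (auto simp: nonzero_weight_def)
  then show ?thesis by (rule that(1))
next
  case True
  have "wt b \<in> roots H"
    by (rule rootsI[OF wt_dual[OF assms] True wt_root_space[OF assms] EB_nonzero[OF assms]])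
  then obtain c where c: "\<forall>h\<in>H. wt b h = comb c h"
    using root_comb by blast
  then have b: "b \<in> root_space H (comb c)"
    using wt_root_space[OF assms] root_space_cong[of "wt b" "comb c"] by simp
  obtain h where "h \<in> H" "comb c h \<noteq> 0" using True c by (auto simp: nonzero_weight_def)
  then obtain a where a: "a \<in> I\<^sub>r" "c a \<noteq> 0"
    unfolding comb_def by (metis (no_types, lifting) mult_eq_0_iff of_int_0 sum.neutral)
  show ?thesis
    by (rule that(2)[OF b comb_root[OF b EB_nonzero[OF assms] a] a])
qed

text \<open>As no root is mixed, the root spaces supported in \<open>J\<close> and the
  \<open>tvec a\<close> with \<open>a \<in> J\<close> span an ideal. It is nonzero and commutes with
  a root vector of \<open>b0\<close>; were it everything, that vector would be central.\<close>

theorem connected: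
  assumes J: "split_by J" and "a0 \<in> I\<^sub>r" "a0 \<in> J" "b0 \<in> I\<^sub>r" "b0 \<notin> J"
  shows False
proof -
  define gens where "gens = {y. \<exists>c. y \<in> root_space H (comb c) \<and> comb c \<in> roots H \<and>
      (\<forall>a\<in>I\<^sub>r. a \<notin> J \<longrightarrow> c a = 0)} \<union> tvec ` (I\<^sub>r \<inter> J)"
  define I where "I = span gens"
  have mixed_zero: "br x y = 0"
    if mz: "x \<in> root_space H (comb c)" "y \<in> root_space H (comb c')" "mixed J (\<lambda>a. c a + c' a)" for x y c c'
  proof (rule ccontr)
    assume nz: "br x y \<noteq> 0"
    have "br x y \<in> root_space H (comb (\<lambda>a. c a + c' a))"
      using root_space_br[OF mz(1,2)] unfolding comb_add .
    moreover obtain a where "a \<in> I\<^sub>r" "c a + c' a \<noteq> 0"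
      using mz(3) unfolding mixed_def by blast
    ultimately have "comb (\<lambda>a. c a + c' a) \<in> roots H"
      using nz by (intro comb_root[of "br x y" _ a])
    then show False using no_mixed_root[OF J] mz(3) by blast
  qed
  have outside: "br x y = 0"
    if x: "x \<in> root_space H (comb c)" "b \<in> I\<^sub>r" "b \<notin> J" "c b \<noteq> 0" "\<And>a. a \<in> I\<^sub>r \<Longrightarrow> a \<in> J \<Longrightarrow> c a = 0"
      and y: "y \<in> gens" for x y c b
  proof -
    consider c' where "y \<in> root_space H (comb c')" "comb c' \<in> roots H" "\<forall>a\<in>I\<^sub>r. a \<notin> J \<longrightarrow> c' a = 0"
      | a where "a \<in> I\<^sub>r" "a \<in> J" "y = tvec a"
      using y unfolding gens_def by blast
    then show ?thesis
    proof cases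
      case 1
      obtain h where "h \<in> H" "comb c' h \<noteq> 0" using rootsD(2)[OF 1(2)] by (auto simp: nonzero_weight_def)
      then obtain a where a: "a \<in> I\<^sub>r" "c' a \<noteq> 0"
        unfolding comb_def by (metis (no_types, lifting) mult_eq_0_iff of_int_0 sum.neutral)
      then have "a \<in> J" using 1(3) by blast
      then have "mixed J (\<lambda>a. c a + c' a)"
        unfolding mixed_def using a x 1(3) by (intro bexI[of _ a] bexI[of _ b]) auto
      then show ?thesis using mixed_zero[OF x(1) 1(1)] by blast
    next
      case 2
      have "c k * gram a k = 0" if k: "k \<in> I\<^sub>r" for k
      proof (cases "k \<in> J")
        case False
        then have "C a k = 0" using J 2 k unfolding split_by_def by blast
        then show ?thesis by (simp add: gram_def)
      qed (use x(5) k in simp)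
      then have "(\<Sum>k\<in>I\<^sub>r. c k * gram a k) = 0" by (intro sum.neutral) blast
      then have "comb c (tvec a) = 0"
        unfolding comb_tvec[OF 2(1)] by (simp only: of_real_0)
      then show ?thesis
        using br_anticomm[of x "tvec a"] root_spaceD[OF x(1) tvec_H[OF 2(1)]] 2(3) by simp
    qed
  qed
  have gen: "br b y \<in> I" if b: "b \<in> EB" and y: "y \<in> gens" for b y
    using b
  proof (cases rule: EB_cases)
    case 1
    consider c' where "y \<in> root_space H (comb c')" | a where "a \<in> I\<^sub>r" "y = tvec a"
      using y unfolding gens_def by blast
    then show ?thesis
    proof cases
      case 1
      then show ?thesis
        using root_spaceD[OF 1 \<open>b \<in> H\<close>] y unfolding I_def by (simp add: span_base span_scale)
    next
      case 2
      then show ?thesis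
        using H_commute[OF \<open>b \<in> H\<close> tvec_H] unfolding I_def by (simp add: span_zero)
    qed
  next
    case (2 c k)
    show ?thesis
    proof (cases "\<forall>a\<in>I\<^sub>r. a \<in> J \<longrightarrow> c a = 0")
      case True
      then have "k \<notin> J" using 2(3,4) by blast
      then show ?thesis
        using outside[OF 2(1,3) _ 2(4) _ y] True unfolding I_def by (simp add: span_zero)
    next
      case False
      then have cJ: "\<forall>a\<in>I\<^sub>r. a \<notin> J \<longrightarrow> c a = 0"
        using no_mixed_root[OF J 2(2)] unfolding mixed_def by blast
      then have bI: "b \<in> I" unfolding I_def gens_def using 2 by (intro span_base) blast
      consider c' where "y \<in> root_space H (comb c')" "comb c' \<in> roots H" "\<forall>a\<in>I\<^sub>r. a \<notin> J \<longrightarrow> c' a = 0"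
        | a where "a \<in> I\<^sub>r" "y = tvec a"
        using y unfolding gens_def by blast
      then show ?thesis
      proof cases
        case c': 1
        have sum: "br b y \<in> root_space H (comb (\<lambda>a. c a + c' a))"
          using root_space_br[OF 2(1) c'(1)] unfolding comb_add .
        show ?thesis
        proof (cases "\<exists>a\<in>I\<^sub>r. c a + c' a \<noteq> 0")
          case True
          then obtain a where a: "a \<in> I\<^sub>r" "c a + c' a \<noteq> 0" by blast
          have "br b y \<in> gens" if "br b y \<noteq> 0"
            using comb_root[OF sum that a] sum cJ c'(3) unfolding gens_def by auto
          then show ?thesis unfolding I_def using span_base span_zero by metis
        next
          case False
          \<comment> \<open>For opposite weights the bracket is a multiple of the dual vector of the
            root, a combination of those \<open>tvec a\<close> with
            \<open>a \<in> J\<close>.\<close>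
          then have "c' a = - c a" if "a \<in> I\<^sub>r" for a using that by force
          then have "comb c' h = - comb c h" for h
            by (simp add: comb_def sum_negf)
          then have "y \<in> root_space H (\<lambda>h. - comb c h)"
            using c'(1) root_space_cong[of "comb c'" "\<lambda>h. - comb c h"] by simp
          then have "br b y = scale (killing b y) (dual_vec H (comb c))"
            by (rule bracket_dual_vec[OF 2(2,1)])
          moreover have "dual_vec H (comb c) = (\<Sum>a\<in>I\<^sub>r. scale (of_int (c a)) (tvec a))"
          proof -
            let ?u = "\<Sum>a\<in>I\<^sub>r. scale (of_int (c a)) (tvec a)"
            have u: "?u \<in> H"
              using subspace_H tvec_H by (intro subspace_sum subspace_scale) auto
            have "killing (dual_vec H (comb c) + - ?u) h = 0" if h: "h \<in> H" for h
              using dual_vec(2)[OF 2(2) h] dual_vec(2)[OF \<alpha>_root h]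
              by (simp only: killing_add_left killing_minus_left)
                (simp add: killing_sum_left killing_scale_left tvec_def comb_def)
            moreover have "dual_vec H (comb c) + - ?u \<in> H"
              using dual_vec(1)[OF 2(2)] u subspace_H by (simp add: subspace_diff)
            ultimately show ?thesis using killing_H_nondegenerate[of "dual_vec H (comb c) + - ?u"] by simp
          qed
          moreover have "(\<Sum>a\<in>I\<^sub>r. scale (of_int (c a)) (tvec a)) \<in> I"
            unfolding I_def
          proof (rule span_sum)
            fix a assume a: "a \<in> I\<^sub>r"
            show "scale (of_int (c a)) (tvec a) \<in> span gens"
            proof (cases "a \<in> J")
              case True
              then have "tvec a \<in> gens" using a unfolding gens_def by blast
              then show ?thesis by (intro span_scale span_base)
            next
              case False
              then show ?thesis using cJ a by (simp add: span_zero)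
            qed
          qed
          ultimately show ?thesis unfolding I_def by (simp add: span_scale)
        qed
      next
        case a: 2
        have "br b y = scale (- comb c (tvec a)) b"
          using br_anticomm[of b "tvec a"] root_spaceD[OF 2(1) tvec_H[OF a(1)]] a(2) by simp
        then show ?thesis using bI unfolding I_def by (simp only: span_scale)
      qed
    qed
  qed
  have "lie_ideal I"
    unfolding I_def by (rule lie_ideal_span[OF gen[unfolded I_def]])
  then consider "I = {0}" | "I = UNIV" using no_ideals by blast
  then show False
  proof cases
    case 1
    have "tvec a0 \<in> I"
      unfolding I_def gens_def using assms(2,3) by (intro span_base) blast
    then have "tvec a0 = 0" using 1 by simp
    then have "\<alpha> a0 h = 0" if "h \<in> H" for h
      using dual_vec(2)[OF \<alpha>_root[OF assms(2)] that] by (simp add: tvec_def)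
    then show False
      using rootsD(2)[OF \<alpha>_root[OF assms(2)]] by (auto simp: nonzero_weight_def)
  next
    case 2
    let ?c = "\<lambda>b. if b = b0 then 1 else (0::int)"
    have "\<alpha> b0 = comb ?c" by (rule ext) (rule comb_\<alpha>[OF assms(4)])
    then obtain x where x: "x \<in> root_space H (comb ?c)" "x \<noteq> 0"
      using rootsD(3)[OF \<alpha>_root[OF assms(4)]] by auto
    have "subspace {y. br x y = 0}"
      by (rule subspaceI) (auto simp: br_add_right br_scale_right)
    moreover have "gens \<subseteq> {y. br x y = 0}"
    proof
      fix y assume "y \<in> gens"
      then have "br x y = 0"
        by (intro outside[OF x(1) assms(4,5)]) (use assms(5) in auto)
      then show "y \<in> {y. br x y = 0}" by simp
    qed
    ultimately have "I \<subseteq> {y. br x y = 0}"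
      unfolding I_def by (rule span_minimal[rotated])
    then have "br x y = 0" for y using 2 by blast
    then show False using central_eq_0[of x] x(2) by blast
  qed
qed

end

section \<open>Lengths of simple roots\<close>

context simple_root_setting
begin

definition form :: "(nat \<Rightarrow> real) \<Rightarrow> (nat \<Rightarrow> real) \<Rightarrow> real" where
  "form x y = (\<Sum>a\<in>I\<^sub>r. \<Sum>b\<in>I\<^sub>r. x a * y b * gram a b)"

definition ind :: "nat set \<Rightarrow> nat \<Rightarrow> real" where
  "ind X a = (if a \<in> X then 1 else 0)"

lemma form_add_left: "form (\<lambda>a. x a + y a) z = form x z + form y z"
  by (simp add: form_def distrib_right sum.distrib)

lemma form_add_right: "form z (\<lambda>a. x a + y a) = form z x + form z y"
  by (simp add: form_def distrib_left distrib_right sum.distrib)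

lemma form_scale_left: "form (\<lambda>a. k * x a) z = k * form x z"
  by (simp add: form_def sum_distrib_left mult_ac)

lemma form_scale_right: "form z (\<lambda>a. k * x a) = k * form z x"
  by (simp add: form_def sum_distrib_left mult_ac)

lemma form_sym: "form x y = form y x"
  unfolding form_def
  by (subst sum.swap, intro sum.cong refl) (simp add: gram_sym mult_ac)

lemma form_ind:
  assumes "X \<subseteq> I\<^sub>r" "Z \<subseteq> I\<^sub>r"
  shows "form (ind X) (ind Z) = (\<Sum>a\<in>X. \<Sum>b\<in>Z. gram a b)"
proof -
  have 1: "(\<Sum>a\<in>I\<^sub>r. ind A a * f a) = (\<Sum>a\<in>A. f a)" if "A \<subseteq> I\<^sub>r" for A f
  proof -
    have "(\<Sum>a\<in>I\<^sub>r. ind A a * f a) = (\<Sum>a\<in>I\<^sub>r. if a \<in> A then f a else 0)"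
      by (intro sum.cong) (auto simp: ind_def)
    also have "\<dots> = (\<Sum>a\<in>I\<^sub>r \<inter> A. f a)" by (simp add: sum.inter_restrict)
    finally show ?thesis using that by (simp add: Int_absorb1)
  qed
  have "form (ind X) (ind Z) = (\<Sum>a\<in>I\<^sub>r. ind X a * (\<Sum>b\<in>I\<^sub>r. ind Z b * gram a b))"
    by (simp add: form_def sum_distrib_left mult_ac)
  then show ?thesis by (simp only: 1 assms)
qed

lemma form_single: "a \<in> I\<^sub>r \<Longrightarrow> b \<in> I\<^sub>r \<Longrightarrow> form (ind {a}) (ind {b}) = gram a b"
  by (simp add: form_ind)

lemma form_positive: "a \<in> I\<^sub>r \<Longrightarrow> x a \<noteq> 0 \<Longrightarrow> 0 < form x x"
  unfolding form_def by (rule gram_positive)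

lemma gram_C: "a \<in> I\<^sub>r \<Longrightarrow> b \<in> I\<^sub>r \<Longrightarrow> len a * C a b = len b * C b a"
  using gram_sym[of a b] by (simp add: gram_def)

lemma gram_square:
  assumes "a \<in> I\<^sub>r" "b \<in> I\<^sub>r"
  shows "gram a b * gram a b = len a * len b * (C a b * C b a) / 4"
proof -
  have "gram a b * gram a b = gram a b * gram b a" using gram_sym assms by simp
  then show ?thesis by (simp add: gram_def)
qed

text \<open>\<open>x\<close> is \<open>\<alpha> a\<close> corrected by its projections onto
  \<open>\<alpha> b\<close> and \<open>\<alpha> e\<close> separately. The remaining cross term in
  \<open>gram b e\<close> is nonpositive, so positivity of the norm bounds the edges at
  \<open>a\<close>, counted with multiplicity.\<close>

lemma star:
  assumes a: "a \<in> I\<^sub>r" and b: "b \<in> I\<^sub>r" and e: "e \<in> I\<^sub>r" and d: "a \<noteq> b" "a \<noteq> e" "b \<noteq> e"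
  shows "C a b * C b a + C a e * C e a < 4"
proof -
  define p where "p = - gram a b / len b"
  define q where "q = - gram a e / len e"
  define x where "x i = ind {a} i + (p * ind {b} i + q * ind {e} i)" for i
  have "0 < form x x"
    by (rule form_positive[OF a]) (use d in \<open>simp add: x_def ind_def\<close>)
  also have "form x x = len a + (p * p * len b + 2 * p * gram a b) + (q * q * len e + 2 * q * gram a e) +
      2 * (p * q) * gram b e"
    unfolding x_def form_add_left form_add_right form_scale_left form_scale_right
    using a b e gram_sym[of a b] gram_sym[of a e] gram_sym[of b e]
    by (simp add: form_single gram_diag algebra_simps)
  also have "p * p * len b + 2 * p * gram a b = - (gram a b * gram a b / len b)"
    using len(1)[OF b] by (simp add: p_def field_simps)
  also have "q * q * len e + 2 * q * gram a e = - (gram a e * gram a e / len e)"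
    using len(1)[OF e] by (simp add: q_def field_simps)
  finally have pos: "0 < len a + - (gram a b * gram a b / len b) + - (gram a e * gram a e / len e) +
      2 * (p * q) * gram b e" .
  have "0 \<le> p" "0 \<le> q"
    using gram_nonpos[OF a b d(1)] gram_nonpos[OF a e d(2)] len(1)[OF b] len(1)[OF e]
    by (simp_all add: p_def q_def divide_nonpos_pos)
  then have "0 \<le> p * q" by simp
  then have "2 * (p * q) * gram b e \<le> 0"
    using gram_nonpos[OF b e d(3)] by (simp add: mult_nonneg_nonpos)
  then have "0 < len a - gram a b * gram a b / len b - gram a e * gram a e / len e"
    using pos by linarith
  also have "\<dots> = len a * (1 - (C a b * C b a) / 4 - (C a e * C e a) / 4)"
    unfolding gram_square[OF a b] gram_square[OF a e]
    using len(1)[OF b] len(1)[OF e] by (simp add: field_simps)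
  finally have "0 < 1 - real_of_int (C a b * C b a) / 4 - real_of_int (C a e * C e a) / 4"
    using len(1)[OF a] by (simp add: zero_less_mult_iff)
  then have "real_of_int (C a b * C b a + C a e * C e a) < real_of_int 4"
    by simp
  then show ?thesis by (simp only: of_int_less_iff)
qed

lemma edge_product:
  assumes a: "a \<in> I\<^sub>r" and b: "b \<in> I\<^sub>r" and d: "a \<noteq> b"
  shows "C a b * C b a < 4"
proof -
  define p where "p = - gram a b / len b"
  define x where "x i = ind {a} i + p * ind {b} i" for i
  have "0 < form x x"
    by (rule form_positive[OF a]) (use d in \<open>simp add: x_def ind_def\<close>)
  also have "form x x = len a + p * p * len b + 2 * p * gram a b"
    unfolding x_def form_add_left form_add_right form_scale_left form_scale_right
    using a b gram_sym[of a b] by (simp add: form_single gram_diag algebra_simps)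
  also have "\<dots> = len a - gram a b * gram a b / len b"
    using len(1)[OF b] by (simp add: p_def field_simps)
  also have "\<dots> = len a * (1 - (C a b * C b a) / 4)"
    unfolding gram_square[OF a b] using len(1)[OF b] by (simp add: field_simps)
  finally have "0 < 1 - real_of_int (C a b * C b a) / 4"
    using len(1)[OF a] by (simp add: zero_less_mult_iff)
  then have "real_of_int (C a b * C b a) < real_of_int 4" by simp
  then show ?thesis by (simp only: of_int_less_iff)
qed

lemma C_zero_sym: "a \<in> I\<^sub>r \<Longrightarrow> b \<in> I\<^sub>r \<Longrightarrow> C a b = 0 \<longleftrightarrow> C b a = 0"
  using gram_C[of a b] len(1)[of a] len(1)[of b] by auto

lemma edge_cases:
  assumes "a \<in> I\<^sub>r" "b \<in> I\<^sub>r" "a \<noteq> b" "C a b \<noteq> 0"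
  shows "C a b = - 1 \<and> C b a \<in> {- 1, - 2, - 3} \<or> C a b \<in> {- 1, - 2, - 3} \<and> C b a = - 1"
proof -
  have "C a b \<le> - 1" "C b a \<le> - 1"
    using C_nonpos[of a b] C_nonpos[of b a] C_zero_sym[of a b] assms by auto
  moreover define u v where "u = - C a b" and "v = - C b a"
  ultimately have uv: "1 \<le> u" "1 \<le> v" by auto
  have p: "u * v < 4" using edge_product[OF assms(1-3)] by (simp add: u_def v_def)
  have "u * 1 \<le> u * v" by (rule mult_left_mono) (use uv in auto)
  then have "u < 4" using p by linarith
  moreover have "1 * v \<le> u * v" by (rule mult_right_mono) (use uv in auto)
  then have "v < 4" using p by linarith
  moreover have "\<not> (2 \<le> u \<and> 2 \<le> v)"
  proof
    assume "2 \<le> u \<and> 2 \<le> v"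
    then have "2 * 2 \<le> u * v" by (intro mult_mono) auto
    then show False using p by simp
  qed
  ultimately have "u = 1 \<and> v \<in> {1, 2, 3} \<or> u \<in> {1, 2, 3} \<and> v = 1"
    using uv by auto
  then show ?thesis unfolding u_def v_def by force
qed

text \<open>By \<open>star\<close>, neither end of a triple edge has room for a further edge;
  connectedness leaves only these two nodes.\<close>

lemma triple_edge:
  assumes a: "a \<in> I\<^sub>r" and b: "b \<in> I\<^sub>r" and d: "a \<noteq> b" and C3: "C a b * C b a = 3"
  shows "type_G2 H r \<alpha>"
proof -
  have "I\<^sub>r \<subseteq> {a, b}"
  proof (rule ccontr)
    assume "\<not> ?thesis"
    then obtain e where e: "e \<in> I\<^sub>r" "e \<notin> {a, b}" by blast
    have "\<not> split_by {a, b}"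
      using connected[of "{a, b}" a e] a e by blast
    then obtain x y where "x \<in> I\<^sub>r" "y \<in> I\<^sub>r" "(x \<in> {a, b}) \<noteq> (y \<in> {a, b})" "C x y \<noteq> 0"
      unfolding split_by_def by blast
    then have "\<exists>x y. x \<in> {a, b} \<and> y \<in> I\<^sub>r \<and> y \<notin> {a, b} \<and> C x y \<noteq> 0"
      using C_zero_sym[of x y] by (cases "x \<in> {a, b}") blast+
    then obtain x y where xy: "x \<in> {a, b}" "y \<in> I\<^sub>r" "y \<notin> {a, b}" "C x y \<noteq> 0" by blast
    have "1 \<le> C x y * C y x"
      using edge_cases[of x y] xy a b by auto
    moreover have "C x y * C y x < 1"
      using star[OF a b xy(2) d] star[OF b a xy(2) d[symmetric]] xy C3 by (auto simp: mult.commute)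
    ultimately show False by simp
  qed
  then have I: "I\<^sub>r = {a, b}" using a b by blast
  have "card I\<^sub>r = card {a, b}" by (rule arg_cong[OF I])
  then have r: "r = 2" using d by simp
  have "{1..r} = {1, 2}" unfolding r by auto
  then have "{a, b} = {1, 2}" by (rule trans[OF I[symmetric]])
  then have ab: "a = 1 \<and> b = 2 \<or> a = 2 \<and> b = 1" unfolding doubleton_eq_iff by blast
  have "C a b \<noteq> 0" using C3 by auto
  then have "C a b = - 1 \<and> C b a = - 3 \<or> C a b = - 3 \<and> C b a = - 1"
    using edge_cases[OF a b d] C3 by auto
  then show ?thesis using ab r unfolding type_G2_def by auto
qed

section \<open>At most two root lengths\<close>

definition maxlen :: real where "maxlen = Max (len ` I\<^sub>r)"

lemma maxlen:
  assumes "a \<in> I\<^sub>r"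
  shows "len a \<le> maxlen" "0 < maxlen" "\<exists>b\<in>I\<^sub>r. len b = maxlen"
    "long_root H r \<alpha> a \<longleftrightarrow> len a = maxlen"
proof -
  have ne: "len ` I\<^sub>r \<noteq> {}" using assms by auto
  show le: "len a \<le> maxlen" unfolding maxlen_def using assms by (intro Max_ge) auto
  then show "0 < maxlen" using len(1)[OF assms] by linarith
  have "maxlen \<in> len ` I\<^sub>r" unfolding maxlen_def using ne by (intro Max_in) auto
  then show ex: "\<exists>b\<in>I\<^sub>r. len b = maxlen" by auto
  have "len b \<le> maxlen" if "b \<in> I\<^sub>r" for b
    unfolding maxlen_def using that by (intro Max_ge) auto
  then show "long_root H r \<alpha> a \<longleftrightarrow> len a = maxlen"
    using ex le unfolding long_root_def len_def[symmetric] by force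
qed

text \<open>The sum over \<open>X\<close> behaves in the form like a single root of half the maximal
  squared length attached to the long root \<open>v0\<close>. Only these inequalities are kept; the
  shape of the chain from \<open>v0\<close> to \<open>w\<close> is forgotten.\<close>

definition half_chain :: "nat \<Rightarrow> nat \<Rightarrow> nat set \<Rightarrow> bool" where
  "half_chain v0 w X \<longleftrightarrow> v0 \<in> I\<^sub>r \<and> len v0 = maxlen \<and> X \<subseteq> I\<^sub>r \<and> w \<in> X \<and> (\<forall>x\<in>X. len x = maxlen / 2) \<and>
     form (ind X) (ind X) \<le> maxlen / 2 \<and> form (ind X) (ind {v0}) \<le> - maxlen / 2"

lemma edge_lengths:
  assumes ab: "a \<in> I\<^sub>r" "b \<in> I\<^sub>r" "a \<noteq> b" "C a b \<noteq> 0" and G2: "\<not> type_G2 H r \<alpha>"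
  shows "len b = len a \<and> gram a b = - len a / 2 \<or> len b = 2 * len a \<and> gram a b = - len a \<or>
    len a = 2 * len b \<and> gram a b = - len b"
proof -
  have "C a b * C b a \<noteq> 3" using triple_edge[OF ab(1-3)] G2 by blast
  then have "C a b = - 1 \<and> C b a \<in> {- 1, - 2} \<or> C a b = - 2 \<and> C b a = - 1"
    using edge_cases[OF ab] by auto
  then show ?thesis
    using gram_C[OF ab(1,2)] by (auto simp: gram_def)
qed

lemma form_ind_le:
  assumes X: "X \<subseteq> I\<^sub>r" "w \<in> X" and u: "u \<in> I\<^sub>r" "u \<notin> X"
  shows "form (ind X) (ind {u}) \<le> gram w u"
proof -
  have fin: "finite X" using X(1) finite_subset by blast
  have "form (ind X) (ind {u}) = gram w u + (\<Sum>a\<in>X - {w}. gram a u)"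
    using X u fin by (simp add: form_ind sum.remove)
  moreover have "(\<Sum>a\<in>X - {w}. gram a u) \<le> 0"
    using X u gram_nonpos by (intro sum_nonpos) blast
  ultimately show ?thesis by simp
qed

text \<open>A second halving would complete the twisted affine diagram \<open>A_{2n}^{(2)}\<close>;
  the inequalities of \<open>half_chain\<close> give its null vector norm at most 0, against
  positive definiteness.\<close>

lemma half_chain_no_quarter:
  assumes X: "half_chain v0 w X" and u: "u \<in> I\<^sub>r" "len u = maxlen / 4"
  shows "gram w u \<noteq> - maxlen / 4"
proof
  assume g: "gram w u = - maxlen / 4"
  have v0: "v0 \<in> I\<^sub>r" "len v0 = maxlen" and XI: "X \<subseteq> I\<^sub>r" "w \<in> X" "\<forall>x\<in>X. len x = maxlen / 2"
    using X by (auto simp: half_chain_def)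
  have M: "0 < maxlen" using maxlen(2)[OF u(1)] .
  have uX: "u \<notin> X" "v0 \<notin> X" "u \<noteq> v0" using XI u v0 M by auto
  \<comment> \<open>Half the null root of that diagram: coefficient 1/2 at the long end, 1
    elsewhere.\<close>
  define x where "x i = ind X i + (1 / 2 * ind {v0} i + 1 * ind {u} i)" for i
  have "form x x = form (ind X) (ind X) + 1 / 4 * len v0 + len u + form (ind X) (ind {v0}) +
      2 * form (ind X) (ind {u}) + gram v0 u"
    unfolding x_def form_add_left form_add_right form_scale_left form_scale_right
    using u v0 gram_sym[of u v0] form_sym[of "ind {u}" "ind X"] form_sym[of "ind {v0}" "ind X"]
    by (simp add: form_single gram_diag algebra_simps)
  also have "\<dots> \<le> maxlen / 2 + 1 / 4 * maxlen + maxlen / 4 - maxlen / 2 + 2 * (- maxlen / 4) + 0"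
    using X form_ind_le[OF XI(1,2) u(1) uX(1)] gram_nonpos[OF v0(1) u(1)] uX g u(2) v0(2)
    unfolding half_chain_def by auto
  also have "\<dots> = 0" by simp
  finally have "form x x \<le> 0" .
  moreover have "0 < form x x"
    by (rule form_positive[OF u(1)]) (use uX in \<open>simp add: x_def ind_def\<close>)
  ultimately show False by simp
qed

text \<open>The cross term, at most \<open>2 * gram w u = - maxlen / 2\<close>, compensates the
  length of \<open>u\<close>, so the bounds survive adding \<open>u\<close> to
  \<open>X\<close>.\<close>

lemma half_chain_extend:
  assumes X: "half_chain v0 w X" and u: "u \<in> I\<^sub>r" "len u = maxlen / 2" "gram w u = - maxlen / 4"
  shows "\<exists>X. half_chain v0 u X"
proof (cases "u \<in> X")
  case True
  then show ?thesis using X unfolding half_chain_def by blast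
next
  case False
  have v0: "v0 \<in> I\<^sub>r" "len v0 = maxlen" and XI: "X \<subseteq> I\<^sub>r" "w \<in> X" "\<forall>x\<in>X. len x = maxlen / 2"
    and f: "form (ind X) (ind X) \<le> maxlen / 2" "form (ind X) (ind {v0}) \<le> - maxlen / 2"
    using X by (auto simp: half_chain_def)
  have M: "0 < maxlen" using maxlen(2)[OF u(1)] .
  have ind: "ind (insert u X) = (\<lambda>i. ind X i + ind {u} i)"
    using False by (auto simp: ind_def)
  have "form (ind (insert u X)) (ind (insert u X)) =
      form (ind X) (ind X) + 2 * form (ind X) (ind {u}) + len u"
    unfolding ind form_add_left form_add_right
    using u form_sym[of "ind {u}" "ind X"] by (simp add: form_single gram_diag)
  also have "\<dots> \<le> maxlen / 2"
    using f(1) form_ind_le[OF XI(1,2) u(1) False] u by simp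
  finally have 1: "form (ind (insert u X)) (ind (insert u X)) \<le> maxlen / 2" .
  have "form (ind (insert u X)) (ind {v0}) = form (ind X) (ind {v0}) + gram u v0"
    unfolding ind form_add_left using u v0 by (simp add: form_single)
  also have "\<dots> \<le> - maxlen / 2"
  proof -
    have "u \<noteq> v0" using u(2) v0(2) M by auto
    then show ?thesis using f(2) gram_nonpos[OF u(1) v0(1)] by simp
  qed
  finally have "half_chain v0 u (insert u X)"
    using v0 XI u 1 by (simp add: half_chain_def)
  then show ?thesis by blast
qed

text \<open>The long nodes and those reached by a half chain are closed under adjacency, because a
  quarter length is excluded. They form a union of components containing a long node, and
  connectedness makes it everything.\<close>

lemma two_lengths:
  assumes G2: "\<not> type_G2 H r \<alpha>" and a: "a \<in> I\<^sub>r"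
  shows "len a = maxlen \<or> len a = maxlen / 2"
proof -
  define J where "J = {a \<in> I\<^sub>r. len a = maxlen \<or> (\<exists>v0 X. half_chain v0 a X)}"
  have M: "0 < maxlen" using maxlen(2)[OF a] .
  have closed: "y \<in> J" if x: "x \<in> J" and y: "y \<in> I\<^sub>r" "C x y \<noteq> 0" for x y
  proof (cases "x = y")
    case xy: False
    have xI: "x \<in> I\<^sub>r" using x by (simp add: J_def)
    note e = edge_lengths[OF xI y(1) xy y(2) G2]
    consider "len x = maxlen" | v0 X where "half_chain v0 x X"
      using x unfolding J_def by blast
    then show ?thesis
    proof cases
      case 1
      then have "len y = maxlen \<or> len y = maxlen / 2 \<and> gram x y = - maxlen / 2"
        using e maxlen(1)[OF y(1)] M by auto
      moreover have "half_chain x y {y}" if "len y = maxlen / 2" "gram x y = - maxlen / 2"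
        using that 1 xI y gram_sym[OF xI y(1)]
        by (simp add: half_chain_def form_single gram_diag)
      ultimately show ?thesis using y unfolding J_def by blast
    next
      case (2 v0 X)
      then have lx: "len x = maxlen / 2" by (auto simp: half_chain_def)
      have "\<not> (len y = maxlen / 4 \<and> gram x y = - maxlen / 4)"
        using half_chain_no_quarter[OF 2 y(1)] by blast
      then have "len y = maxlen \<or> len y = maxlen / 2 \<and> gram x y = - maxlen / 4"
        using e lx by auto
      then show ?thesis
        using half_chain_extend[OF 2 y(1)] y unfolding J_def by blast
    qed
  qed (use x in simp)
  have "split_by J"
    unfolding split_by_def using closed C_zero_sym by blast
  moreover obtain b where "b \<in> I\<^sub>r" "len b = maxlen" using maxlen(3)[OF a] by blast
  then have "b \<in> I\<^sub>r" "b \<in> J" by (auto simp: J_def)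
  ultimately have "a \<in> J" using connected[of J b a] a by blast
  then show ?thesis unfolding J_def half_chain_def by blast
qed

text \<open>Turns the case distinction of \<open>root_t\<close> into a ratio of squared lengths, the
  quantity that symmetrizes the Cartan matrix.\<close>

lemma root_t_len:
  assumes a: "a \<in> I\<^sub>r"
  shows "real (root_t H r \<alpha> a) * len a = maxlen"
proof (cases "type_G2 H r \<alpha>")
  case True
  then have r: "r = 2" and C12: "C 1 2 = - 1 \<and> C 2 1 = - 3 \<or> C 1 2 = - 3 \<and> C 2 1 = - 1"
    by (auto simp: type_G2_def)
  have I: "I\<^sub>r = {1, 2}" unfolding r by auto
  have "len 1 = 3 * len 2 \<or> len 2 = 3 * len 1"
  proof -
    have "len 1 * C 1 2 = len 2 * C 2 1" by (rule gram_C) (simp_all add: r)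
    then show ?thesis using C12 by auto
  qed
  moreover have "maxlen = max (len 1) (len 2)"
    unfolding maxlen_def I by simp
  moreover have "0 < len 1" "0 < len 2" by (rule len(1), simp add: r)+
  moreover have "a = 1 \<or> a = 2" using a I by blast
  ultimately show ?thesis
    using maxlen(4)[OF a] True unfolding root_t_def by auto
next
  case False
  then show ?thesis
    using two_lengths[OF False a] maxlen(4)[OF a] by (auto simp: root_t_def)
qed

theorem M_sum_eq_N_sum_lie:
  "M_sum r C (root_t H r \<alpha>) k l n = N_sum r C (root_t H r \<alpha>) k l n"
proof -
  let ?t = "root_t H r \<alpha>"
  \<comment> \<open>A common multiple of all \<open>t a\<close>. Then \<open>d a\<close>, the
    quotient of \<open>T\<close> by \<open>t a\<close>, is proportional to the squared length of
    \<open>\<alpha> a\<close>, and \<open>d a * t a\<close> is the same for all colours.\<close>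
  define T where "T = (if type_G2 H r \<alpha> then 3 else 2 :: nat)"
  define d where "d a = T div ?t a" for a
  define c where "c a b = nat (- C a b)" for a b
  have td: "d a * ?t a = T" "0 < d a" if "a \<in> I\<^sub>r" for a
    unfolding d_def T_def root_t_def by auto
  have d_len: "real (d a) * maxlen = real T * len a" if a: "a \<in> I\<^sub>r" for a
  proof -
    have "real (d a) * maxlen = real (d a * ?t a) * len a"
      using root_t_len[OF a] by simp
    then show ?thesis using td(1)[OF a] by simp
  qed
  have c: "int (c a b) = - C a b" if "a \<in> I\<^sub>r" "b \<in> I\<^sub>r" "a \<noteq> b" for a b
    using C_nonpos[OF that] by (simp add: c_def)
  interpret cartan_data r c d
  proof
    show "0 < d a" if "a \<in> I\<^sub>r" for a using td(2)[OF that] .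
    show "d a * c a b = d b * c b a" if ab: "a \<in> I\<^sub>r" "b \<in> I\<^sub>r" "a \<noteq> b" for a b
    proof -
      have M: "maxlen \<noteq> 0" using maxlen(2)[OF ab(1)] by simp
      have cr: "real (c a b) = - real_of_int (C a b)" "real (c b a) = - real_of_int (C b a)"
        using c[of a b] c[of b a] ab by (metis of_int_minus of_int_of_nat_eq)+
      have "maxlen * (real (d a) * real (c a b)) = real T * (len a * - C a b)"
        using d_len[OF ab(1)] by (simp add: cr mult_ac)
      also have "\<dots> = real T * (len b * - C b a)"
        using gram_C[OF ab(1,2)] by simp
      also have "\<dots> = maxlen * (real (d b) * real (c b a))"
        using d_len[OF ab(2)] by (simp add: cr mult_ac)
      finally have "real (d a * c a b) = real (d b * c b a)" using M by simp
      then show ?thesis by (simp only: of_nat_eq_iff)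
    qed
    show "c a b \<le> 1 \<or> c b a \<le> 1" if ab: "a \<in> I\<^sub>r" "b \<in> I\<^sub>r" "a \<noteq> b" for a b
      using edge_cases[OF ab] by (cases "C a b = 0") (auto simp: c_def)
  qed
  show ?thesis
  proof (rule M_sum_eq_N_sum)
    show "C a a = 2" if "a \<in> I\<^sub>r" for a by (rule C_diag[OF that])
    show "C a b = - int (c a b)" if "a \<in> I\<^sub>r" "b \<in> I\<^sub>r" "a \<noteq> b" for a b
      using c[OF that] by simp
    show "d a * (?t a * k) = T * k" if "a \<in> I\<^sub>r" for a
      using td(1)[OF that] by (simp flip: mult.assoc)
    show "x b = 0" if x: "\<And>a. a \<in> I\<^sub>r \<Longrightarrow> (\<Sum>b=1..r. C a b * x b) = 0" and b: "b \<in> I\<^sub>r"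
      for x :: "nat \<Rightarrow> int" and b
    proof (rule ccontr)
      assume "x b \<noteq> 0"
      \<comment> \<open>A nonzero kernel vector of the Cartan matrix would have norm zero, as row
        \<open>a\<close> of \<open>gram\<close> is \<open>len a / 2\<close> times that of
        \<open>C\<close>.\<close>
      then have "0 < (\<Sum>a\<in>I\<^sub>r. \<Sum>b\<in>I\<^sub>r. real_of_int (x a) * real_of_int (x b) * gram a b)"
        by (intro gram_positive[OF b]) simp
      also have "\<dots> = (\<Sum>a\<in>I\<^sub>r. real_of_int (x a) * len a / 2 * real_of_int (\<Sum>b\<in>I\<^sub>r. C a b * x b))"
        by (simp add: gram_def sum_distrib_left mult_ac)
      also have "\<dots> = 0"
        using x by (intro sum.neutral) (simp del: of_int_sum)
      finally show False by simp
    qed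
  qed
qed

end

theorem corollary5p19:
  fixes scale :: "complex \<Rightarrow> 'g::ab_group_add \<Rightarrow> 'g"
    and Basis :: "'g set" and br :: "'g \<Rightarrow> 'g \<Rightarrow> 'g"
    and H :: "'g set" and r :: nat and \<alpha> :: "nat \<Rightarrow> 'g \<Rightarrow> complex"
    and C :: "nat \<Rightarrow> nat \<Rightarrow> int" and t :: "nat \<Rightarrow> nat"
    and k :: nat and l :: "nat \<Rightarrow> nat" and n :: "nat \<Rightarrow> nat \<Rightarrow> nat"
  assumes "simple_lie_algebra scale Basis br"
    and "lie_algebra.cartan_subalgebra scale br H"
    and "lie_algebra.simple_roots scale br H r \<alpha>"
    and "C = lie_algebra.cartan_matrix scale Basis br H \<alpha>"
    and "t = lie_algebra.root_t scale Basis br H r \<alpha>"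
    and "k \<ge> 1"
    and "n \<in> collections r t k"
  shows "M_sum r C t k l n = N_sum r C t k l n"
proof -
  interpret simple_lie_algebra scale Basis br by (rule assms(1))
  interpret simple_root_setting scale Basis br H r \<alpha>
    by unfold_locales (use assms(2,3) in auto)
  show ?thesis
    unfolding assms(4,5) by (rule M_sum_eq_N_sum_lie)
qed

end
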